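(* Let $b\in(0,1)$ with $b^2\notin\mathbb{Q}$, $q=e^{\pi i b^2}$, $Q=b+b^{-1}$, and let $\lambda_1,\lambda_2\ge 0$. Define the kernel $$C(x,y,\alpha,z)=\delta(x+y-z)\,\frac{S_b(\frac{Q}{2}+i\alpha-iz)\,S_b(\frac{Q}{2}+i\alpha-i\lambda_1+i\lambda_2)}{S_b(\frac{Q}{2}-iy+i\lambda_2)\,S_b(2i\alpha)}\int_{\mathbb{R}}\frac{e^{\pi(\frac{Q}{2}+ix+i\lambda_1)(r+\alpha-\lambda_1-y)}\,S_b(i\alpha-iy-i\lambda_1+ir)\,S_b(ir)\,S_b(2i\alpha+ir)}{S_b(\frac{Q}{2}+i\alpha-iz+ir)\,S_b(\frac{Q}{2}+i\alpha-i\lambda_1-i\lambda_2+ir)\,S_b(\frac{Q}{2}+i\alpha-i\lambda_1+i\lambda_2+ir)}\,dr ,$$ where the contour in $r$ runs along $\mathbb{R}$, passing below all poles of the factors $S_b(i\alpha-iy-i\lambda_1+ir),\,S_b(ir),\,S_b(2i\alpha+ir)$ and above all poles of the reciprocals of the three factors in the denominator. Then the integral transformation $$f(\alpha,z)\longmapsto F(x,y)=\int_{\mathbb{R}}\int_{\mathbb{R}_+}C(x,y,\alpha,z)f(\alpha,z)\,d\alpha\,dz$$ intertwines the actions of $E$, $F$ and $K$: for each $X\in\{E,F,K\}$, it carries the action of $X$ on $f$ in which, for each fixed $\alpha$, $X$ acts on $f(\alpha,\cdot)$ by the positive representation $\mathcal{P}_\alpha$ (in the variable $z$), to the action of the coproduct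 $\Delta(X)$ on $F$ in the tensor product $\mathcal{P}_{\lambda_1}\otimes\mathcal{P}_{\lambda_2}$ (in the variables $x,y$).
   Context: Quantum dilogarithm. Let $\zeta_b=e^{\frac{\pi i}{2}(\frac{b^2+b^{-2}}{6}+\frac12)}$. For $0<\mathrm{Re}(z)<Q$, $$G_b(z)=\overline{\zeta_b}\exp\Big(-\int_{C}\frac{e^{\pi tz}}{(e^{\pi bt}-1)(e^{\pi b^{-1}t}-1)}\frac{dt}{t}\Big),$$ the contour $C$ running along $\mathbb{R}$ and passing above the pole at $t=0$. $G_b$ extends meromorphically to $\mathbb{C}$ with simple zeros at $Q+nb+mb^{-1}$ and simple poles at $-nb-mb^{-1}$, $n,m\in\mathbb{Z}_{\ge0}$. Set $S_b(x)=e^{\frac{\pi i x(Q-x)}{2}}G_b(x)$. Quantum group. $E,F,K^{\pm1}$ generate the Hopf algebra $\mathcal{U}_q(\mathfrak{sl}_2)$ with relations $KE=q^2EK$, $KF=q^{-2}FK$, $[E,F]=\frac{K-K^{-1}}{q-q^{-1}}$ and coproduct $\Delta(E)=E\otimes1+K\otimes E$, $\Delta(F)=1\otimes F+F\otimes K^{-1}$, $\Delta(K)=K\otimes K$. Positive representations. Write $[w]_q=\frac{q^w-q^{-w}}{q-q^{-1}}$ for $w\in\mathbb{C}$. For $\lambda\ge0$, $\mathcal{P}_\lambda$ acts on $L^2(\mathbb{R},dx)$ by positive essentially self-adjoint unbounded operators $$E=\Big[\tfrac{Q}{2b}+\tfrac{i}{b}(\lambda-x)\Big]_q e^{-2\pi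 bp},\quad F=\Big[\tfrac{Q}{2b}+\tfrac{i}{b}(\lambda+x)\Big]_q e^{2\pi bp},\quad K=e^{-2\pi bx},$$ where $p=\frac{1}{2\pi i}\frac{d}{dx}$, so that $(e^{\pm2\pi bp}f)(x)=f(x\mp ib)$ for functions $f$ analytic in a suitable strip. Domain. The transformation is considered on test functions $f(\alpha,z)$ that are finite linear combinations of products $f_1(\alpha)f_2(z)$, where each $f_i$ is an entire function of the form $e^{-rw^2+sw}P(w)$ with $r>0$, $s\in\mathbb{C}$, $P$ a polynomial. The factor $\delta(x+y-z)$ means that $F(x,y)$ is the integral over $\alpha$ with $z=x+y$ substituted. *)

theory Defs
  imports "HOL-Complex_Analysis.Complex_Analysis"
begin

text \<open>
  Integral of \<open>f\<close> along the horizontal line at height \<open>h\<close>, from left to right.  All contours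
  below run along the real axis apart from avoiding poles; the integrands decay exponentially in
  horizontal strips, so these contours are represented by lines parallel to the real axis.
\<close>

definition line_integral :: "real \<Rightarrow> (complex \<Rightarrow> complex) \<Rightarrow> complex" where
  "line_integral h f = (LINT u|lborel. f (Complex u h))"

definition line_integrable :: "real \<Rightarrow> (complex \<Rightarrow> complex) \<Rightarrow> bool" where
  "line_integrable h f \<longleftrightarrow> integrable lborel (\<lambda>u. f (Complex u h))"


section \<open>Quantum dilogarithm\<close>

definition Qb :: "real \<Rightarrow> real" where
  "Qb b = b + 1 / b"

definition zeta_b :: "real \<Rightarrow> complex" where
  "zeta_b b = exp (pi * \<i> / 2 * ((b^2 + 1 / b^2) / 6 + 1 / 2))"

text \<open>
  The integrand has its poles at \<open>t = 2 i n b\<close> and \<open>t = 2 i n / b\<close> with \<open>n\<close> an integer.  For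
  \<open>0 < b < 1\<close> the lowest one above \<open>0\<close> is \<open>2 i b\<close>, so the line at height \<open>b\<close> passes above the
  pole at \<open>0\<close> and below all the other poles of the upper half plane.
\<close>

definition Gb_strip :: "real \<Rightarrow> complex \<Rightarrow> complex" where
  "Gb_strip b (z::complex) = cnj (zeta_b b) * exp (- line_integral b
     (\<lambda>t::complex. exp (pi * t * z) / ((exp (pi * b * t) - 1) * (exp (pi * t / b) - 1)) / t))"

text \<open>
  The meromorphic extension to the plane; it is unique because \<open>nicely_meromorphic_on\<close> also
  fixes the values (namely \<open>0\<close> at poles).
\<close>

definition Gb :: "real \<Rightarrow> complex \<Rightarrow> complex" where
  "Gb b = (SOME g. g nicely_meromorphic_on UNIV \<and>
                   (\<forall>z. 0 < Re z \<and> Re z < Qb b \<longrightarrow> g z = Gb_strip b z))"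

definition Sb :: "real \<Rightarrow> complex \<Rightarrow> complex" where
  "Sb b (x::complex) = exp (pi * \<i> * x * (of_real (Qb b) - x) / 2) * Gb b x"


section \<open>Positive representations\<close>

text \<open>
  Unbounded shift operators on functions of a real variable: \<open>shift a f x\<close> is \<open>f (x + i a)\<close>,
  where \<open>f\<close> is continued analytically to the closed strip between \<open>\<real>\<close> and \<open>\<real> + i a\<close>.  The
  continuation is unique on that strip when it exists.
\<close>

definition shift_strip :: "real \<Rightarrow> complex set" where
  "shift_strip a = {z. Im z \<in> closed_segment 0 a}"

definition continues :: "real \<Rightarrow> (real \<Rightarrow> complex) \<Rightarrow> (complex \<Rightarrow> complex) \<Rightarrow> bool" where
  "continues a f \<phi> \<longleftrightarrow> \<phi> analytic_on shift_strip a \<and> (\<forall>x::real. \<phi> (of_real x) = f x)"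

definition shiftable :: "real \<Rightarrow> (real \<Rightarrow> complex) \<Rightarrow> bool" where
  "shiftable a f \<longleftrightarrow> (\<exists>\<phi>. continues a f \<phi>)"

definition shift :: "real \<Rightarrow> (real \<Rightarrow> complex) \<Rightarrow> real \<Rightarrow> complex" where
  "shift a f x = (SOME \<phi>. continues a f \<phi>) (Complex x a)"

text \<open>
  Complex powers are principal.  For \<open>0 < b < 1\<close> the argument \<open>\<pi> b\<^sup>2\<close> of \<open>q\<close> lies in
  \<open>(0, \<pi>)\<close>, so \<open>q powr w = exp (\<pi> i b\<^sup>2 w)\<close>.
\<close>

definition qpar :: "real \<Rightarrow> complex" where
  "qpar b = exp (pi * \<i> * b^2)"

definition qnum :: "complex \<Rightarrow> complex \<Rightarrow> complex" where
  "qnum q w = (q powr w - q powr (- w)) / (q - inverse q)"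

datatype gen = Unit | E | F | K | Kinv

fun act :: "real \<Rightarrow> real \<Rightarrow> gen \<Rightarrow> (real \<Rightarrow> complex) \<Rightarrow> (real \<Rightarrow> complex)" where
  "act b l Unit f = f"
| "act b l E f = (\<lambda>x. qnum (qpar b) (Qb b / (2 * b) + \<i> / b * (l - x)) * shift b f x)"
| "act b l F f = (\<lambda>x. qnum (qpar b) (Qb b / (2 * b) + \<i> / b * (l + x)) * shift (- b) f x)"
| "act b l K f = (\<lambda>x. of_real (exp (- 2 * pi * b * x)) * f x)"
| "act b l Kinv f = (\<lambda>x. of_real (exp (2 * pi * b * x)) * f x)"

fun in_domain :: "real \<Rightarrow> gen \<Rightarrow> (real \<Rightarrow> complex) \<Rightarrow> bool" where
  "in_domain b E f \<longleftrightarrow> shiftable b f"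
| "in_domain b F f \<longleftrightarrow> shiftable (- b) f"
| "in_domain b _ f \<longleftrightarrow> True"

text \<open>The coproduct, as the list of the pure tensors whose sum it is.\<close>

fun coproduct :: "gen \<Rightarrow> (gen \<times> gen) list" where
  "coproduct Unit = [(Unit, Unit)]"
| "coproduct E = [(E, Unit), (K, E)]"
| "coproduct F = [(Unit, F), (F, Kinv)]"
| "coproduct K = [(K, K)]"
| "coproduct Kinv = [(Kinv, Kinv)]"

definition tensor_act ::
  "real \<Rightarrow> real \<Rightarrow> real \<Rightarrow> gen \<times> gen \<Rightarrow> (real \<Rightarrow> real \<Rightarrow> complex) \<Rightarrow> (real \<Rightarrow> real \<Rightarrow> complex)" where
  "tensor_act b l\<^sub>1 l\<^sub>2 XY \<Phi> =
     (\<lambda>x y. act b l\<^sub>1 (fst XY) (\<lambda>x'. act b l\<^sub>2 (snd XY) (\<Phi> x') y) x)"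

definition in_tensor_domain ::
  "real \<Rightarrow> real \<Rightarrow> gen \<times> gen \<Rightarrow> (real \<Rightarrow> real \<Rightarrow> complex) \<Rightarrow> bool" where
  "in_tensor_domain b l\<^sub>2 XY \<Phi> \<longleftrightarrow>
     (\<forall>x. in_domain b (snd XY) (\<Phi> x)) \<and>
     (\<forall>y. in_domain b (fst XY) (\<lambda>x. act b l\<^sub>2 (snd XY) (\<Phi> x) y))"

definition coproduct_act ::
  "real \<Rightarrow> real \<Rightarrow> real \<Rightarrow> gen \<Rightarrow> (real \<Rightarrow> real \<Rightarrow> complex) \<Rightarrow> (real \<Rightarrow> real \<Rightarrow> complex)" where
  "coproduct_act b l\<^sub>1 l\<^sub>2 X \<Phi> = (\<lambda>x y. \<Sum>XY\<leftarrow>coproduct X. tensor_act b l\<^sub>1 l\<^sub>2 XY \<Phi> x y)"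

definition in_coproduct_domain :: "real \<Rightarrow> real \<Rightarrow> gen \<Rightarrow> (real \<Rightarrow> real \<Rightarrow> complex) \<Rightarrow> bool" where
  "in_coproduct_domain b l\<^sub>2 X \<Phi> \<longleftrightarrow> (\<forall>XY\<in>set (coproduct X). in_tensor_domain b l\<^sub>2 XY \<Phi>)"


section \<open>The integral transformation\<close>

definition kernel_integrand ::
  "real \<Rightarrow> real \<Rightarrow> real \<Rightarrow> real \<Rightarrow> real \<Rightarrow> real \<Rightarrow> real \<Rightarrow> complex \<Rightarrow> complex" where
  "kernel_integrand b l\<^sub>1 l\<^sub>2 x y \<alpha> z (r::complex) =
     exp (pi * (Qb b / 2 + \<i> * x + \<i> * l\<^sub>1) * (r + \<alpha> - l\<^sub>1 - y))
     * Sb b (\<i> * \<alpha> - \<i> * y - \<i> * l\<^sub>1 + \<i> * r) * Sb b (\<i> * r) * Sb b (2 * \<i> * \<alpha> + \<i> * r)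
     / (Sb b (Qb b / 2 + \<i> * \<alpha> - \<i> * z + \<i> * r)
        * Sb b (Qb b / 2 + \<i> * \<alpha> - \<i> * l\<^sub>1 - \<i> * l\<^sub>2 + \<i> * r)
        * Sb b (Qb b / 2 + \<i> * \<alpha> - \<i> * l\<^sub>1 + \<i> * l\<^sub>2 + \<i> * r))"

text \<open>
  The line at height \<open>h\<close> passes below the poles of the numerator factors and above those of the
  reciprocals of the denominator factors.  Since all parameters are real, the former have
  imaginary part at least \<open>0\<close> and the latter at most \<open>- Q / 2\<close>, so the admissible heights are
  those with \<open>- Q / 2 < h < 0\<close>.
\<close>

definition separates ::
  "real \<Rightarrow> real \<Rightarrow> real \<Rightarrow> real \<Rightarrow> real \<Rightarrow> real \<Rightarrow> real \<Rightarrow> bool" where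
  "separates b l\<^sub>1 l\<^sub>2 y \<alpha> z h \<longleftrightarrow>
     (\<forall>r. is_pole (\<lambda>r::complex. Sb b (\<i> * \<alpha> - \<i> * y - \<i> * l\<^sub>1 + \<i> * r)) r
          \<or> is_pole (\<lambda>r::complex. Sb b (\<i> * r)) r
          \<or> is_pole (\<lambda>r::complex. Sb b (2 * \<i> * \<alpha> + \<i> * r)) r
          \<longrightarrow> h < Im r) \<and>
     (\<forall>r. is_pole (\<lambda>r::complex. 1 / Sb b (Qb b / 2 + \<i> * \<alpha> - \<i> * z + \<i> * r)) r
          \<or> is_pole (\<lambda>r::complex. 1 / Sb b (Qb b / 2 + \<i> * \<alpha> - \<i> * l\<^sub>1 - \<i> * l\<^sub>2 + \<i> * r)) r
          \<or> is_pole (\<lambda>r::complex. 1 / Sb b (Qb b / 2 + \<i> * \<alpha> - \<i> * l\<^sub>1 + \<i> * l\<^sub>2 + \<i> * r)) r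
          \<longrightarrow> Im r < h)"

text \<open>
  The kernel without its factor \<open>\<delta>(x + y - z)\<close>; \<open>h\<close> is the height of the contour in \<open>r\<close>.
\<close>

definition cg_kernel ::
  "real \<Rightarrow> real \<Rightarrow> real \<Rightarrow> real \<Rightarrow> real \<Rightarrow> real \<Rightarrow> real \<Rightarrow> real \<Rightarrow> complex" where
  "cg_kernel b l\<^sub>1 l\<^sub>2 h x y \<alpha> z =
     Sb b (Qb b / 2 + \<i> * \<alpha> - \<i> * z) * Sb b (Qb b / 2 + \<i> * \<alpha> - \<i> * l\<^sub>1 + \<i> * l\<^sub>2)
     / (Sb b (Qb b / 2 - \<i> * y + \<i> * l\<^sub>2) * Sb b (2 * \<i> * \<alpha>))
     * line_integral h (kernel_integrand b l\<^sub>1 l\<^sub>2 x y \<alpha> z)"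

text \<open>
  The contour may be chosen separately for every kernel value: its height is \<open>h x y \<alpha>\<close>.
  The factor \<open>\<delta>(x + y - z)\<close> removes the integral over \<open>z\<close> and substitutes \<open>z = x + y\<close>.
\<close>

definition transform ::
  "real \<Rightarrow> real \<Rightarrow> real \<Rightarrow> (real \<Rightarrow> real \<Rightarrow> real \<Rightarrow> real) \<Rightarrow> (real \<Rightarrow> real \<Rightarrow> complex)
   \<Rightarrow> (real \<Rightarrow> real \<Rightarrow> complex)" where
  "transform b l\<^sub>1 l\<^sub>2 h f =
     (\<lambda>x y. LINT \<alpha>:{0..}|lborel. cg_kernel b l\<^sub>1 l\<^sub>2 (h x y \<alpha>) x y \<alpha> (x + y) * f \<alpha> (x + y))"

definition transform_converges ::
  "real \<Rightarrow> real \<Rightarrow> real \<Rightarrow> (real \<Rightarrow> real \<Rightarrow> real \<Rightarrow> real) \<Rightarrow> (real \<Rightarrow> real \<Rightarrow> complex) \<Rightarrow> bool" where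
  "transform_converges b l\<^sub>1 l\<^sub>2 h f \<longleftrightarrow>
     (\<forall>x y. \<forall>\<alpha>\<ge>0. line_integrable (h x y \<alpha>) (kernel_integrand b l\<^sub>1 l\<^sub>2 x y \<alpha> (x + y))) \<and>
     (\<forall>x y. set_integrable lborel {0..}
        (\<lambda>\<alpha>. cg_kernel b l\<^sub>1 l\<^sub>2 (h x y \<alpha>) x y \<alpha> (x + y) * f \<alpha> (x + y)))"

definition gauss_poly :: "(complex \<Rightarrow> complex) set" where
  "gauss_poly = {g. \<exists>(r::real) (s::complex) (P::complex poly).
                      (0::real) < r \<and> g = (\<lambda>w::complex. exp (- of_real r * w^2 + s * w) * poly P w)}"

definition test_function :: "(real \<Rightarrow> real \<Rightarrow> complex) \<Rightarrow> bool" where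
  "test_function f \<longleftrightarrow> (\<exists>(n::nat) (a :: nat \<Rightarrow> complex) g\<^sub>1 g\<^sub>2.
     (\<forall>j<n. g\<^sub>1 j \<in> gauss_poly \<and> g\<^sub>2 j \<in> gauss_poly) \<and>
     f = (\<lambda>\<alpha> z. \<Sum>j<n. a j * g\<^sub>1 j (of_real \<alpha>) * g\<^sub>2 j (of_real z)))"

end

theory Submission
  imports Defs
begin

text \<open>
  All arguments of the quantum dilogarithm that occur can be kept in the strip \<open>0 < Re < Q\<close>,
  where \<open>Sb\<close> is given by the integral; the meromorphic continuation only matters for
  \<open>1 / Sb (2 i \<alpha>)\<close> and for the poles that confine the contour height to \<open>- Q / 2 < h < 0\<close>.
  In the strip the integral representation yields \<open>Sb (w + b) = 2 sin (\<pi> b w) Sb w\<close>, and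
  moving its contour across the pole at \<open>0\<close> yields that \<open>Sb w * Sb (Q - w)\<close> is constant; together
  with boundedness of the integral for \<open>Im w \<ge> 0\<close> this gives the exact exponential growth of \<open>Sb\<close>
  on vertical lines.  Hence all integrals converge absolutely and may be continued in \<open>x\<close> and \<open>y\<close>.

  Applying the functional equation to the shifted kernels, the relation for \<open>E\<close> is an identity
  between the integrands in \<open>r\<close>, and that for \<open>K\<close> is immediate.  For \<open>F\<close> the two sides differ by a
  multiple of \<open>g r - g (r - i b)\<close> with \<open>g\<close> holomorphic and decaying between the two lines, so that
  the difference integrates to \<open>0\<close>.
\<close>

section \<open>Integrals over horizontal lines\<close>

text \<open>Putting \<open>z = x + y\<close> makes a shift of \<open>x\<close> alone and a shift of
  \<open>y\<close> alone move the argument of \<open>f\<close> by the same amount, so the shifted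
  \<open>f\<close> is a common factor and each intertwining relation becomes one between kernels.
  The delicate choice is the height \<open>- k\<close> of the line in \<open>r\<close>. Raising
  \<open>Im x\<close> or \<open>Im y\<close> by \<open>b\<close>, as for \<open>E\<close>, pushes a
  denominator argument of real part \<open>Q / 2 + k\<close> up by \<open>b\<close>, so
  \<open>k < Q / 2 - b\<close> is required; lowering \<open>Im y\<close> by \<open>b\<close>, as for
  \<open>F\<close>, pushes a numerator argument from \<open>k\<close> down to \<open>k - b\<close>,
  so \<open>k > b\<close> is required. Both ranges meet \<open>0 < k < Q / 2\<close> because
  \<open>b < 1 / b\<close> gives \<open>b < Q / 2\<close>. Hence the transform is rewritten as
  \<open>Phi k\<close>, an integral with one fixed height that is chosen for each generator; at real
  points the height is immaterial. The rate of decay in \<open>r\<close> obtained for the kernel is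
  \<open>pi * (Q + 2 * Im x)\<close>, in which neither \<open>k\<close> nor \<open>y\<close> occurs,
  and \<open>b < Q / 2\<close> again keeps it positive at \<open>Im x = - b\<close>.\<close>

lemma integrable_exp_minus_abs:
  fixes d :: real
  assumes "0 < d"
  shows "integrable lborel (\<lambda>u::real. exp (- d * \<bar>u\<bar>))"
proof -
  have "set_integrable lebesgue {0..} (\<lambda>u::real. exp (- d * u))"
    using integrable_on_exp_minus_to_infinity[OF assms, of 0]
    by (intro nonnegative_absolutely_integrable_1) auto
  then have "set_integrable lborel {0..} (\<lambda>u::real. exp (- d * u))"
    unfolding set_integrable_def by (subst (asm) integrable_completion) auto
  then have 1: "integrable lborel (\<lambda>u. indicator {0..} u *\<^sub>R exp (- d * u))"
    by (simp add: set_integrable_def)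
  have 2: "integrable lborel (\<lambda>u. indicator {0..} (-u) *\<^sub>R exp (- d * (-u)))"
    using lborel_integrable_real_affine[OF 1, of "-1" 0] by simp
  show ?thesis
    by (rule Bochner_Integration.integrable_bound[OF Bochner_Integration.integrable_add[OF 1 2]])
       (auto split: split_indicator)
qed

text \<open>An affine change of variable; it links the path integrals of Cauchy's theorem to the
  real integrals behind \<open>line_integral\<close>.\<close>

lemma has_contour_integral_linepath_same_Im_iff:
  assumes "a < c"
  shows "(f has_contour_integral I) (linepath (Complex a h) (Complex c h)) \<longleftrightarrow>
         ((\<lambda>x. f (Complex x h)) has_integral I) {a..c}"
proof -
  have "(f has_contour_integral I) (linepath (Complex a h) (Complex c h)) \<longleftrightarrow>
          ((\<lambda>x. f (Complex (a + (c - a) * x) h) * of_real (c - a)) has_integral I) {0..1}"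
    unfolding has_contour_integral_linepath
    by (intro has_integral_cong arg_cong2[of _ _ _ _ "(*)"] arg_cong[of _ _ f])
       (auto simp: linepath_def complex_eq_iff algebra_simps)
  also have "{0..1} = (\<lambda>x. x / (c - a)) ` {0..c-a}"
    using assms by simp
  also have "((\<lambda>x. f (Complex (a + (c - a) * x) h) * of_real (c - a)) has_integral I) \<dots> \<longleftrightarrow>
             ((\<lambda>x. f (Complex (a + x) h) * of_real (c - a)) has_integral ((c-a) *\<^sub>R I)) {0..c-a}"
    by (subst has_integral_stretch_real_iff) (use assms in simp_all)
  also have "\<dots> \<longleftrightarrow> ((\<lambda>x. of_real (c-a) * f (Complex x h)) has_integral (c-a) *\<^sub>R I) {a..c}"
    by (subst has_integral_shift_real_ivl_iff[where c = "-a"])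
       (simp_all add: scaleR_conv_of_real mult_ac)
  also have "\<dots> \<longleftrightarrow> ((\<lambda>x. f (Complex x h)) has_integral I) {a..c}"
    by (subst has_integral_mult_right_iff) (use assms in \<open>auto simp: scaleR_conv_of_real\<close>)
  finally show ?thesis .
qed

lemma continuous_on_Complex_line: "continuous_on A (\<lambda>u. Complex u h)"
  by (auto simp: Complex_eq intro!: continuous_intros)

text \<open>A continuous function is bounded on the compact middle part, so decay is demanded only
  for \<open>Rb \<le> \<bar>Re z\<bar>\<close>. This matters for lines that pass a pole, where the
  available estimates hold only away from it.\<close>

lemma line_integrable_exp_decay:
  assumes cont: "continuous_on {z. Im z = h} f"
    and bound: "\<And>z. Im z = h \<Longrightarrow> Rb \<le> \<bar>Re z\<bar> \<Longrightarrow> norm (f z) \<le> C * exp (- d * \<bar>Re z\<bar>)"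
    and d: "0 < d"
  shows "line_integrable h f"
proof -
  have cf: "continuous_on UNIV (\<lambda>u. f (Complex u h))"
    by (rule continuous_on_compose2[OF cont continuous_on_Complex_line]) auto
  have "bounded ((\<lambda>u. f (Complex u h)) ` {-Rb..Rb})"
    by (intro compact_imp_bounded compact_continuous_image continuous_on_subset[OF cf]) auto
  then obtain B where B: "\<And>u. \<bar>u\<bar> \<le> Rb \<Longrightarrow> norm (f (Complex u h)) \<le> B"
    by (fastforce simp: bounded_iff)
  \<comment> \<open>The factor \<open>exp (d * Rb)\<close> compensates for the smallest value that
    \<open>exp (- d * \<bar>u\<bar>)\<close> takes on the middle part.\<close>
  define C' where "C' = max \<bar>C\<bar> (\<bar>B\<bar> * exp (d * Rb))"
  have C': "norm (f (Complex u h)) \<le> C' * exp (- d * \<bar>u\<bar>)" for u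
  proof (cases "Rb \<le> \<bar>u\<bar>")
    case True
    have "norm (f (Complex u h)) \<le> C * exp (- d * \<bar>u\<bar>)"
      using bound[of "Complex u h"] True by simp
    also have "\<dots> \<le> C' * exp (- d * \<bar>u\<bar>)" by (intro mult_right_mono) (auto simp: C'_def)
    finally show ?thesis .
  next
    case False
    have "norm (f (Complex u h)) \<le> \<bar>B\<bar> * 1" using B[of u] False by simp
    also have "\<dots> \<le> \<bar>B\<bar> * exp (d * Rb - d * \<bar>u\<bar>)"
      using False d by (intro mult_left_mono) (auto simp: right_diff_distrib[symmetric])
    also have "\<dots> = (\<bar>B\<bar> * exp (d * Rb)) * exp (- d * \<bar>u\<bar>)" by (simp add: exp_diff exp_minus divide_inverse)
    also have "\<dots> \<le> C' * exp (- d * \<bar>u\<bar>)" by (intro mult_right_mono) (auto simp: C'_def)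
    finally show ?thesis .
  qed
  show ?thesis
    unfolding line_integrable_def
    by (rule Bochner_Integration.integrable_bound[OF integrable_mult_right[OF integrable_exp_minus_abs[OF d], of C']])
       (use cf C' in \<open>auto intro!: borel_measurable_continuous_onI order.trans[OF C'] simp: abs_mult\<close>)
qed

text \<open>In the rectangle with vertical sides at real parts \<open>R\<close> and
  \<open>- R\<close>, these sides contribute at most a multiple of \<open>exp (- d * R)\<close>,
  while the horizontal ones tend to the two line integrals. Leaving the value \<open>V\<close> open
  serves both Cauchy's theorem (\<open>V = 0\<close>) and the residue at a simple pole.\<close>

lemma line_integral_diff_rectpath:
  assumes "h1 < h2"
    and cont: "continuous_on {z. Im z = h1} f" "continuous_on {z. Im z = h2} f"
    and cont': "\<And>u. Rb \<le> \<bar>u\<bar> \<Longrightarrow> continuous_on {z. Re z = u \<and> h1 \<le> Im z \<and> Im z \<le> h2} f"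
    and bound: "\<And>z. h1 \<le> Im z \<Longrightarrow> Im z \<le> h2 \<Longrightarrow> Rb \<le> \<bar>Re z\<bar> \<Longrightarrow>
                  norm (f z) \<le> C * exp (- d * \<bar>Re z\<bar>)"
    and d: "0 < d"
    and V: "\<And>R. Rb < R \<Longrightarrow> 0 < R \<Longrightarrow> (f has_contour_integral V) (rectpath (Complex (-R) h1) (Complex R h2))"
  shows "line_integral h1 f - line_integral h2 f = V"
proof -
  have li: "line_integrable h1 f" "line_integrable h2 f"
    using assms by (auto intro!: line_integrable_exp_decay[where Rb=Rb and C=C and d=d])
  define X where "X h R = integral {-R..R} (\<lambda>u. f (Complex u h))" for h and R :: real
  have lim: "(\<lambda>n. X h (real n)) \<longlonglongrightarrow> line_integral h f" if "line_integrable h f" for h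
  proof -
    have i: "integrable lborel (\<lambda>u. f (Complex u h))"
      using that by (simp add: line_integrable_def)
    then have m[measurable]: "(\<lambda>u. f (Complex u h)) \<in> borel_measurable borel" by auto
    have "(\<lambda>n. LINT u|lborel. indicator {-real n..real n} u *\<^sub>R f (Complex u h)) \<longlonglongrightarrow> (LINT u|lborel. f (Complex u h))"
    proof (rule integral_dominated_convergence[where w="\<lambda>u. norm (f (Complex u h))"])
      show "AE u in lborel. (\<lambda>n. indicator {-real n..real n} u *\<^sub>R f (Complex u h)) \<longlonglongrightarrow> f (Complex u h)"
      proof (intro AE_I2 tendsto_eventually)
        fix u :: real
        have "\<forall>\<^sub>F n in sequentially. \<bar>u\<bar> \<le> real n"
          using filterlim_real_sequentially by (simp add: filterlim_at_top)
        then show "\<forall>\<^sub>F n in sequentially. indicator {-real n..real n} u *\<^sub>R f (Complex u h) = f (Complex u h)"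
          by eventually_elim (auto simp: abs_le_iff)
      qed
    qed (use i in \<open>auto intro!: AE_I2 split: split_indicator\<close>)
    moreover have "(LINT u|lborel. indicator {-real n..real n} u *\<^sub>R f (Complex u h)) = X h (real n)" for n
    proof -
      have "set_integrable lborel {-real n..real n} (\<lambda>u. f (Complex u h))"
        unfolding set_integrable_def using i by (intro integrable_mult_indicator) auto
      then show ?thesis unfolding X_def
        by (metis set_borel_integral_eq_integral(2) set_lebesgue_integral_def)
    qed
    ultimately show ?thesis by (simp add: line_integral_def)
  qed
  have est: "norm (X h1 R - X h2 R - V) \<le> 2 * (C * exp (- d * R) * (h2 - h1))"
    if R: "Rb < R" "0 < R" for R
  proof -
    have ci: "f contour_integrable_on (rectpath (Complex (-R) h1) (Complex R h2))"
      using V[OF R] by (auto simp: contour_integrable_on_def)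
    define f1 where "f1 = contour_integral (linepath (Complex (-R) h1) (Complex R h1)) f"
    define f2 where "f2 = contour_integral (linepath (Complex R h1) (Complex R h2)) f"
    define f3 where "f3 = contour_integral (linepath (Complex R h2) (Complex (-R) h2)) f"
    define f4 where "f4 = contour_integral (linepath (Complex (-R) h2) (Complex (-R) h1)) f"
    have c1: "f contour_integrable_on (linepath (Complex (-R) h1) (Complex R h1))"
      and c2: "f contour_integrable_on (linepath (Complex R h1) (Complex R h2))"
      and c3: "f contour_integrable_on (linepath (Complex R h2) (Complex (-R) h2))"
      and c4: "f contour_integrable_on (linepath (Complex (-R) h2) (Complex (-R) h1))"
      using ci by (auto simp: rectpath_def Let_def)
    have "V = contour_integral (rectpath (Complex (-R) h1) (Complex R h2)) f"
      using V[OF R] contour_integral_unique by metis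
    also have "\<dots> = f1 + f2 + f3 + f4"
      using c1 c2 c3 c4 unfolding rectpath_def Let_def
      by (simp add: f1_def f2_def f3_def f4_def)
    finally have Ve: "V = f1 + f2 + f3 + f4" .
    have c3': "f contour_integrable_on (linepath (Complex (-R) h2) (Complex R h2))"
      using c3 by (metis contour_integrable_reversepath reversepath_linepath valid_path_linepath)
    have "(f has_contour_integral X h1 R) (linepath (Complex (-R) h1) (Complex R h1))"
      using c1 R has_contour_integral_linepath_same_Im_iff[of "-R" R f _ h1]
      unfolding X_def contour_integrable_on_def by (auto dest: integral_unique)
    then have f1: "f1 = X h1 R"
      unfolding f1_def by (rule contour_integral_unique)
    have "(f has_contour_integral X h2 R) (linepath (Complex (-R) h2) (Complex R h2))"
      using c3' R has_contour_integral_linepath_same_Im_iff[of "-R" R f _ h2]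
      unfolding X_def contour_integrable_on_def by (auto dest: integral_unique)
    then have f3: "f3 = - X h2 R"
      unfolding f3_def by (intro contour_integral_unique has_contour_integral_reverse_linepath)
    have Cn: "0 \<le> C * exp (- d * R)"
      using order.trans[OF norm_ge_zero bound[of "Complex R h1"]] R \<open>h1 < h2\<close> by simp
    have b2: "norm f2 \<le> C * exp (- d * R) * norm (Complex R h2 - Complex R h1)"
      unfolding f2_def
    proof (rule contour_integral_bound_linepath[OF c2 Cn])
      fix x assume "x \<in> closed_segment (Complex R h1) (Complex R h2)"
      then have "Re x = R" "h1 \<le> Im x" "Im x \<le> h2"
        using \<open>h1 < h2\<close> by (auto simp: closed_segment_same_Re closed_segment_eq_real_ivl split: if_splits)
      then show "norm (f x) \<le> C * exp (- d * R)" using bound[of x] R by auto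
    qed
    have b4: "norm f4 \<le> C * exp (- d * R) * norm (Complex (-R) h1 - Complex (-R) h2)"
      unfolding f4_def
    proof (rule contour_integral_bound_linepath[OF c4 Cn])
      fix x assume "x \<in> closed_segment (Complex (-R) h2) (Complex (-R) h1)"
      then have "Re x = -R" "h1 \<le> Im x" "Im x \<le> h2"
        using \<open>h1 < h2\<close> by (auto simp: closed_segment_same_Re closed_segment_eq_real_ivl split: if_splits)
      then show "norm (f x) \<le> C * exp (- d * R)" using bound[of x] R by auto
    qed
    have e1: "norm (Complex R h2 - Complex R h1) = h2 - h1" "norm (Complex (-R) h1 - Complex (-R) h2) = h2 - h1"
      using \<open>h1 < h2\<close> by (auto simp: cmod_def)
    have "X h1 R - X h2 R - V = - (f2 + f4)" by (simp add: Ve f1 f3)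
    then have "norm (X h1 R - X h2 R - V) \<le> norm f2 + norm f4"
      by (metis norm_minus_cancel norm_triangle_ineq)
    also have "\<dots> \<le> 2 * (C * exp (- d * R) * (h2 - h1))" using b2 b4 e1 by simp
    finally show ?thesis .
  qed
  have "(\<lambda>n. X h1 (real n) - X h2 (real n) - V) \<longlonglongrightarrow> 0"
  proof (rule Lim_null_comparison)
    have "\<forall>\<^sub>F n in sequentially. max Rb 0 < real n"
      using filterlim_real_sequentially unfolding filterlim_at_top_dense by blast
    then show "\<forall>\<^sub>F n in sequentially. norm (X h1 (real n) - X h2 (real n) - V)
        \<le> 2 * (C * exp (- d * real n) * (h2 - h1))"
      by eventually_elim (use est in auto)
    have "((\<lambda>x. exp (- d * x)) \<longlongrightarrow> 0) at_top"
    proof -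
      have "filterlim (\<lambda>x. - d * x) at_bot at_top"
        using filterlim_tendsto_neg_mult_at_bot[OF tendsto_const _ filterlim_ident, of "-d"] d by simp
      then show ?thesis by (rule filterlim_compose[OF exp_at_bot])
    qed
    then have "(\<lambda>n. exp (- d * real n)) \<longlonglongrightarrow> 0"
      by (rule filterlim_compose[OF _ filterlim_real_sequentially])
    then have "(\<lambda>n. 2 * (C * exp (- d * real n) * (h2 - h1))) \<longlonglongrightarrow> 2 * (C * 0 * (h2 - h1))"
      by (intro tendsto_intros)
    then show "(\<lambda>n. 2 * (C * exp (- d * real n) * (h2 - h1))) \<longlonglongrightarrow> 0" by simp
  qed
  moreover have "(\<lambda>n. X h1 (real n) - X h2 (real n) - V) \<longlonglongrightarrow> line_integral h1 f - line_integral h2 f - V"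
    by (intro tendsto_intros lim li)
  ultimately show ?thesis using LIMSEQ_unique by fastforce
qed

section \<open>Moving a contour from one horizontal line to another\<close>

lemma convex_Im_strip: "convex {z. a < Im z \<and> Im z < c}"
proof -
  have "{z. a < Im z \<and> Im z < c} = {z. Im z > a} \<inter> {z. Im z < c}" by auto
  then show ?thesis by (simp add: convex_Int convex_halfspace_Im_gt convex_halfspace_Im_lt)
qed

lemma open_Im_strip: "open {z. a < Im z \<and> Im z < c}"
proof -
  have "{z. a < Im z \<and> Im z < c} = {z. Im z > a} \<inter> {z. Im z < c}" by auto
  then show ?thesis by (simp add: open_Int open_halfspace_Im_gt open_halfspace_Im_lt)
qed

lemma path_image_rectpath_strip:
  assumes "h1 < h2" "0 < R" "z \<in> path_image (rectpath (Complex (-R) h1) (Complex R h2))"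
  shows "h1 \<le> Im z" "Im z \<le> h2"
  using assms path_image_rectpath_subset_cbox[of "Complex (-R) h1" "Complex R h2"]
  by (auto simp: in_cbox_complex_iff dest!: subsetD)

text \<open>Cauchy's integral formula on large rectangles, which have winding number
  \<open>1\<close> about \<open>p\<close>. The lower line is traversed in the positive sense, hence
  the sign of the difference.\<close>

lemma line_integral_shift_simple_pole:
  assumes g: "g holomorphic_on {z. a < Im z \<and> Im z < c}"
    and h: "a < h1" "h1 < Im p" "Im p < h2" "h2 < c"
    and bound: "\<And>z. h1 \<le> Im z \<Longrightarrow> Im z \<le> h2 \<Longrightarrow> Rb \<le> \<bar>Re z\<bar> \<Longrightarrow>
                  norm (g z / (z - p)) \<le> C * exp (- d * \<bar>Re z\<bar>)"
    and d: "0 < d"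
  shows "line_integral h1 (\<lambda>z. g z / (z - p)) - line_integral h2 (\<lambda>z. g z / (z - p)) = 2 * pi * \<i> * g p"
\<comment> \<open>The bound \<open>\<bar>Re p\<bar> + 1\<close> keeps the vertical sides clear of
  the pole.\<close>
proof (rule line_integral_diff_rectpath[where Rb="max Rb (\<bar>Re p\<bar> + 1)" and C=C and d=d])
  have cg: "continuous_on {z. a < Im z \<and> Im z < c} g" by (rule holomorphic_on_imp_continuous_on[OF g])
  show "h1 < h2" using h by simp
  show "continuous_on {z. Im z = h1} (\<lambda>z. g z / (z - p))" "continuous_on {z. Im z = h2} (\<lambda>z. g z / (z - p))"
    "\<And>u. max Rb (\<bar>Re p\<bar> + 1) \<le> \<bar>u\<bar> \<Longrightarrow> continuous_on {z. Re z = u \<and> h1 \<le> Im z \<and> Im z \<le> h2} (\<lambda>z. g z / (z - p))"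
    using h by (auto intro!: continuous_intros continuous_on_subset[OF cg])
  fix R assume R: "max Rb (\<bar>Re p\<bar> + 1) < R" "0 < R"
  let ?\<gamma> = "rectpath (Complex (-R) h1) (Complex R h2)"
  have "p \<in> box (Complex (-R) h1) (Complex R h2)"
    using R h by (auto simp: in_box_complex_iff)
  then have w: "winding_number ?\<gamma> p = 1" and np: "p \<notin> path_image ?\<gamma>"
    using R h by (auto intro!: winding_number_rectpath simp: path_image_rectpath_cbox_minus_box)
  have "((\<lambda>z. g z / (z - p)) has_contour_integral (2 * pi * \<i> * winding_number ?\<gamma> p * g p)) ?\<gamma>"
  proof (rule Cauchy_integral_formula_convex_simple[OF convex_Im_strip g])
    show "p \<in> interior {z. a < Im z \<and> Im z < c}" using h by (simp add: interior_open[OF open_Im_strip])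
    show "path_image ?\<gamma> \<subseteq> {z. a < Im z \<and> Im z < c} - {p}"
      using np path_image_rectpath_strip[of h1 h2 R] R h by fastforce
  qed auto
  then show "((\<lambda>z. g z / (z - p)) has_contour_integral 2 * pi * \<i> * g p) ?\<gamma>" by (simp add: w)
qed (use bound d in auto)

lemma line_integral_shift:
  assumes f: "f holomorphic_on {z. a < Im z \<and> Im z < c}"
    and h: "a < h1" "h1 \<le> h2" "h2 < c"
    and bound: "\<And>z. h1 \<le> Im z \<Longrightarrow> Im z \<le> h2 \<Longrightarrow> norm (f z) \<le> C * exp (- d * \<bar>Re z\<bar>)"
    and d: "0 < d"
  shows "line_integral h1 f = line_integral h2 f"
proof (cases "h1 = h2")
  case False
  then have "h1 < h2" using h by simp
  have cf: "continuous_on {z. a < Im z \<and> Im z < c} f" by (rule holomorphic_on_imp_continuous_on[OF f])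
  have "line_integral h1 f - line_integral h2 f = 0"
  proof (rule line_integral_diff_rectpath[where Rb=0 and C=C and d=d])
    show "continuous_on {z. Im z = h1} f" "continuous_on {z. Im z = h2} f"
      "\<And>u. continuous_on {z. Re z = u \<and> h1 \<le> Im z \<and> Im z \<le> h2} f"
      using h by (auto intro!: continuous_on_subset[OF cf])
    fix R :: real assume R: "0 < R"
    show "(f has_contour_integral 0) (rectpath (Complex (-R) h1) (Complex R h2))"
      using path_image_rectpath_strip[of h1 h2 R] R h \<open>h1 < h2\<close>
      by (intro Cauchy_theorem_convex_simple[OF f convex_Im_strip]) fastforce+
  qed (use bound d \<open>h1 < h2\<close> in auto)
  then show ?thesis by simp
qed simp

text \<open>Cauchy's inequality on circles of radius \<open>r / 4\<close> turns the bound
  \<open>w\<close> for the function into the bound \<open>4 * w / r\<close> for its derivative on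
  the half ball. The difference quotients are thus dominated without any separate hypothesis on the
  derivative.\<close>

lemma has_field_derivative_integral_dominated:
  fixes F :: "complex \<Rightarrow> 'a \<Rightarrow> complex"
  assumes r: "0 < r"
    and hol: "\<And>t. t \<in> space M \<Longrightarrow> (\<lambda>z. F z t) holomorphic_on ball z0 r"
    and meas[measurable]: "\<And>z. z \<in> ball z0 r \<Longrightarrow> F z \<in> borel_measurable M"
    and w: "integrable M w"
    and bound: "\<And>z t. z \<in> ball z0 r \<Longrightarrow> t \<in> space M \<Longrightarrow> norm (F z t) \<le> w t"
  shows "((\<lambda>z. \<integral>t. F z t \<partial>M) has_field_derivative (\<integral>t. deriv (\<lambda>z. F z t) z0 \<partial>M)) (at z0)"
proof -
  have int: "integrable M (F z)" if "z \<in> ball z0 r" for z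
    by (rule Bochner_Integration.integrable_bound[OF w])
       (use that bound in \<open>auto intro!: AE_I2 intro: order.trans[OF bound]\<close>)
  have wn: "0 \<le> w t" if "t \<in> space M" for t
    using order.trans[OF norm_ge_zero bound[of z0 t]] r that by simp
  let ?B = "ball z0 (r/2)"
  have lip: "norm (F z t - F z0 t) \<le> 4 * w t / r * norm (z - z0)"
    if t: "t \<in> space M" and z: "z \<in> ?B" for z t
  proof (rule field_differentiable_bound[of ?B])
    have h: "(\<lambda>z. F z t) holomorphic_on ball z0 r" by (rule hol[OF t])
    fix x assume x: "x \<in> ?B"
    then have "x \<in> ball z0 r" using r by auto
    then show "((\<lambda>z. F z t) has_field_derivative deriv (\<lambda>z. F z t) x) (at x within ?B)"
      using h by (meson DERIV_subset holomorphic_derivI open_ball subset_UNIV)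
    have sub: "cball x (r/4) \<subseteq> ball z0 r"
    proof
      fix y assume "y \<in> cball x (r/4)"
      then show "y \<in> ball z0 r"
        using x r dist_triangle[of z0 y x] by (auto simp: dist_commute)
    qed
    have "norm ((deriv ^^ 1) (\<lambda>z. F z t) x) \<le> fact 1 * w t / (r/4) ^ 1"
    proof (rule Cauchy_inequality)
      show "(\<lambda>z. F z t) holomorphic_on ball x (r/4)"
        using h sub by (meson ball_subset_cball holomorphic_on_subset)
      show "continuous_on (cball x (r/4)) (\<lambda>z. F z t)"
        using h sub by (meson holomorphic_on_imp_continuous_on holomorphic_on_subset)
      show "norm (F y t) \<le> w t" if "norm (x - y) = r/4" for y
        using bound[of y t] sub that t by (auto simp: dist_norm subset_iff)
    qed (use r in auto)
    then show "norm (deriv (\<lambda>z. F z t) x) \<le> 4 * w t / r" by (simp add: mult.commute)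
  qed (use z r in auto)
  have der: "((\<lambda>z. F z t) has_field_derivative deriv (\<lambda>z. F z t) z0) (at z0 within ?B)"
    if "t \<in> space M" for t
    using hol[OF that] r by (meson DERIV_subset holomorphic_derivI open_ball subset_UNIV centre_in_ball)
  have "((\<lambda>z. ((\<integral>t. F z t \<partial>M) - (\<integral>t. F z0 t \<partial>M)) / (z - z0)) \<longlongrightarrow> (\<integral>t. deriv (\<lambda>z. F z t) z0 \<partial>M)) (at z0 within ?B)"
  proof (subst tendsto_at_iff_sequentially, intro allI impI)
    fix X :: "nat \<Rightarrow> complex" assume X: "\<forall>i. X i \<in> ?B - {z0}" "X \<longlonglongrightarrow> z0"
    have Xr: "X i \<in> ball z0 r" for i using X(1) r by (auto dest!: spec[of _ i])
    have lim: "(\<lambda>n. (F (X n) t - F z0 t) / (X n - z0)) \<longlonglongrightarrow> deriv (\<lambda>z. F z t) z0" if "t \<in> space M" for t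
      using der[OF that] X by (auto simp: has_field_derivative_iff tendsto_at_iff_sequentially o_def)
    have m[measurable]: "(\<lambda>t. (F (X n) t - F z0 t) / (X n - z0)) \<in> borel_measurable M" for n
      using int[OF Xr[of n]] int[of z0] r by (intro borel_measurable_divide borel_measurable_diff) auto
    \<comment> \<open>The derivative is measurable as a pointwise limit of difference
      quotients.\<close>
    have m': "(\<lambda>t. deriv (\<lambda>z. F z t) z0) \<in> borel_measurable M"
      by (rule borel_measurable_LIMSEQ_metric[OF m lim])
    have "(\<lambda>n. \<integral>t. (F (X n) t - F z0 t) / (X n - z0) \<partial>M) \<longlonglongrightarrow> (\<integral>t. deriv (\<lambda>z. F z t) z0 \<partial>M)"
    proof (rule integral_dominated_convergence[where w="\<lambda>t. 4 / r * w t"])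
      show "AE t in M. norm ((F (X n) t - F z0 t) / (X n - z0)) \<le> 4 / r * w t" for n
      proof (rule AE_I2)
        fix t assume t: "t \<in> space M"
        have "X n \<noteq> z0" using X(1) by auto
        then show "norm ((F (X n) t - F z0 t) / (X n - z0)) \<le> 4 / r * w t"
          using lip[OF t, of "X n"] X(1) by (auto simp: norm_divide divide_le_eq)
      qed
    qed (use m m' lim w in auto)
    moreover have "(\<integral>t. (F (X n) t - F z0 t) / (X n - z0) \<partial>M) =
        ((\<integral>t. F (X n) t \<partial>M) - (\<integral>t. F z0 t \<partial>M)) / (X n - z0)" for n
      using int[OF Xr[of n]] int[of z0] r by simp
    ultimately show "((\<lambda>z. ((\<integral>t. F z t \<partial>M) - (\<integral>t. F z0 t \<partial>M)) / (z - z0)) \<circ> X) \<longlonglongrightarrow> (\<integral>t. deriv (\<lambda>z. F z t) z0 \<partial>M)"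
      by (simp only: o_def)
  qed
  then have "((\<lambda>z. \<integral>t. F z t \<partial>M) has_field_derivative (\<integral>t. deriv (\<lambda>z. F z t) z0 \<partial>M)) (at z0 within ?B)"
    by (simp only: has_field_derivative_iff)
  then show ?thesis using r by (simp add: at_within_open[of z0 ?B])
qed

section \<open>Fourier-Laplace integrals\<close>

text \<open>Exponential decay of \<open>c t * exp (pi * t * z)\<close> on \<open>T\<close> for real
  parts of \<open>z\<close> strictly between \<open>s0\<close> and \<open>s1\<close>, the imaginary
  parts of \<open>t\<close> and \<open>z\<close> being left aside. The set \<open>T\<close> is
  either a horizontal line or the part of a strip with \<open>1 \<le> \<bar>Re t\<bar>\<close>,
  where poles inside the strip do no harm.\<close>

definition exp_type :: "complex set \<Rightarrow> real \<Rightarrow> real \<Rightarrow> (complex \<Rightarrow> complex) \<Rightarrow> bool" where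
  "exp_type T s0 s1 c \<longleftrightarrow> continuous_on T c \<and>
     (\<forall>\<sigma>. s0 < \<sigma> \<longrightarrow> \<sigma> < s1 \<longrightarrow> (\<exists>C d. 0 < d \<and>
        (\<forall>t\<in>T. norm (c t) * exp (pi * \<sigma> * Re t) \<le> C * exp (- d * \<bar>Re t\<bar>))))"

text \<open>A two-sided Laplace transform along a horizontal line, normalised like the integral in
  the quantum dilogarithm.\<close>

definition expint :: "real \<Rightarrow> (complex \<Rightarrow> complex) \<Rightarrow> complex \<Rightarrow> complex" where
  "expint h c z = line_integral h (\<lambda>t::complex. c t * exp (pi * t * z))"

lemma exp_typeE:
  assumes "exp_type T s0 s1 c" "s0 < \<sigma>" "\<sigma> < s1"
  obtains d C where "0 < d" "0 \<le> C"
    "\<And>t. t \<in> T \<Longrightarrow> norm (c t) * exp (pi * \<sigma> * Re t) \<le> C * exp (- d * \<bar>Re t\<bar>)"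
proof -
  from assms obtain C d where C: "0 < d"
    "\<And>t. t \<in> T \<Longrightarrow> norm (c t) * exp (pi * \<sigma> * Re t) \<le> C * exp (- d * \<bar>Re t\<bar>)"
    unfolding exp_type_def by blast
  have "C * exp (- d * \<bar>Re t\<bar>) \<le> max 0 C * exp (- d * \<bar>Re t\<bar>)" for t
    by (intro mult_right_mono) auto
  then show ?thesis
    using C that[of d "max 0 C"] by (meson max.cobounded1 order.trans)
qed

text \<open>A weight \<open>\<sigma>\<close> between \<open>s0 + s0'\<close> and
  \<open>s1 + s1'\<close> is split as \<open>\<sigma>1 + \<sigma>2\<close>, where
  \<open>\<sigma>1\<close> and \<open>\<sigma>2\<close> divide their own intervals in the ratio in
  which \<open>\<sigma>\<close> divides the sum.\<close>

lemma exp_type_mult: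
  assumes c: "exp_type T s0 s1 c" and c': "exp_type T s0' s1' c'" and "s0 < s1" "s0' < s1'"
  shows "exp_type T (s0 + s0') (s1 + s1') (\<lambda>t. c t * c' t)"
  unfolding exp_type_def
proof (intro conjI allI impI ballI)
  show "continuous_on T (\<lambda>t. c t * c' t)"
    using c c' by (auto simp: exp_type_def intro!: continuous_intros)
  fix \<sigma> assume s: "s0 + s0' < \<sigma>" "\<sigma> < s1 + s1'"
  define \<sigma>1 where "\<sigma>1 = s0 + (\<sigma> - s0 - s0') / (s1 + s1' - s0 - s0') * (s1 - s0)"
  define \<sigma>2 where "\<sigma>2 = s0' + (\<sigma> - s0 - s0') / (s1 + s1' - s0 - s0') * (s1' - s0')"
  have th: "0 < (\<sigma> - s0 - s0') / (s1 + s1' - s0 - s0')" "(\<sigma> - s0 - s0') / (s1 + s1' - s0 - s0') < 1"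
    using s by auto
  have "\<sigma>1 + \<sigma>2 = s0 + s0' + (\<sigma> - s0 - s0') / (s1 + s1' - s0 - s0') * (s1 + s1' - s0 - s0')"
    unfolding \<sigma>1_def \<sigma>2_def by (simp only: distrib_left right_diff_distrib)
  then have sum: "\<sigma>1 + \<sigma>2 = \<sigma>" using s by simp
  have *: "a < a + \<theta> * (a' - a) \<and> a + \<theta> * (a' - a) < a'" if "0 < \<theta>" "\<theta> < 1" "a < a'" for a a' \<theta> :: real
    using that mult_strict_right_mono[of \<theta> 1 "a' - a"] by (auto simp: algebra_simps)
  have b: "s0 < \<sigma>1" "\<sigma>1 < s1" "s0' < \<sigma>2" "\<sigma>2 < s1'"
    using *[OF th \<open>s0 < s1\<close>] *[OF th \<open>s0' < s1'\<close>] unfolding \<sigma>1_def \<sigma>2_def by auto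
  obtain C d where C: "0 < d" "0 \<le> C"
    "\<And>t. t \<in> T \<Longrightarrow> norm (c t) * exp (pi * \<sigma>1 * Re t) \<le> C * exp (- d * \<bar>Re t\<bar>)"
    using exp_typeE[OF c b(1,2)] by blast
  obtain C' d' where C': "0 < d'" "0 \<le> C'"
    "\<And>t. t \<in> T \<Longrightarrow> norm (c' t) * exp (pi * \<sigma>2 * Re t) \<le> C' * exp (- d' * \<bar>Re t\<bar>)"
    using exp_typeE[OF c' b(3,4)] by blast
  show "\<exists>C d. 0 < d \<and> (\<forall>t\<in>T. norm (c t * c' t) * exp (pi * \<sigma> * Re t) \<le> C * exp (- d * \<bar>Re t\<bar>))"
  proof (rule exI[of _ "C * C'"], rule exI[of _ "d + d'"], intro conjI allI impI ballI)
    fix t :: complex assume t: "t \<in> T"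
    have "norm (c t * c' t) * exp (pi * \<sigma> * Re t)
        = (norm (c t) * exp (pi * \<sigma>1 * Re t)) * (norm (c' t) * exp (pi * \<sigma>2 * Re t))"
      by (simp add: norm_mult sum[symmetric] distrib_left distrib_right exp_add)
    also have "\<dots> \<le> (C * exp (- d * \<bar>Re t\<bar>)) * (C' * exp (- d' * \<bar>Re t\<bar>))"
      by (rule mult_mono[OF C(3)[OF t] C'(3)[OF t]]) (use C(2) in auto)
    also have "\<dots> = C * C' * exp (- (d + d') * \<bar>Re t\<bar>)"
      by (simp add: distrib_right exp_add exp_diff exp_minus field_simps)
    finally show "norm (c t * c' t) * exp (pi * \<sigma> * Re t) \<le> C * C' * exp (- (d + d') * \<bar>Re t\<bar>)" .
  qed (use C(1) C'(1) in auto)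
qed

text \<open>Half of the decay rate absorbs a linear factor. This covers the factor \<open>t\<close>
  produced by differentiation and, off the real axis, the bounded factor
  \<open>1 / t\<close>.\<close>

lemma exp_type_mult_linear_growth:
  assumes c: "exp_type T s0 s1 c" and p: "continuous_on T p"
    and A0: "0 \<le> A" and A: "\<And>t. t \<in> T \<Longrightarrow> norm (p t) \<le> A * (1 + \<bar>Re t\<bar>)"
  shows "exp_type T s0 s1 (\<lambda>t. p t * c t)"
  unfolding exp_type_def
proof (intro conjI allI impI ballI)
  show "continuous_on T (\<lambda>t. p t * c t)"
    using c p by (auto simp: exp_type_def intro!: continuous_intros)
  fix \<sigma> assume s: "s0 < \<sigma>" "\<sigma> < s1"
  obtain C d where C: "0 < d" "0 \<le> C"
    "\<And>t. t \<in> T \<Longrightarrow> norm (c t) * exp (pi * \<sigma> * Re t) \<le> C * exp (- d * \<bar>Re t\<bar>)"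
    using exp_typeE[OF c s] by blast
  show "\<exists>C d. 0 < d \<and> (\<forall>t\<in>T. norm (p t * c t) * exp (pi * \<sigma> * Re t) \<le> C * exp (- d * \<bar>Re t\<bar>))"
  proof (rule exI[of _ "A * (1 + 2 / d) * C"], rule exI[of _ "d / 2"], intro conjI allI impI ballI)
    fix t :: complex assume t: "t \<in> T"
    have "1 + \<bar>Re t\<bar> \<le> (1 + 2 / d) * (1 + d / 2 * \<bar>Re t\<bar>)"
      using C(1) by (simp add: field_simps)
    also have "\<dots> \<le> (1 + 2 / d) * exp (d / 2 * \<bar>Re t\<bar>)"
      using C(1) by (intro mult_left_mono exp_ge_add_one_self) auto
    finally have 1: "1 + \<bar>Re t\<bar> \<le> (1 + 2 / d) * exp (d / 2 * \<bar>Re t\<bar>)" .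
    have "norm (p t * c t) * exp (pi * \<sigma> * Re t) = norm (p t) * (norm (c t) * exp (pi * \<sigma> * Re t))"
      by (simp add: norm_mult)
    also have "\<dots> \<le> (A * ((1 + 2 / d) * exp (d / 2 * \<bar>Re t\<bar>))) * (C * exp (- d * \<bar>Re t\<bar>))"
    proof (rule mult_mono[OF _ C(3)[OF t]])
      show "norm (p t) \<le> A * ((1 + 2 / d) * exp (d / 2 * \<bar>Re t\<bar>))"
        using order.trans[OF A[OF t] mult_left_mono[OF 1 A0]] .
    qed (use A0 C(1) in auto)
    also have "\<dots> = A * (1 + 2 / d) * C * (exp (d / 2 * \<bar>Re t\<bar>) * exp (- d * \<bar>Re t\<bar>))" by simp
    also have "exp (d / 2 * \<bar>Re t\<bar>) * exp (- d * \<bar>Re t\<bar>) = exp (- (d/2) * \<bar>Re t\<bar>)"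
      by (subst exp_add[symmetric]) (simp add: algebra_simps)
    finally show "norm (p t * c t) * exp (pi * \<sigma> * Re t) \<le> A * (1 + 2 / d) * C * exp (- (d/2) * \<bar>Re t\<bar>)" .
  qed (use C(1) in auto)
qed

section \<open>Bounds and derivatives of Laplace integrals on a line\<close>

lemma norm_exp_line: "norm (exp (pi * t * z :: complex)) = exp (pi * Re z * Re t - pi * Im t * Im z)"
  by (simp add: norm_exp_eq_Re algebra_simps)

lemma continuous_on_line:
  assumes "continuous_on {t. Im t = h} c"
  shows "continuous_on UNIV (\<lambda>u. c (Complex u h))"
  by (rule continuous_on_compose2[OF assms continuous_on_Complex_line]) auto

text \<open>For each sign of \<open>Re t\<close> the exponential is monotone in \<open>Re z\<close>,
  so it is at most the sum of its values at the two ends \<open>\<sigma>0\<close> and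
  \<open>\<sigma>1\<close>. This makes the constants uniform over a closed substrip.\<close>

lemma exp_type_bound:
  fixes c :: "complex \<Rightarrow> complex"
  assumes c: "exp_type {t. Im t = h} s0 s1 c" and "s0 < \<sigma>0" "\<sigma>1 < s1" "\<sigma>0 \<le> \<sigma>1"
  obtains d C where "0 < d" "0 \<le> C"
    "\<And>(t::complex) (z::complex). Im t = h \<Longrightarrow> \<sigma>0 \<le> Re z \<Longrightarrow> Re z \<le> \<sigma>1 \<Longrightarrow>
       norm (c t * exp (pi * t * z)) \<le> C * exp (- d * \<bar>Re t\<bar>) * exp (- pi * h * Im z)"
proof -
  have s: "s0 < \<sigma>0" "\<sigma>0 < s1" "s0 < \<sigma>1" "\<sigma>1 < s1" using assms by auto
  obtain C d where C: "0 < d" "0 \<le> C"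
    "\<And>t. Im t = h \<Longrightarrow> norm (c t) * exp (pi * \<sigma>0 * Re t) \<le> C * exp (- d * \<bar>Re t\<bar>)"
    using exp_typeE[OF c s(1,2)] unfolding mem_Collect_eq by blast
  obtain C' d' where C': "0 < d'" "0 \<le> C'"
    "\<And>t. Im t = h \<Longrightarrow> norm (c t) * exp (pi * \<sigma>1 * Re t) \<le> C' * exp (- d' * \<bar>Re t\<bar>)"
    using exp_typeE[OF c s(3,4)] unfolding mem_Collect_eq by blast
  define e where "e = min d d'"
  have e: "0 < e" "e \<le> d" "e \<le> d'" using C C' by (auto simp: e_def)
  show ?thesis
  proof (rule that[of e "C + C'"])
    fix t z :: complex assume t: "Im t = h" and z: "\<sigma>0 \<le> Re z" "Re z \<le> \<sigma>1"
    have "exp (pi * Re z * Re t) \<le> exp (pi * \<sigma>0 * Re t) + exp (pi * \<sigma>1 * Re t)"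
    proof (cases "0 \<le> Re t")
      case True
      then have "exp (pi * Re z * Re t) \<le> exp (pi * \<sigma>1 * Re t)" using z by (auto intro!: mult_right_mono)
      then show ?thesis by (simp add: add_increasing)
    next
      case False
      then have "exp (pi * Re z * Re t) \<le> exp (pi * \<sigma>0 * Re t)" using z by (auto intro!: mult_right_mono_neg)
      then show ?thesis by (simp add: add_increasing2)
    qed
    then have "norm (c t) * exp (pi * Re z * Re t) \<le> norm (c t) * exp (pi * \<sigma>0 * Re t) + norm (c t) * exp (pi * \<sigma>1 * Re t)"
      by (simp add: mult_left_mono flip: distrib_left)
    also have "\<dots> \<le> C * exp (- d * \<bar>Re t\<bar>) + C' * exp (- d' * \<bar>Re t\<bar>)"
      using C(3)[OF t] C'(3)[OF t] by simp
    also have "\<dots> \<le> C * exp (- e * \<bar>Re t\<bar>) + C' * exp (- e * \<bar>Re t\<bar>)"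
      using e C(2) C'(2) by (intro add_mono mult_left_mono) (auto intro: mult_right_mono)
    finally have 1: "norm (c t) * exp (pi * Re z * Re t) \<le> (C + C') * exp (- e * \<bar>Re t\<bar>)"
      by (simp add: distrib_right)
    have "norm (c t * exp (pi * t * z)) = norm (c t) * exp (pi * Re z * Re t) * exp (- pi * h * Im z)"
      unfolding norm_mult norm_exp_line using t by (simp add: exp_diff exp_minus field_simps)
    also have "\<dots> \<le> (C + C') * exp (- e * \<bar>Re t\<bar>) * exp (- pi * h * Im z)"
      by (intro mult_right_mono 1) auto
    finally show "norm (c t * exp (pi * t * z)) \<le> (C + C') * exp (- e * \<bar>Re t\<bar>) * exp (- pi * h * Im z)" .
  qed (use e C C' in auto)
qed

lemma exp_type_line_integrable:
  fixes c :: "complex \<Rightarrow> complex" and z :: complex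
  assumes c: "exp_type {t. Im t = h} s0 s1 c" and z: "s0 < Re z" "Re z < s1"
  shows "line_integrable h (\<lambda>t::complex. c t * exp (pi * t * z))"
proof -
  obtain C d where C: "0 < d" "0 \<le> C"
    "\<And>(t::complex) (y::complex). Im t = h \<Longrightarrow> Re z \<le> Re y \<Longrightarrow> Re y \<le> Re z \<Longrightarrow>
       norm (c t * exp (pi * t * y)) \<le> C * exp (- d * \<bar>Re t\<bar>) * exp (- pi * h * Im y)"
    by (rule exp_type_bound[OF c z order.refl]) (rule that)
  show ?thesis
  proof (rule line_integrable_exp_decay[where Rb=0 and d=d and C="C * exp (- pi * h * Im z)"])
    show "continuous_on {z. Im z = h} (\<lambda>t::complex. c t * exp (pi * t * z))"
      using c by (auto simp: exp_type_def intro!: continuous_intros)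
    show "norm (c t * exp (pi * t * z)) \<le> C * exp (- pi * h * Im z) * exp (- d * \<bar>Re t\<bar>)" if "Im t = h" for t :: complex
      using C(3)[OF that, of z] by (simp add: mult.assoc mult.commute mult.left_commute)
  qed fact
qed

text \<open>The factor \<open>exp (- pi * h * Im z)\<close> is the modulus that the height
  \<open>h\<close> of the line contributes to \<open>exp (pi * t * z)\<close>. For
  \<open>h = b\<close> it yields decay as \<open>Im z\<close> grows, which later fixes a constant of
  integration and the growth of \<open>S0\<close>.\<close>

lemma expint_bound:
  fixes c :: "complex \<Rightarrow> complex"
  assumes c: "exp_type {t. Im t = h} s0 s1 c" and "s0 < \<sigma>0" "\<sigma>1 < s1" "\<sigma>0 \<le> \<sigma>1"
  obtains K where "0 \<le> K" "\<And>z::complex. \<sigma>0 \<le> Re z \<Longrightarrow> Re z \<le> \<sigma>1 \<Longrightarrow> norm (expint h c z) \<le> K * exp (- pi * h * Im z)"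
proof -
  obtain C d where C: "0 < d" "0 \<le> C"
    "\<And>(t::complex) (z::complex). Im t = h \<Longrightarrow> \<sigma>0 \<le> Re z \<Longrightarrow> Re z \<le> \<sigma>1 \<Longrightarrow>
       norm (c t * exp (pi * t * z)) \<le> C * exp (- d * \<bar>Re t\<bar>) * exp (- pi * h * Im z)"
    by (rule exp_type_bound[OF assms]) (rule that)
  define K where "K = (LINT u|lborel. C * exp (- d * \<bar>u\<bar>))"
  show ?thesis
  proof (rule that[of K])
    show "0 \<le> K" unfolding K_def using C by (intro integral_nonneg_AE) auto
    fix z :: complex assume z: "\<sigma>0 \<le> Re z" "Re z \<le> \<sigma>1"
    have i: "integrable lborel (\<lambda>u. c (Complex u h) * exp (pi * Complex u h * z))"
      using exp_type_line_integrable[OF c] z assms by (auto simp: line_integrable_def)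
    have "norm (expint h c z) \<le> (LINT u|lborel. norm (c (Complex u h) * exp (pi * Complex u h * z)))"
      unfolding expint_def line_integral_def by (rule integral_norm_bound)
    also have "\<dots> \<le> (LINT u|lborel. C * exp (- d * \<bar>u\<bar>) * exp (- pi * h * Im z))"
    proof (rule integral_mono)
      show "integrable lborel (\<lambda>u. norm (c (Complex u h) * exp (pi * Complex u h * z)))"
        using i by (rule integrable_norm)
      show "integrable lborel (\<lambda>u. C * exp (- d * \<bar>u\<bar>) * exp (- pi * h * Im z))"
        by (intro integrable_mult_left integrable_mult_right integrable_exp_minus_abs C)
      show "norm (c (Complex u h) * exp (pi * Complex u h * z)) \<le> C * exp (- d * \<bar>u\<bar>) * exp (- pi * h * Im z)" for u
        using C(3)[of "Complex u h" z] z by simp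
    qed
    also have "\<dots> = K * exp (- pi * h * Im z)" by (simp add: K_def)
    finally show "norm (expint h c z) \<le> K * exp (- pi * h * Im z)" .
  qed
qed

lemma expint_deriv:
  fixes c :: "complex \<Rightarrow> complex" and z0 :: complex
  assumes c: "exp_type {t. Im t = h} s0 s1 c" and z: "s0 < Re z0" "Re z0 < s1"
  shows "(expint h c has_field_derivative expint h (\<lambda>t::complex. pi * t * c t) z0) (at z0)"
proof -
  define r where "r = min (Re z0 - s0) (s1 - Re z0) / 2"
  have r: "0 < r" "s0 < Re z0 - r" "Re z0 + r < s1" using z by (auto simp: r_def min_def field_simps)
  obtain C d where C: "0 < d" "0 \<le> C"
    "\<And>(t::complex) (z::complex). Im t = h \<Longrightarrow> Re z0 - r \<le> Re z \<Longrightarrow> Re z \<le> Re z0 + r \<Longrightarrow>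
       norm (c t * exp (pi * t * z)) \<le> C * exp (- d * \<bar>Re t\<bar>) * exp (- pi * h * Im z)"
    by (rule exp_type_bound[OF c r(2,3)]) (use r(1) in auto)
  have cc: "continuous_on UNIV (\<lambda>u. c (Complex u h))"
    using c by (intro continuous_on_line) (auto simp: exp_type_def)
  have "((\<lambda>z. LINT u|lborel. c (Complex u h) * exp (pi * Complex u h * z)) has_field_derivative
        (LINT u|lborel. deriv (\<lambda>z. c (Complex u h) * exp (pi * Complex u h * z)) z0)) (at z0)"
  proof (rule has_field_derivative_integral_dominated[where r=r
        and w="\<lambda>u. C * exp (- d * \<bar>u\<bar>) * exp (pi * \<bar>h\<bar> * (\<bar>Im z0\<bar> + r))"])
    show "integrable lborel (\<lambda>u. C * exp (- d * \<bar>u\<bar>) * exp (pi * \<bar>h\<bar> * (\<bar>Im z0\<bar> + r)))"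
      by (intro integrable_mult_left integrable_mult_right integrable_exp_minus_abs C)
    fix z :: complex assume zb: "z \<in> ball z0 r"
    have "(\<lambda>u. c (Complex u h) * exp (pi * Complex u h * z)) \<in> borel_measurable borel"
      by (intro borel_measurable_continuous_onI continuous_intros cc continuous_on_Complex_line)
    then show "(\<lambda>u. c (Complex u h) * exp (pi * Complex u h * z)) \<in> borel_measurable lborel" by simp
    fix u :: real
    have zr: "norm (z - z0) < r" using zb by (simp add: dist_norm norm_minus_commute)
    have zr': "\<bar>Re z - Re z0\<bar> < r" "\<bar>Im z - Im z0\<bar> < r"
      using abs_Re_le_cmod[of "z - z0"] abs_Im_le_cmod[of "z - z0"] zr by auto
    have "norm (c (Complex u h) * exp (pi * Complex u h * z)) \<le> C * exp (- d * \<bar>u\<bar>) * exp (- pi * h * Im z)"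
      using C(3)[of "Complex u h" z] zr' by auto
    also have "\<dots> \<le> C * exp (- d * \<bar>u\<bar>) * exp (pi * \<bar>h\<bar> * (\<bar>Im z0\<bar> + r))"
    proof -
      have "- pi * h * Im z \<le> \<bar>- pi * h * Im z\<bar>" by simp
      also have "\<dots> = pi * \<bar>h\<bar> * \<bar>Im z\<bar>" by (simp add: abs_mult)
      also have "\<dots> \<le> pi * \<bar>h\<bar> * (\<bar>Im z0\<bar> + r)" using zr' by (intro mult_left_mono) auto
      finally show ?thesis using C by (intro mult_left_mono) auto
    qed
    finally show "norm (c (Complex u h) * exp (pi * Complex u h * z)) \<le> C * exp (- d * \<bar>u\<bar>) * exp (pi * \<bar>h\<bar> * (\<bar>Im z0\<bar> + r))" .
  qed (use r in \<open>auto intro!: holomorphic_intros\<close>)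
  moreover have "deriv (\<lambda>z. c (Complex u h) * exp (pi * Complex u h * z)) z0
      = pi * Complex u h * c (Complex u h) * exp (pi * Complex u h * z0)" for u
    by (rule DERIV_imp_deriv) (auto intro!: derivative_eq_intros simp: mult_ac)
  ultimately show ?thesis unfolding expint_def line_integral_def by simp
qed

lemma expint_cong: "(\<And>t. Im t = h \<Longrightarrow> c t = c' t) \<Longrightarrow> expint h c z = expint h c' z"
  by (simp add: expint_def line_integral_def)

section \<open>Exponential type of the factors of the dilogarithm integrand\<close>

lemma exp_type_ident: "exp_type {t. Im t = h} s0 s1 c \<Longrightarrow> exp_type {t. Im t = h} s0 s1 (\<lambda>t::complex. pi * t * c t)"
proof (rule exp_type_mult_linear_growth[where A="pi * (1 + \<bar>h\<bar>)"])
  fix t :: complex assume "t \<in> {t. Im t = h}"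
  then have "norm t \<le> \<bar>Re t\<bar> + \<bar>h\<bar>" using cmod_le[of t] by simp
  also have "\<dots> \<le> (1 + \<bar>h\<bar>) * (1 + \<bar>Re t\<bar>)" by (simp add: algebra_simps)
  finally show "norm (pi * t :: complex) \<le> pi * (1 + \<bar>h\<bar>) * (1 + \<bar>Re t\<bar>)"
    by (simp add: norm_mult mult.assoc)
qed (auto intro!: continuous_intros)

lemma exp_type_inverse: "h \<noteq> 0 \<Longrightarrow> exp_type {t. Im t = h} s0 s1 c \<Longrightarrow> exp_type {t. Im t = h} s0 s1 (\<lambda>t. 1 / t * c t)"
proof (rule exp_type_mult_linear_growth[where A="1 / \<bar>h\<bar>"])
  fix t :: complex assume "h \<noteq> 0" "t \<in> {t. Im t = h}"
  then have "norm (1 / t) \<le> 1 / \<bar>h\<bar>" using abs_Im_le_cmod[of t]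
    by (auto simp: norm_divide intro!: frac_le)
  also have "\<dots> \<le> 1 / \<bar>h\<bar> * (1 + \<bar>Re t\<bar>)" using \<open>h \<noteq> 0\<close> by (simp add: field_simps)
  finally show "norm (1 / t) \<le> 1 / \<bar>h\<bar> * (1 + \<bar>Re t\<bar>)" .
qed (auto intro!: continuous_intros)

text \<open>With modulus \<open>X\<close> and angle \<open>pi * a * h\<close>, the square of the
  right side is \<open>(X - 1)^2 + 2 * X * k\<close>. Since \<open>k \<le> 2\<close>, replacing
  \<open>(X - 1)^2\<close> by \<open>k / 2 * (X - 1)^2\<close> only lowers it, and the result is
  exactly \<open>k / 2 * (1 + X)^2\<close>.\<close>

lemma norm_exp_minus_1_ge:
  fixes a h :: real and t :: complex
  assumes k: "k = 1 - cos (pi * a * h)" and t: "Im t = h"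
  shows "sqrt (k / 2) * (1 + exp (pi * a * Re t)) \<le> norm (exp (pi * a * t) - 1)"
proof -
  define X where "X = exp (pi * a * Re t)"
  have X: "0 < X" by (simp add: X_def)
  have k2: "0 \<le> k" "k \<le> 2" using cos_ge_minus_one[of "pi * a * h"] by (auto simp: k)
  have e: "exp (pi * a * t) = Complex (X * cos (pi * a * h)) (X * sin (pi * a * h))"
    using t by (simp add: exp_eq_polar X_def cis.ctr complex_eq_iff Re_exp Im_exp)
  have "(norm (exp (pi * a * t) - 1))\<^sup>2 = (X * cos (pi * a * h) - 1)\<^sup>2 + (X * sin (pi * a * h))\<^sup>2"
    unfolding e cmod_power2 by simp
  also have "\<dots> = X\<^sup>2 * ((sin (pi * a * h))\<^sup>2 + (cos (pi * a * h))\<^sup>2) - 2 * X * cos (pi * a * h) + 1"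
    by (simp only: power_mult_distrib power2_diff distrib_left) simp
  also have "\<dots> = (X - 1)\<^sup>2 + 2 * X * k" by (simp add: k power2_eq_square algebra_simps)
  also have "\<dots> \<ge> k / 2 * (X - 1)\<^sup>2 + 2 * X * k"
    using k2 mult_right_mono[of "k/2" 1 "(X - 1)\<^sup>2"] by simp
  also (xtrans) have "k / 2 * (X - 1)\<^sup>2 + 2 * X * k = (sqrt (k / 2) * (1 + X))\<^sup>2"
    using k2 by (simp add: power_mult_distrib) (simp add: power2_eq_square algebra_simps)
  finally show ?thesis unfolding X_def[symmetric] by (rule power2_le_imp_le) simp
qed

text \<open>Once the denominator is comparable to \<open>1 + exp (pi * a * Re t)\<close>, the
  summand that is larger for the given sign of \<open>Re t\<close> provides the decay, at rate
  \<open>pi * (a - \<sigma>)\<close> to the right and \<open>pi * \<sigma>\<close> to the left. The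
  comparison is a hypothesis because it has different reasons on lines and on the ends of
  strips.\<close>

lemma exp_type_exp_minus_1_aux:
  fixes a k :: real
  assumes a: "0 < a" and k: "0 < k"
    and ge: "\<And>t::complex. t \<in> T \<Longrightarrow> k * (1 + exp (pi * a * Re t)) \<le> norm (exp (pi * a * t) - 1)"
  shows "exp_type T 0 a (\<lambda>t::complex. 1 / (exp (pi * a * t) - 1))"
    and "\<And>t::complex. t \<in> T \<Longrightarrow> exp (pi * a * t) \<noteq> 1"
proof -
  have pos: "0 < k * (1 + exp (pi * a * Re t))" for t :: complex
    using k by (intro mult_pos_pos add_pos_pos) auto
  show ne: "exp (pi * a * t) \<noteq> 1" if "t \<in> T" for t :: complex
    using ge[OF that] pos[of t] by auto
  show "exp_type T 0 a (\<lambda>t::complex. 1 / (exp (pi * a * t) - 1))"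
    unfolding exp_type_def
  proof (intro conjI allI impI)
    show "continuous_on T (\<lambda>t::complex. 1 / (exp (pi * a * t) - 1))"
      using ne by (auto intro!: continuous_intros)
    fix \<sigma> assume s: "0 < \<sigma>" "\<sigma> < a"
    show "\<exists>C d. 0 < d \<and> (\<forall>t\<in>T. norm (1 / (exp (pi * a * t) - 1)) * exp (pi * \<sigma> * Re t) \<le> C * exp (- d * \<bar>Re t\<bar>))"
    proof (rule exI[of _ "1 / k"], rule exI[of _ "pi * min \<sigma> (a - \<sigma>)"], intro conjI allI impI ballI)
      show "0 < pi * min \<sigma> (a - \<sigma>)" using s by simp
      fix t :: complex assume t: "t \<in> T"
      have "norm (1 / (exp (pi * a * t) - 1)) \<le> 1 / (k * (1 + exp (pi * a * Re t)))"
        using ge[OF t] pos[of t] by (auto simp: norm_divide intro!: frac_le)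
      then have 1: "norm (1 / (exp (pi * a * t) - 1)) * exp (pi * \<sigma> * Re t)
          \<le> 1 / (k * (1 + exp (pi * a * Re t))) * exp (pi * \<sigma> * Re t)"
        by (rule mult_right_mono) auto
      have "exp (pi * \<sigma> * Re t) / (1 + exp (pi * a * Re t)) \<le> exp (- (pi * min \<sigma> (a - \<sigma>)) * \<bar>Re t\<bar>)"
      proof (cases "0 \<le> Re t")
        case True
        have "exp (pi * \<sigma> * Re t) / (1 + exp (pi * a * Re t)) \<le> exp (pi * \<sigma> * Re t) / exp (pi * a * Re t)"
          by (intro frac_le) auto
        also have "\<dots> = exp (- (pi * (a - \<sigma>)) * Re t)"
          by (subst exp_diff[symmetric]) (simp add: algebra_simps)
        also have "\<dots> \<le> exp (- (pi * min \<sigma> (a - \<sigma>)) * \<bar>Re t\<bar>)"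
          using True by (auto intro!: mult_right_mono mult_left_mono)
        finally show ?thesis .
      next
        case False
        have "exp (pi * \<sigma> * Re t) / (1 + exp (pi * a * Re t)) \<le> exp (pi * \<sigma> * Re t) / 1"
          by (intro frac_le) auto
        also have "\<dots> \<le> exp (- (pi * min \<sigma> (a - \<sigma>)) * \<bar>Re t\<bar>)"
          using False by (auto intro!: mult_right_mono_neg mult_left_mono)
        finally show ?thesis .
      qed
      then have "1 / k * (exp (pi * \<sigma> * Re t) / (1 + exp (pi * a * Re t)))
          \<le> 1 / k * exp (- (pi * min \<sigma> (a - \<sigma>)) * \<bar>Re t\<bar>)"
        using k by (intro mult_left_mono) auto
      with 1 show "norm (1 / (exp (pi * a * t) - 1)) * exp (pi * \<sigma> * Re t)
          \<le> 1 / k * exp (- (pi * min \<sigma> (a - \<sigma>)) * \<bar>Re t\<bar>)"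
        by simp
    qed
  qed
qed

text \<open>The zeros of \<open>exp (pi * a * t) - 1\<close> have imaginary parts
  \<open>2 * n / a\<close>; the condition on the cosine says that the line misses all of
  them.\<close>

lemma exp_type_exp_minus_1:
  fixes a h :: real
  assumes a: "0 < a" and h: "cos (pi * a * h) \<noteq> 1"
  shows "exp_type {t. Im t = h} 0 a (\<lambda>t::complex. 1 / (exp (pi * a * t) - 1))"
    and "\<And>t::complex. Im t = h \<Longrightarrow> exp (pi * a * t) \<noteq> 1"
proof -
  define k where "k = 1 - cos (pi * a * h)"
  have "0 < sqrt (k / 2)" using h cos_le_one[of "pi * a * h"] by (simp add: k_def less_le)
  note aux = exp_type_exp_minus_1_aux[OF a this norm_exp_minus_1_ge[OF k_def], of "{t. Im t = h}"]
  show "exp_type {t. Im t = h} 0 a (\<lambda>t::complex. 1 / (exp (pi * a * t) - 1))"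
    "\<And>t::complex. Im t = h \<Longrightarrow> exp (pi * a * t) \<noteq> 1"
    using aux by auto
qed

lemma exp_type_exp_minus_1_ends:
  fixes a :: real
  assumes a: "0 < a"
  shows "exp_type {t. 1 \<le> \<bar>Re t\<bar>} 0 a (\<lambda>t::complex. 1 / (exp (pi * a * t) - 1))"
proof -
  \<comment> \<open>With \<open>Y = exp (pi * a)\<close> this is the value of
    \<open>\<bar>X - 1\<bar> / (X + 1)\<close> at both \<open>X = Y\<close> and
    \<open>X = 1 / Y\<close>, its minimum over the moduli \<open>X\<close> that occur for
    \<open>1 \<le> \<bar>Re t\<bar>\<close>.\<close>
  define k where "k = (exp (pi * a) - 1) / (exp (pi * a) + 1)"
  have k: "0 < k" unfolding k_def using a by (intro divide_pos_pos add_pos_pos) auto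
  show ?thesis
  proof (rule exp_type_exp_minus_1_aux(1)[OF a k])
    fix t :: complex assume "t \<in> {t. 1 \<le> \<bar>Re t\<bar>}"
    then have t: "1 \<le> \<bar>Re t\<bar>" by simp
    define X where "X = exp (pi * a * Re t)"
    define Y where "Y = exp (pi * a)"
    have X: "0 < X" "1 < Y" using a by (auto simp: X_def Y_def)
    have "Y \<le> X \<or> X * Y \<le> 1"
    proof (cases "0 \<le> Re t")
      case True
      then have "1 \<le> Re t" using t by simp
      then show ?thesis using a by (auto simp: X_def Y_def)
    next
      case False
      then have "Re t \<le> -1" using t by simp
      then have "pi * a * Re t \<le> pi * a * (-1)" using a by (intro mult_left_mono) auto
      then show ?thesis by (auto simp: X_def Y_def exp_add[symmetric])
    qed
    then have "(Y - 1) * (1 + X) \<le> \<bar>X - 1\<bar> * (Y + 1)"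
    proof
      assume "Y \<le> X"
      then show ?thesis using X by (simp add: abs_if algebra_simps)
    next
      assume XY: "X * Y \<le> 1"
      moreover have "X < X * Y" using X by simp
      ultimately have "X < 1" by linarith
      with XY show ?thesis using X by (simp add: abs_if algebra_simps)
    qed
    then have "k * (1 + X) \<le> \<bar>X - 1\<bar>"
      using X unfolding k_def Y_def[symmetric] by (simp add: field_simps)
    also have "X = norm (exp (pi * a * t))" by (simp add: X_def norm_exp_eq_Re)
    also have "\<bar>\<dots> - 1\<bar> \<le> norm (exp (pi * a * t) - 1)"
      using norm_triangle_ineq3[of "exp (pi * a * t)" 1] by simp
    finally show "k * (1 + exp (pi * a * Re t)) \<le> norm (exp (pi * a * t) - 1)"
      by (simp add: X_def norm_exp_eq_Re)
  qed
qed

lemma exp_type_subset: "exp_type T s0 s1 c \<Longrightarrow> T' \<subseteq> T \<Longrightarrow> exp_type T' s0 s1 c"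
  unfolding exp_type_def by (meson continuous_on_subset subsetD)

section \<open>The quantum dilogarithm in its strip\<close>

text \<open>Division by a simple zero, with the derivative as the value at \<open>p\<close>. It
  serves to write an integrand with a simple pole as \<open>g t / (t - p)\<close> with
  \<open>g\<close> holomorphic.\<close>

lemma holomorphic_exp_divided_difference:
  fixes a p :: complex
  assumes "exp (a * p) = 1"
  obtains \<epsilon> where "\<epsilon> holomorphic_on UNIV" "\<epsilon> p = a" "\<And>t::complex. t \<noteq> p \<Longrightarrow> \<epsilon> t = (exp (a * t) - 1) / (t - p)"
proof -
  let ?f = "\<lambda>t. exp (a * t)"
  let ?\<epsilon> = "\<lambda>t. if t = p then deriv ?f p else (?f t - ?f p) / (t - p)"
  have "(?f has_field_derivative a) (at p)"
    by (auto intro!: derivative_eq_intros simp: assms)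
  then have "?\<epsilon> p = a" by (simp add: DERIV_imp_deriv)
  moreover have "?\<epsilon> holomorphic_on UNIV"
    by (rule pole_lemma) (auto intro!: holomorphic_intros)
  moreover have "?\<epsilon> t = (?f t - 1) / (t - p)" if "t \<noteq> p" for t
    using that assms by simp
  ultimately show ?thesis using that by blast
qed

lemma expint_cmult: "expint h (\<lambda>t. k * c t) z = k * expint h c z"
  by (simp only: expint_def line_integral_def mult.assoc integral_mult_right_zero)

lemma line_integral_add_height: "line_integral (h + h') f = line_integral h (\<lambda>t. f (t + \<i> * h'))"
  by (simp add: line_integral_def Complex_eq algebra_simps)

lemma exp_pi_eq_1:
  fixes a :: real and t :: complex
  assumes "exp (pi * a * t) = 1" "0 < a"
  shows "\<exists>n::int. t = Complex 0 (2 * n / a)"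
proof -
  from assms(1) obtain n :: int where "pi * a * Re t = 0" "pi * a * Im t = of_int (2 * n) * pi"
    unfolding exp_eq_1 by auto
  then have "Re t = 0" "a * Im t = 2 * of_int n" using assms(2) by auto
  then show ?thesis using assms(2) by (intro exI[of _ n]) (auto simp: complex_eq_iff field_simps)
qed

locale qdilog =
  fixes b :: real
  assumes b_pos: "0 < b" and b_less: "b < 1"
begin

abbreviation "Q \<equiv> Qb b"

lemma b_less_inverse: "b < 1 / b"
proof -
  have "b * b < 1 * 1" using b_pos b_less by (intro mult_strict_mono) auto
  then show ?thesis using b_pos by (simp add: field_simps)
qed

lemma b_less_half_Q: "b < Q / 2"
  using b_less_inverse by (simp add: Qb_def)

lemma Q_pos: "0 < Q" using b_less_half_Q b_pos by linarith

lemma cos_pi_b_ne_1: "cos (pi * b * b) \<noteq> 1" "cos (pi * b * (-b)) \<noteq> 1"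
proof -
  have "0 < pi * b * b" "pi * b * b < pi"
    using b_pos b_less mult_strict_mono[of b 1 b 1] by (auto simp: mult.assoc)
  then have "cos (pi * b * b) < cos 0" by (intro cos_monotone_0_pi) auto
  then show "cos (pi * b * b) \<noteq> 1" "cos (pi * b * (-b)) \<noteq> 1" by auto
qed

text \<open>The zeros of \<open>exp (pi * t / b) - 1\<close> are the integer multiples of
  \<open>2 i b\<close>, and the three heights lie midway between neighbouring zeros, so the cosine
  is \<open>-1\<close> each time.\<close>

lemma cos_pi_inverse_b_ne_1: "cos (pi * (1/b) * b) \<noteq> 1" "cos (pi * (1/b) * (-b)) \<noteq> 1" "cos (pi * (1/b) * (3 * b)) \<noteq> 1"
proof -
  have "cos (3 * pi) = cos (2 * pi + pi)" by simp
  also have "\<dots> = -1" by (simp only: cos_add) simp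
  finally show "cos (pi * (1/b) * b) \<noteq> 1" "cos (pi * (1/b) * (-b)) \<noteq> 1" "cos (pi * (1/b) * (3 * b)) \<noteq> 1"
    using b_pos by (auto simp: mult.commute)
qed

text \<open>Both the factor gained by \<open>exp (pi * t * z)\<close> when \<open>t\<close> moves up
  by \<open>2 i b\<close> and the quantity in the difference equation with factor
  \<open>1 - nome z\<close> for \<open>Gb\<close>.\<close>

definition nome :: "complex \<Rightarrow> complex" where
  "nome z = exp (2 * pi * \<i> * b * z)"

text \<open>The line integral picks up the residue at \<open>t = 2 i b\<close> when it is shifted by the period \<open>2 i b\<close>.\<close>

lemma expint_inverse_exp_minus_1:
  assumes z: "0 < Re z" "Re z < 1 / b"
  shows "expint b (\<lambda>t::complex. 1 / (exp (pi * (1/b) * t) - 1)) z * (1 - nome z) = 2 * \<i> * b * nome z"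
proof -
  let ?c = "\<lambda>t::complex. 1 / (exp (pi * (1/b) * t) - 1)"
  define a where "a = complex_of_real (pi * (1/b))"
  define p where "p = Complex 0 (2 * b)"
  have p1: "exp (a * p) = 1"
  proof -
    have "a * p = 2 * pi * \<i>" using b_pos by (simp add: a_def p_def complex_eq_iff)
    then show ?thesis by simp
  qed
  obtain \<epsilon> where e: "\<epsilon> holomorphic_on UNIV" "\<epsilon> p = a" "\<And>t::complex. t \<noteq> p \<Longrightarrow> \<epsilon> t = (exp (a * t) - 1) / (t - p)"
    using holomorphic_exp_divided_difference[OF p1] by blast
  let ?S = "{t. 0 < Im t \<and> Im t < 4 * b}"
  \<comment> \<open>Within \<open>0 < Im t < 4 * b\<close> the point \<open>2 i b\<close> is the
    only zero of \<open>exp (a * t) - 1\<close>, and it has been divided out.\<close>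
  have ne: "\<epsilon> t \<noteq> 0" if "t \<in> ?S" for t
  proof (cases "t = p")
    case True then show ?thesis using e(2) b_pos by (simp add: a_def)
  next
    case False
    have "exp (a * t) \<noteq> 1"
    proof
      assume "exp (a * t) = 1"
      then obtain n :: int where n: "t = Complex 0 (2 * n / (1 / b))"
        using exp_pi_eq_1[of "1/b" t] b_pos by (auto simp: a_def)
      then have "0 < real_of_int n" "real_of_int n < 2" using that b_pos by (auto simp: zero_less_mult_iff)
      then have "n = 1" by linarith
      then show False using n False by (simp add: p_def)
    qed
    then show ?thesis using e(3)[OF False] False by simp
  qed
  define g :: "complex \<Rightarrow> complex" where "g = (\<lambda>t::complex. exp (pi * t * z) / \<epsilon> t)"
  have g: "g holomorphic_on ?S"
    unfolding g_def using ne by (auto intro!: holomorphic_intros holomorphic_on_subset[OF e(1)])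
  have eq: "g t / (t - p) = ?c t * exp (pi * t * z)" for t :: complex
    using e(3)[of t] p1 by (cases "t = p") (auto simp: g_def a_def field_simps)
  have z': "0 < Re z" "Re z < 1/b" using z by auto
  obtain d C where C: "0 < d" "0 \<le> C"
    "\<And>t::complex. t \<in> {t. 1 \<le> \<bar>Re t\<bar>} \<Longrightarrow> norm (?c t) * exp (pi * Re z * Re t) \<le> C * exp (- d * \<bar>Re t\<bar>)"
    using exp_typeE[OF exp_type_exp_minus_1_ends[of "1/b"] z'] b_pos by auto
  have "line_integral b (\<lambda>t. g t / (t - p)) - line_integral (3 * b) (\<lambda>t. g t / (t - p)) = 2 * pi * \<i> * g p"
  proof (rule line_integral_shift_simple_pole[OF g])
    show "norm (g t / (t - p)) \<le> C * exp (3 * pi * b * \<bar>Im z\<bar>) * exp (- d * \<bar>Re t\<bar>)"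
      if t: "b \<le> Im t" "Im t \<le> 3 * b" "1 \<le> \<bar>Re t\<bar>" for t
    proof -
      have "norm (g t / (t - p)) = norm (?c t) * (exp (pi * Re z * Re t) * exp (- (pi * Im t * Im z)))"
        unfolding eq norm_mult norm_exp_line by (simp add: exp_add[symmetric])
      also have "\<dots> = (norm (?c t) * exp (pi * Re z * Re t)) * exp (- (pi * Im t * Im z))" by simp
      also have "\<dots> \<le> (C * exp (- d * \<bar>Re t\<bar>)) * exp (3 * pi * b * \<bar>Im z\<bar>)"
      proof (rule mult_mono)
        have "- (pi * Im t * Im z) \<le> \<bar>pi * Im t * Im z\<bar>" by simp
        also have "\<dots> = pi * (\<bar>Im t\<bar> * \<bar>Im z\<bar>)" by (simp add: abs_mult)
        also have "\<dots> \<le> pi * ((3 * b) * \<bar>Im z\<bar>)"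
          using t b_pos by (intro mult_left_mono mult_right_mono) auto
        finally show "exp (- (pi * Im t * Im z)) \<le> exp (3 * pi * b * \<bar>Im z\<bar>)" by (simp add: mult_ac)
      qed (use C t in auto)
      finally show ?thesis by (simp add: mult_ac)
    qed
  qed (use b_pos C(1) in \<open>auto simp: p_def\<close>)
  then have 1: "expint b ?c z - expint (3 * b) ?c z = 2 * pi * \<i> * g p"
    by (simp add: eq expint_def)
  have "expint (3 * b) ?c z = line_integral (b + 2 * b) (\<lambda>t. ?c t * exp (pi * t * z))"
    by (simp add: expint_def)
  also have "\<dots> = line_integral b (\<lambda>t. ?c t * exp (pi * t * z) * nome z)"
  proof -
    have "pi * (1/b) * (t + \<i> * (2 * b)) = pi * (1/b) * t + 2 * pi * \<i>" for t :: complex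
      using b_pos by (simp add: field_simps)
    moreover have "exp (pi * (t + \<i> * (2 * b)) * z) = exp (pi * t * z) * nome z" for t :: complex
      by (simp add: nome_def exp_add[symmetric] algebra_simps)
    ultimately show ?thesis unfolding line_integral_add_height by (simp add: exp_add)
  qed
  also have "\<dots> = expint b ?c z * nome z"
    by (simp only: expint_def line_integral_def integral_mult_left_zero)
  finally have 2: "expint (3 * b) ?c z = expint b ?c z * nome z" .
  have "g p = nome z * b / pi" unfolding g_def e(2) using b_pos
    by (simp add: a_def p_def nome_def Complex_eq mult_ac)
  then have 3: "2 * pi * \<i> * g p = 2 * \<i> * b * nome z" by simp
  show ?thesis using 1 unfolding 2 3 by (simp add: algebra_simps)
qed

text \<open>The integrand of the dilogarithm with the factor \<open>exp (pi * b * t) - 1\<close>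
  cancelled: its transform at \<open>z\<close> is the increment of the dilogarithm integral from
  \<open>z\<close> to \<open>z + b\<close>.\<close>

abbreviation "jc \<equiv> \<lambda>t::complex. 1 / t * (1 / (exp (pi * (1/b) * t) - 1))"

lemma exp_type_jc: "exp_type {t. Im t = b} 0 (1/b) jc"
  using b_pos cos_pi_inverse_b_ne_1 by (intro exp_type_inverse exp_type_exp_minus_1) auto

lemma expint_jc_bound:
  obtains K where "0 \<le> K" "\<And>z::complex. Re z = 1 / (2 * b) \<Longrightarrow> norm (expint b jc z) \<le> K * exp (- pi * b * Im z)"
  using expint_bound[OF exp_type_jc, of "1 / (2 * b)" "1 / (2 * b)"] b_pos
  by (smt (verit) divide_strict_left_mono mult_pos_pos zero_less_divide_1_iff)

text \<open>Differentiation removes the factor \<open>1 / t\<close> and leaves the integral known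
  from \<open>expint_inverse_exp_minus_1\<close>, so the quotient of the two sides has derivative
  \<open>0\<close>. It equals \<open>1\<close> because both \<open>expint b jc\<close> and
  \<open>nome\<close> tend to \<open>0\<close> upwards along \<open>Re z = 1 / (2 * b)\<close>.
  Working with the quotient avoids any choice of a logarithm.\<close>

lemma exp_expint_jc:
  assumes z: "0 < Re z" "Re z < 1 / b"
  shows "exp (- expint b jc z) = 1 - nome z"
proof -
  define S where "S = {z. 0 < Re z \<and> Re z < 1 / b}"
  have S: "convex S"
  proof -
    have "S = {z. Re z > 0} \<inter> {z. Re z < 1/b}" by (auto simp: S_def)
    then show ?thesis by (simp add: convex_Int convex_halfspace_Re_gt convex_halfspace_Re_lt)
  qed
  define \<psi> where "\<psi> z = exp (- expint b jc z) / (1 - nome z)" for z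
  \<comment> \<open>A zero of the factor would annihilate the left side of the residue identity but
    not the right side.\<close>
  have ne: "1 - nome z \<noteq> 0" if "z \<in> S" for z
  proof
    assume "1 - nome z = 0"
    then have "2 * \<i> * b * nome z = 0" using expint_inverse_exp_minus_1[of z] that by (simp add: S_def)
    then show False using b_pos by (simp add: nome_def)
  qed
  have der: "(\<psi> has_field_derivative 0) (at z within S)" if z: "z \<in> S" for z
  proof -
    define M where "M = expint b (\<lambda>t::complex. 1 / (exp (pi * (1/b) * t) - 1)) z"
    have "expint b (\<lambda>t. pi * t * jc t) z = pi * M"
    proof -
      have "expint b (\<lambda>t. pi * t * jc t) z = expint b (\<lambda>t. pi * (1 / (exp (pi * (1/b) * t) - 1))) z"
        by (rule expint_cong) (use b_pos in auto)
      then show ?thesis by (simp only: M_def expint_cmult)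
    qed
    then have d: "(expint b jc has_field_derivative pi * M) (at z)"
      using expint_deriv[OF exp_type_jc, of z] z by (simp add: S_def)
    have M: "M * (1 - nome z) = 2 * \<i> * b * nome z"
      using expint_inverse_exp_minus_1[of z] z by (simp add: S_def M_def)
    have d2: "(nome has_field_derivative 2 * pi * \<i> * b * nome z) (at z)"
      unfolding nome_def by (auto intro!: derivative_eq_intros)
    have "(\<psi> has_field_derivative ((exp (- expint b jc z) * (- (pi * M))) * (1 - nome z) -
         exp (- expint b jc z) * (- (2 * pi * \<i> * b * nome z))) / ((1 - nome z) * (1 - nome z))) (at z)"
      unfolding \<psi>_def by (rule derivative_eq_intros d d2 refl | use ne[OF z] in simp)+
    moreover have "(exp (- expint b jc z) * (- (pi * M))) * (1 - nome z) -
         exp (- expint b jc z) * (- (2 * pi * \<i> * b * nome z)) = - exp (- expint b jc z) * pi * (M * (1 - nome z) - 2 * \<i> * b * nome z)"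
      by (simp add: algebra_simps)
    moreover have "M * (1 - nome z) - 2 * \<i> * b * nome z = 0" using M by simp
    ultimately have "(\<psi> has_field_derivative 0) (at z)" by (simp only: mult_zero_right div_0)
    then show ?thesis by (rule has_field_derivative_at_within)
  qed
  obtain c where c: "\<And>z::complex. z \<in> S \<Longrightarrow> \<psi> z = c"
    using has_field_derivative_zero_constant[OF S der] by (auto simp: constant_on_def)
  obtain K where K: "0 \<le> K" "\<And>z::complex. Re z = 1 / (2 * b) \<Longrightarrow> norm (expint b jc z) \<le> K * exp (- pi * b * Im z)"
    using expint_jc_bound by blast
  have lim0: "(\<lambda>n. exp (- pi * b * real n)) \<longlonglongrightarrow> 0"
  proof -
    have "filterlim (\<lambda>x. (- pi * b) * x) at_bot at_top"
      using filterlim_tendsto_neg_mult_at_bot[OF tendsto_const _ filterlim_ident, of "- pi * b"] b_pos by simp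
    from filterlim_compose[OF exp_at_bot this]
    show ?thesis by (rule filterlim_compose[OF _ filterlim_real_sequentially])
  qed
  let ?z = "\<lambda>n. Complex (1 / (2 * b)) (real n)"
  have j0: "(\<lambda>n. expint b jc (?z n)) \<longlonglongrightarrow> 0"
  proof (rule Lim_null_comparison)
    show "\<forall>\<^sub>F n in sequentially. norm (expint b jc (?z n)) \<le> K * exp (- pi * b * real n)"
      using K(2)[of "?z _"] by simp
    show "(\<lambda>n. K * exp (- pi * b * real n)) \<longlonglongrightarrow> 0" using tendsto_mult_left[OF lim0, of K] by simp
  qed
  have n0: "(\<lambda>n. nome (?z n)) \<longlonglongrightarrow> 0"
  proof (rule Lim_null_comparison)
    show "\<forall>\<^sub>F n in sequentially. norm (nome (?z n)) \<le> exp (- pi * b * real n)"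
      using b_pos by (intro always_eventually) (auto simp: nome_def norm_exp_eq_Re)
  qed (rule lim0)
  have "(\<lambda>n. \<psi> (?z n)) \<longlonglongrightarrow> exp (- 0) / (1 - 0)"
    unfolding \<psi>_def by (intro tendsto_intros j0 n0) auto
  moreover have "\<psi> (?z n) = c" for n
    using c[of "?z n"] b_pos by (simp add: S_def field_simps)
  ultimately have "c = 1" by (simp add: LIMSEQ_const_iff)
  then have "\<psi> z = 1" using c[of z] z by (simp add: S_def)
  then show ?thesis using ne[of z] z by (simp add: \<psi>_def S_def)
qed

section \<open>The dilogarithm integral: functional equation and behaviour at the pole
  \<open>0\<close>\<close>

abbreviation "gc \<equiv> \<lambda>t::complex. 1 / t * (1 / (exp (pi * b * t) - 1) * (1 / (exp (pi * (1/b) * t) - 1)))"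

lemma exp_type_gc: "exp_type {t. Im t = b} 0 Q gc" "exp_type {t. Im t = - b} 0 Q gc"
proof -
  have "exp_type {t. Im t = b} (0 + 0) (b + 1/b) (\<lambda>t::complex. 1 / (exp (pi * b * t) - 1) * (1 / (exp (pi * (1/b) * t) - 1)))"
    using b_pos cos_pi_b_ne_1 cos_pi_inverse_b_ne_1
    by (intro exp_type_mult exp_type_exp_minus_1) auto
  then show "exp_type {t. Im t = b} 0 Q gc"
    using b_pos by (intro exp_type_inverse) (auto simp: Qb_def)
  have "exp_type {t. Im t = -b} (0 + 0) (b + 1/b) (\<lambda>t::complex. 1 / (exp (pi * b * t) - 1) * (1 / (exp (pi * (1/b) * t) - 1)))"
    using b_pos cos_pi_b_ne_1 cos_pi_inverse_b_ne_1
    by (intro exp_type_mult exp_type_exp_minus_1) auto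
  then show "exp_type {t. Im t = - b} 0 Q gc"
    using b_pos by (intro exp_type_inverse) (auto simp: Qb_def)
qed

lemma Gb_strip_eq: "Gb_strip b z = cnj (zeta_b b) * exp (- expint b gc z)"
  unfolding Gb_strip_def expint_def by (simp add: mult_ac)

lemma zeta_b_nonzero: "zeta_b b \<noteq> 0"
  by (simp add: zeta_b_def)

lemma Gb_strip_nonzero: "Gb_strip b z \<noteq> 0"
  by (simp add: Gb_strip_eq zeta_b_nonzero)

lemma holomorphic_Gb_strip: "Gb_strip b holomorphic_on {z. 0 < Re z \<and> Re z < Q}"
proof -
  have "expint b gc holomorphic_on {z. 0 < Re z \<and> Re z < Q}"
    unfolding holomorphic_on_def field_differentiable_def
    using expint_deriv[OF exp_type_gc(1)] has_field_derivative_at_within by blast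
  then show ?thesis unfolding Gb_strip_eq[abs_def] by (intro holomorphic_intros)
qed

text \<open>For these \<open>z\<close> both \<open>z\<close> and \<open>z + b\<close> lie in the
  strip of convergence, and the two integrands differ by the factor \<open>exp (pi * b * t)\<close>.
  Subtracting them cancels one denominator and leaves \<open>jc\<close>.\<close>

lemma Gb_strip_add_b:
  assumes z: "0 < Re z" "Re z < 1 / b"
  shows "Gb_strip b (z + b) = (1 - nome z) * Gb_strip b z"
proof -
  have i: "line_integrable b (\<lambda>t. gc t * exp (pi * t * (z + b)))" "line_integrable b (\<lambda>t. gc t * exp (pi * t * z))"
    by (rule exp_type_line_integrable[OF exp_type_gc(1)]; use z b_pos b_less_inverse in \<open>auto simp: Qb_def\<close>)+
  have ne: "exp (pi * b * t) \<noteq> 1" if "Im t = b" for t :: complex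
    by (rule exp_type_exp_minus_1(2)[OF b_pos _ that]) (use cos_pi_b_ne_1 in auto)
  have "expint b gc (z + b) - expint b gc z
      = (LINT u|lborel. gc (Complex u b) * exp (pi * Complex u b * (z + b)) - gc (Complex u b) * exp (pi * Complex u b * z))"
    using i unfolding expint_def line_integral_def line_integrable_def by (intro Bochner_Integration.integral_diff[symmetric])
  also have "\<dots> = expint b jc z"
    unfolding expint_def line_integral_def
  proof (rule Bochner_Integration.integral_cong)
    fix u :: real
    define t where "t = Complex u b"
    have "exp (pi * t * (z + b)) = exp (pi * t * z) * exp (pi * b * t)"
      by (simp add: exp_add[symmetric] algebra_simps)
    then have "gc t * exp (pi * t * (z + b)) - gc t * exp (pi * t * z)
        = gc t * exp (pi * t * z) * (exp (pi * b * t) - 1)"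
      by (simp only: right_diff_distrib mult.assoc mult_1_right)
    also have "\<dots> = jc t * exp (pi * t * z)" using ne[of t] by (simp add: t_def)
    finally show "gc t * exp (pi * t * (z + b)) - gc t * exp (pi * t * z) = jc t * exp (pi * t * z)" .
  qed simp
  finally have "expint b gc (z + b) = expint b gc z + expint b jc z" by (simp add: algebra_simps)
  then have "exp (- expint b gc (z + b)) = exp (- expint b gc z) * exp (- expint b jc z)"
    by (simp add: exp_add[symmetric])
  then show ?thesis unfolding Gb_strip_eq exp_expint_jc[OF z] by simp
qed

text \<open>Substituting \<open>- t\<close> for \<open>t\<close> exchanges the lines above and below the pole at \<open>0\<close>.\<close>

lemma expint_gc_reflect:
  fixes z :: complex
  shows "expint (- b) gc z = - expint b gc (Q - z)"
proof -
  let ?f = "\<lambda>u. gc (Complex u (-b)) * exp (pi * Complex u (-b) * z)"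
  have "expint (-b) gc z = (LINT u|lborel. ?f u)"
    by (simp only: expint_def line_integral_def)
  also have "\<dots> = \<bar>-1\<bar> *\<^sub>R (LINT u|lborel. ?f (0 + (-1) * u))"
    by (rule lborel_integral_real_affine) simp
  also have "\<dots> = (LINT u|lborel. - (gc (Complex u b) * exp (pi * Complex u b * (Q - z))))"
  proof -
    have "?f (0 + (-1) * u) = - (gc (Complex u b) * exp (pi * Complex u b * (Q - z)))" for u :: real
    proof -
      define t where "t = Complex u b"
      define A where "A = exp (pi * b * t)"
      define B where "B = exp (pi * (1/b) * t)"
      define W where "W = exp (- (pi * t * z))"
      have it: "Im t = b" by (simp add: t_def)
      have nz: "A \<noteq> 1" "B \<noteq> 1"
        using exp_type_exp_minus_1(2)[OF b_pos cos_pi_b_ne_1(1) it]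
          exp_type_exp_minus_1(2)[OF _ cos_pi_inverse_b_ne_1(1) it] b_pos
        by (simp_all add: A_def B_def)
      have nz': "A \<noteq> 0" "B \<noteq> 0" "t \<noteq> 0" using it b_pos by (auto simp: A_def B_def)
      have m: "Complex (0 + (-1) * u) (-b) = - t" by (simp add: t_def complex_eq_iff)
      have A': "exp (pi * b * (- t)) = 1 / A" by (simp add: A_def exp_minus field_simps)
      have B': "exp (pi * (1/b) * (- t)) = 1 / B" by (simp add: B_def exp_minus field_simps)
      have W': "exp (pi * (- t) * z) = W" by (simp add: W_def)
      have "exp (pi * t * (Q - z)) = exp (pi * b * t + pi * (1/b) * t + - (pi * t * z))"
        by (rule arg_cong[of _ _ exp]) (simp add: Qb_def algebra_simps)
      then have Q': "exp (pi * t * (Q - z)) = A * B * W" by (simp only: exp_add A_def B_def W_def)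
      \<comment> \<open>The factors \<open>A\<close> and \<open>B\<close> released here multiply to
        \<open>exp (pi * Q * t)\<close>, which turns \<open>- z\<close> into
        \<open>Q - z\<close>.\<close>
      have "1 / (1 / A - 1) = - (A * (1 / (A - 1)))" "1 / (1 / B - 1) = - (B * (1 / (B - 1)))"
        using nz nz' by (simp_all add: divide_simps) (simp_all add: algebra_simps)
      then have "1 / (-t) * (1 / (1 / A - 1) * (1 / (1 / B - 1))) * W
          = - (1 / t * (1 / (A - 1) * (1 / (B - 1))) * (A * B * W))"
        by simp
      then show ?thesis unfolding m A' B' W' t_def[symmetric] Q' A_def[symmetric] B_def[symmetric] .
    qed
    then show ?thesis by (simp only: abs_minus_cancel abs_one scaleR_one)
  qed
  also have "\<dots> = - expint b gc (Q - z)"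
    by (simp only: Bochner_Integration.integral_minus expint_def line_integral_def)
  finally show ?thesis .
qed

text \<open>The integrand \<open>gc\<close> has a triple pole at \<open>0\<close>. Two derivatives
  in \<open>z\<close> contribute \<open>(pi * t)^2\<close> and reduce it to a simple pole whose
  residue is \<open>pi^2 / ((pi * b) * (pi / b)) = 1\<close>.\<close>

lemma expint_gc_second_difference:
  assumes z: "0 < Re z" "Re z < Q"
  defines "c2 \<equiv> \<lambda>t::complex. pi * t * (pi * t * gc t)"
  shows "expint (- b) c2 z - expint b c2 z = 2 * pi * \<i>"
proof -
  define a1 where "a1 = complex_of_real (pi * b)"
  define a2 where "a2 = complex_of_real (pi * (1/b))"
  obtain e1 where e1: "e1 holomorphic_on UNIV" "e1 0 = a1" "\<And>t::complex. t \<noteq> 0 \<Longrightarrow> e1 t = (exp (a1 * t) - 1) / (t - 0)"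
    by (rule holomorphic_exp_divided_difference[of a1 0]) auto
  obtain e2 where e2: "e2 holomorphic_on UNIV" "e2 0 = a2" "\<And>t::complex. t \<noteq> 0 \<Longrightarrow> e2 t = (exp (a2 * t) - 1) / (t - 0)"
    by (rule holomorphic_exp_divided_difference[of a2 0]) auto
  let ?S = "{t. - 2 * b < Im t \<and> Im t < 2 * b}"
  have ne1: "e1 t \<noteq> 0" if "t \<in> ?S" for t
  proof (cases "t = 0")
    case True then show ?thesis using e1(2) b_pos by (simp add: a1_def)
  next
    case False
    have "exp (a1 * t) \<noteq> 1"
    proof
      assume "exp (a1 * t) = 1"
      then obtain n :: int where n: "t = Complex 0 (2 * n / b)"
        using exp_pi_eq_1[of b t] b_pos by (auto simp: a1_def)
      \<comment> \<open>Here \<open>b < 1\<close> enters: the nonzero zeros \<open>2 i n / b\<close>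
        of the first factor lie outside \<open>\<bar>Im t\<bar> < 2 * b\<close>.\<close>
      have "b * b < 1" using b_pos b_less mult_strict_mono[of b 1 b 1] by auto
      have im: "Im t = 2 * real_of_int n / b" by (simp add: n)
      have "\<bar>2 * real_of_int n / b\<bar> < 2 * b"
        using that unfolding im[symmetric] by (simp add: abs_less_iff)
      then have "\<bar>real_of_int n\<bar> < b * b" using b_pos by (simp add: abs_mult field_simps)
      then have "n = 0" using \<open>b * b < 1\<close> by linarith
      then show False using n False by (simp add: complex_eq_iff)
    qed
    then show ?thesis using e1(3)[OF False] False by simp
  qed
  have ne2: "e2 t \<noteq> 0" if "t \<in> ?S" for t
  proof (cases "t = 0")
    case True then show ?thesis using e2(2) b_pos by (simp add: a2_def)
  next
    case False
    have "exp (a2 * t) \<noteq> 1"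
    proof
      assume "exp (a2 * t) = 1"
      then obtain n :: int where n: "t = Complex 0 (2 * n / (1/b))"
        using exp_pi_eq_1[of "1/b" t] b_pos by (auto simp: a2_def)
      have im: "Im t = 2 * real_of_int n * b" by (simp add: n)
      have "\<bar>2 * real_of_int n * b\<bar> < 2 * b"
        using that unfolding im[symmetric] by (simp add: abs_less_iff)
      then have "\<bar>real_of_int n\<bar> < 1" using b_pos by (simp add: abs_mult)
      then have "n = 0" by linarith
      then show False using n False by (simp add: complex_eq_iff)
    qed
    then show ?thesis using e2(3)[OF False] False by simp
  qed
  define g where "g = (\<lambda>t::complex. pi * pi * exp (pi * t * z) / (e1 t * e2 t))"
  have g: "g holomorphic_on ?S"
    unfolding g_def using ne1 ne2
    by (auto intro!: holomorphic_intros holomorphic_on_subset[OF e1(1)] holomorphic_on_subset[OF e2(1)])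
  have eq: "g t / (t - 0) = c2 t * exp (pi * t * z)" for t :: complex
  proof (cases "t = 0")
    case False
    then show ?thesis
      using e1(3)[of t] e2(3)[of t] by (simp add: g_def c2_def a1_def a2_def)
  qed (simp add: c2_def)
  let ?T = "{t. 1 \<le> \<bar>Re t\<bar> \<and> - b \<le> Im t \<and> Im t \<le> b}"
  have "exp_type ?T (0 + 0) (b + 1/b) (\<lambda>t::complex. 1 / (exp (pi * b * t) - 1) * (1 / (exp (pi * (1/b) * t) - 1)))"
    using b_pos by (intro exp_type_mult exp_type_subset[OF exp_type_exp_minus_1_ends]) auto
  then have base: "exp_type ?T 0 Q (\<lambda>t::complex. 1 / (exp (pi * b * t) - 1) * (1 / (exp (pi * (1/b) * t) - 1)))"
    by (simp only: Qb_def add_0)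
  have "exp_type ?T 0 Q (\<lambda>t. (pi * pi * t) * (1 / (exp (pi * b * t) - 1) * (1 / (exp (pi * (1/b) * t) - 1))))"
  proof (rule exp_type_mult_linear_growth[where A="pi * pi * (1 + b)", OF base])
    fix t :: complex assume "t \<in> ?T"
    then have "norm t \<le> \<bar>Re t\<bar> + b" using cmod_le[of t] by auto
    also have "\<dots> \<le> (1 + b) * (1 + \<bar>Re t\<bar>)" using b_pos by (simp add: algebra_simps)
    finally show "norm (pi * pi * t) \<le> pi * pi * (1 + b) * (1 + \<bar>Re t\<bar>)"
      by (simp add: norm_mult mult.assoc)
  qed (use b_pos in \<open>auto intro!: continuous_intros\<close>)
  then obtain d C where C: "0 < d" "0 \<le> C"
    "\<And>t::complex. t \<in> ?T \<Longrightarrow> norm ((pi * pi * t) * (1 / (exp (pi * b * t) - 1) * (1 / (exp (pi * (1/b) * t) - 1)))) * exp (pi * Re z * Re t) \<le> C * exp (- d * \<bar>Re t\<bar>)"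
    using exp_typeE[OF _ z] by blast
  have "line_integral (-b) (\<lambda>t. g t / (t - 0)) - line_integral b (\<lambda>t. g t / (t - 0)) = 2 * pi * \<i> * g 0"
  proof (rule line_integral_shift_simple_pole[OF g])
    show "norm (g t / (t - 0)) \<le> C * exp (pi * b * \<bar>Im z\<bar>) * exp (- d * \<bar>Re t\<bar>)"
      if t: "- b \<le> Im t" "Im t \<le> b" "1 \<le> \<bar>Re t\<bar>" for t
    proof -
      have c2: "c2 t = (pi * pi * t) * (1 / (exp (pi * b * t) - 1) * (1 / (exp (pi * (1/b) * t) - 1)))"
        using t by (auto simp: c2_def)
      have "norm (g t / (t - 0)) = norm (c2 t) * (exp (pi * Re z * Re t) * exp (- (pi * Im t * Im z)))"
        unfolding eq norm_mult norm_exp_line by (simp add: exp_add[symmetric])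
      also have "\<dots> = (norm (c2 t) * exp (pi * Re z * Re t)) * exp (- (pi * Im t * Im z))" by simp
      also have "\<dots> \<le> (C * exp (- d * \<bar>Re t\<bar>)) * exp (pi * b * \<bar>Im z\<bar>)"
      proof (rule mult_mono)
        have "- (pi * Im t * Im z) \<le> \<bar>pi * Im t * Im z\<bar>" by simp
        also have "\<dots> = pi * (\<bar>Im t\<bar> * \<bar>Im z\<bar>)" by (simp add: abs_mult)
        also have "\<dots> \<le> pi * (b * \<bar>Im z\<bar>)"
          using t b_pos by (intro mult_left_mono mult_right_mono) auto
        finally show "exp (- (pi * Im t * Im z)) \<le> exp (pi * b * \<bar>Im z\<bar>)" by (simp add: mult_ac)
        show "norm (c2 t) * exp (pi * Re z * Re t) \<le> C * exp (- d * \<bar>Re t\<bar>)"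
          unfolding c2 using C(3)[of t] t by blast
      qed (use C in auto)
      finally show ?thesis by (simp add: mult_ac)
    qed
  qed (use b_pos C(1) in auto)
  moreover have "g 0 = 1" using b_pos by (simp add: g_def e1(2) e2(2) a1_def a2_def)
  ultimately show ?thesis by (simp only: eq expint_def) simp
qed

text \<open>\<open>Sb\<close> with the integral itself in place of its meromorphic extension. Being
  an exponential times a nonzero constant, it vanishes nowhere, which makes all divisions by it
  legitimate.\<close>

definition S0 :: "complex \<Rightarrow> complex" where
  "S0 z = exp (pi * \<i> * z * (of_real Q - z) / 2) * Gb_strip b z"

lemma S0_nonzero: "S0 z \<noteq> 0"
  by (simp add: S0_def Gb_strip_nonzero)

section \<open>Reflection and growth of \<open>S0\<close>\<close>

lemma convex_Re_strip: "convex {z. a < Re z \<and> Re z < c}"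
proof -
  have "{z. a < Re z \<and> Re z < c} = {z. Re z > a} \<inter> {z. Re z < c}" by auto
  then show ?thesis by (simp add: convex_Int convex_halfspace_Re_gt convex_halfspace_Re_lt)
qed

lemma open_Re_strip: "open {z. a < Re z \<and> Re z < c}"
proof -
  have "{z. a < Re z \<and> Re z < c} = {z. Re z > a} \<inter> {z. Re z < c}" by auto
  then show ?thesis by (simp add: open_Int open_halfspace_Re_gt open_halfspace_Re_lt)
qed

text \<open>
  The constant is in fact \<open>1\<close>, but only its existence matters for the growth of \<open>S0\<close>.
  With \<open>D\<close> the difference of the integrals below and above the pole at \<open>0\<close>,
  \<open>D'' = 2 \<pi> i\<close> and \<open>D (Q - z) = D z\<close>, so \<open>D z - \<pi> i (z - Q / 2)\<^sup>2\<close> is constant.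
\<close>

lemma S0_reflect:
  obtains c where "c \<noteq> 0" "\<And>z::complex. 0 < Re z \<Longrightarrow> Re z < Q \<Longrightarrow> S0 z * S0 (Q - z) = c"
proof -
  let ?S = "{z. 0 < Re z \<and> Re z < Q}"
  define c1 where "c1 = (\<lambda>t::complex. pi * t * gc t)"
  define c2 where "c2 = (\<lambda>t::complex. pi * t * c1 t)"
  define D where "D z = expint (- b) gc z - expint b gc z" for z
  define D1 where "D1 z = expint (- b) c1 z - expint b c1 z" for z
  have et1: "exp_type {t. Im t = b} 0 Q c1" "exp_type {t. Im t = - b} 0 Q c1"
    unfolding c1_def by (rule exp_type_ident exp_type_gc)+
  have DD1: "(D has_field_derivative D1 z) (at z)" if "z \<in> ?S" for z
    using that unfolding D_def D1_def c1_def
    by (intro DERIV_diff expint_deriv[OF exp_type_gc(1)] expint_deriv[OF exp_type_gc(2)]) auto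
  have D1D2: "(D1 has_field_derivative 2 * pi * \<i>) (at z)" if "z \<in> ?S" for z
  proof -
    have "(D1 has_field_derivative expint (- b) c2 z - expint b c2 z) (at z)"
      using that unfolding D1_def c2_def
      by (intro DERIV_diff expint_deriv[OF et1(1)] expint_deriv[OF et1(2)]) auto
    then show ?thesis
      using expint_gc_second_difference[of z] that by (simp add: c2_def c1_def)
  qed
  have sym: "D (Q - z) = D z" for z :: complex
    using expint_gc_reflect[of z] expint_gc_reflect[of "complex_of_real Q - z"] unfolding D_def by simp
  have half: "complex_of_real (Q / 2) \<in> ?S" using Q_pos by simp
  \<comment> \<open>\<open>D\<close> is symmetric about \<open>Q / 2\<close>, so its derivative
    vanishes there; this determines the first constant of integration.\<close>
  have D1h: "D1 (Q / 2) = 0"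
  proof -
    have e: "complex_of_real Q - complex_of_real (Q / 2) = complex_of_real (Q / 2)"
      by (simp add: field_simps)
    have "((\<lambda>z. D (Q - z)) has_field_derivative D1 (Q / 2) * (- 1)) (at (complex_of_real (Q / 2)))"
    proof (rule DERIV_chain2[where f=D and g="\<lambda>z. complex_of_real Q - z"])
      show "(D has_field_derivative D1 (Q / 2)) (at (complex_of_real Q - complex_of_real (Q / 2)))"
        unfolding e by (rule DD1[OF half])
      show "((\<lambda>z. complex_of_real Q - z) has_field_derivative - 1) (at (complex_of_real (Q / 2)))"
        by (auto intro!: derivative_eq_intros)
    qed
    then have "(D has_field_derivative - D1 (Q / 2)) (at (Q / 2))" by (simp add: sym)
    with DD1[OF half] have "D1 (Q / 2) = - D1 (Q / 2)" by (metis DERIV_unique of_real_divide of_real_numeral)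
    then show ?thesis by simp
  qed
  have "\<exists>k. \<forall>z\<in>?S. D1 z - 2 * pi * \<i> * (z - Q / 2) = k"
  proof (rule has_field_derivative_zero_constant[OF convex_Re_strip])
    fix z assume z: "z \<in> ?S"
    have "((\<lambda>z. 2 * pi * \<i> * (z - Q / 2)) has_field_derivative 2 * pi * \<i>) (at z)"
      by (auto intro!: derivative_eq_intros)
    from DERIV_diff[OF D1D2[OF z] this]
    have "((\<lambda>z. D1 z - 2 * pi * \<i> * (z - Q / 2)) has_field_derivative 0) (at z)" by simp
    then show "((\<lambda>z. D1 z - 2 * pi * \<i> * (z - Q / 2)) has_field_derivative 0) (at z within ?S)"
      by (rule has_field_derivative_at_within)
  qed
  then obtain k1 where "\<forall>z\<in>?S. D1 z - 2 * pi * \<i> * (z - Q / 2) = k1" by (rule exE)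
  note k1 = bspec[OF this]
  have "k1 = 0" using k1[OF half] D1h by simp
  then have D1: "D1 z = 2 * pi * \<i> * (z - Q / 2)" if "z \<in> ?S" for z :: complex
    using k1[OF that] by simp
  have "\<exists>k. \<forall>z\<in>?S. D z - pi * \<i> * (z - Q / 2)\<^sup>2 = k"
  proof (rule has_field_derivative_zero_constant[OF convex_Re_strip])
    fix z assume z: "z \<in> ?S"
    have "((\<lambda>z. pi * \<i> * (z - Q / 2)\<^sup>2) has_field_derivative 2 * pi * \<i> * (z - Q / 2)) (at z)"
      by (auto intro!: derivative_eq_intros)
    from DERIV_diff[OF DD1[OF z] this]
    have "((\<lambda>z. D z - pi * \<i> * (z - Q / 2)\<^sup>2) has_field_derivative 0) (at z)"
      unfolding D1[OF z] by simp
    then show "((\<lambda>z. D z - pi * \<i> * (z - Q / 2)\<^sup>2) has_field_derivative 0) (at z within ?S)"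
      by (rule has_field_derivative_at_within)
  qed
  then obtain k where "\<forall>z\<in>?S. D z - pi * \<i> * (z - Q / 2)\<^sup>2 = k" by (rule exE)
  note k' = bspec[OF this]
  have k: "D z = pi * \<i> * (z - Q / 2)\<^sup>2 + k" if "z \<in> ?S" for z :: complex
    using k'[OF that] by (simp add: diff_eq_eq add.commute)
  show ?thesis
  proof (rule that[of "exp (pi * \<i> * Q\<^sup>2 / 4 + k) * (cnj (zeta_b b))\<^sup>2"])
    fix z :: complex assume "0 < Re z" "Re z < Q"
    then have z: "z \<in> ?S" by simp
    have "- expint b gc z + - expint b gc (Q - z) = D z"
      using expint_gc_reflect[of z] unfolding D_def by simp
    then have "exp (- expint b gc z) * exp (- expint b gc (Q - z)) = exp (pi * \<i> * (z - Q / 2)\<^sup>2 + k)"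
      unfolding k[OF z, symmetric] by (simp add: exp_add[symmetric])
    then have "S0 z * S0 (Q - z) = exp (pi * \<i> * z * (Q - z) / 2) * exp (pi * \<i> * (Q - z) * z / 2)
        * exp (pi * \<i> * (z - Q / 2)\<^sup>2 + k) * (cnj (zeta_b b))\<^sup>2"
      unfolding S0_def Gb_strip_eq by (simp add: power2_eq_square)
    \<comment> \<open>The prefactors are chosen so that \<open>z\<close> drops out:
      \<open>z * (Q - z) + (z - Q / 2)^2 = Q^2 / 4\<close>.\<close>
    also have "exp (pi * \<i> * z * (Q - z) / 2) * exp (pi * \<i> * (Q - z) * z / 2) * exp (pi * \<i> * (z - Q / 2)\<^sup>2 + k)
        = exp (pi * \<i> * Q\<^sup>2 / 4 + k)"
      by (simp add: exp_add[symmetric] power2_eq_square algebra_simps add_divide_distrib diff_divide_distrib)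
    finally show "S0 z * S0 (Q - z) = exp (pi * \<i> * Q\<^sup>2 / 4 + k) * (cnj (zeta_b b))\<^sup>2" .
  qed (simp add: zeta_b_nonzero)
qed

text \<open>For \<open>0 \<le> Im z\<close> the dilogarithm integral is bounded, so
  \<open>Gb_strip\<close> is bounded above and away from \<open>0\<close>. All growth comes from the
  quadratic exponential, whose modulus is exactly
  \<open>exp (pi * Im z * (Re z - Q / 2))\<close>.\<close>

lemma S0_bounds_upper_half:
  assumes e: "0 < e" "e \<le> Q / 2"
  obtains C where "0 < C" "\<And>z::complex. e \<le> Re z \<Longrightarrow> Re z \<le> Q - e \<Longrightarrow> 0 \<le> Im z \<Longrightarrow>
      norm (S0 z) \<le> C * exp (pi * Im z * (Re z - Q / 2)) \<and>
      inverse (norm (S0 z)) \<le> C * exp (- (pi * Im z * (Re z - Q / 2)))"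
proof -
  obtain K where K: "0 \<le> K" "\<And>z::complex. e \<le> Re z \<Longrightarrow> Re z \<le> Q - e \<Longrightarrow> norm (expint b gc z) \<le> K * exp (- pi * b * Im z)"
    by (rule expint_bound[OF exp_type_gc(1), of e "Q - e"]) (use e in auto)
  define A where "A = norm (zeta_b b)"
  have A: "0 < A" by (simp add: A_def zeta_b_nonzero)
  define C where "C = A * exp K + exp K / A"
  show ?thesis
  proof (rule that[of C])
    show "0 < C" using A by (simp add: C_def add_pos_pos)
    fix z :: complex assume z: "e \<le> Re z" "Re z \<le> Q - e" "0 \<le> Im z"
    have "norm (expint b gc z) \<le> K * exp (- pi * b * Im z)" using K z by blast
    also have "\<dots> \<le> K * 1" using K(1) z b_pos by (intro mult_left_mono) auto
    finally have I: "\<bar>Re (expint b gc z)\<bar> \<le> K" using abs_Re_le_cmod[of "expint b gc z"] by simp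
    define E where "E = exp (pi * Im z * (Re z - Q / 2))"
    define G where "G = exp (- Re (expint b gc z))"
    have G: "0 < G" "G \<le> exp K" "inverse G \<le> exp K" using I by (auto simp: G_def exp_minus[symmetric])
    have E: "0 < E" by (simp add: E_def)
    have "norm (exp (pi * \<i> * z * (of_real Q - z) / 2)) = E"
      by (simp add: E_def norm_exp_eq_Re algebra_simps diff_divide_distrib)
    then have n: "norm (S0 z) = E * (A * G)"
      by (simp add: S0_def Gb_strip_eq norm_mult A_def G_def norm_exp_eq_Re)
    have "E * (A * G) \<le> E * (A * exp K)" using E A G by (intro mult_left_mono) auto
    also have "\<dots> \<le> E * C" using E A by (intro mult_left_mono) (auto simp: C_def)
    finally have 1: "norm (S0 z) \<le> C * E" by (simp add: n mult.commute)
    have "inverse (E * (A * G)) = inverse E * (inverse A * inverse G)" by simp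
    also have "\<dots> \<le> inverse E * (inverse A * exp K)" using E A G by (intro mult_left_mono) auto
    also have "\<dots> \<le> inverse E * C" using E A by (intro mult_left_mono) (auto simp: C_def divide_inverse)
    finally have 2: "inverse (norm (S0 z)) \<le> C * inverse E" by (simp add: n mult.commute)
    show "norm (S0 z) \<le> C * exp (pi * Im z * (Re z - Q / 2)) \<and>
      inverse (norm (S0 z)) \<le> C * exp (- (pi * Im z * (Re z - Q / 2)))"
      using 1 2 by (simp add: E_def exp_minus)
  qed
qed

text \<open>For \<open>Im z < 0\<close> the point \<open>Q - z\<close> lies in the upper half plane,
  and \<open>S0 z * S0 (Q - z) = c\<close> exchanges the bound on the norm with the bound on its
  inverse.\<close>

lemma S0_bounds:
  assumes e: "0 < e" "e \<le> Q / 2"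
  obtains C where "0 < C" "\<And>z::complex. e \<le> Re z \<Longrightarrow> Re z \<le> Q - e \<Longrightarrow>
      norm (S0 z) \<le> C * exp (pi * \<bar>Im z\<bar> * (Re z - Q / 2))"
    "\<And>z::complex. e \<le> Re z \<Longrightarrow> Re z \<le> Q - e \<Longrightarrow>
      inverse (norm (S0 z)) \<le> C * exp (- (pi * \<bar>Im z\<bar> * (Re z - Q / 2)))"
proof -
  obtain C where C: "0 < C" "\<And>z::complex. e \<le> Re z \<Longrightarrow> Re z \<le> Q - e \<Longrightarrow> 0 \<le> Im z \<Longrightarrow>
      norm (S0 z) \<le> C * exp (pi * Im z * (Re z - Q / 2)) \<and>
      inverse (norm (S0 z)) \<le> C * exp (- (pi * Im z * (Re z - Q / 2)))"
    using S0_bounds_upper_half[OF e] by blast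
  obtain c where c: "c \<noteq> 0" "\<And>z::complex. 0 < Re z \<Longrightarrow> Re z < Q \<Longrightarrow> S0 z * S0 (Q - z) = c"
    using S0_reflect by blast
  define C' where "C' = C * (1 + norm c + inverse (norm c))"
  have cp: "0 < norm c" using c by simp
  have main: "norm (S0 z) \<le> C' * exp (pi * \<bar>Im z\<bar> * (Re z - Q / 2)) \<and>
      inverse (norm (S0 z)) \<le> C' * exp (- (pi * \<bar>Im z\<bar> * (Re z - Q / 2)))"
    if z: "e \<le> Re z" "Re z \<le> Q - e" for z :: complex
  proof (cases "0 \<le> Im z")
    case True
    define E where "E = exp (pi * Im z * (Re z - Q / 2))"
    have "C * E \<le> C' * E" "C * inverse E \<le> C' * inverse E"
      using C(1) cp by (auto simp: C'_def E_def algebra_simps intro!: mult_right_mono)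
    moreover have "norm (S0 z) \<le> C * E" "inverse (norm (S0 z)) \<le> C * inverse E"
      using C(2)[OF z True] by (auto simp: E_def exp_minus)
    ultimately have "norm (S0 z) \<le> C' * E \<and> inverse (norm (S0 z)) \<le> C' * inverse E"
      by (blast intro: order.trans)
    then show ?thesis using True by (simp add: E_def exp_minus)
  next
    case False
    define E where "E = exp (pi * \<bar>Im z\<bar> * (Re z - Q / 2))"
    have E: "0 < E" by (simp add: E_def)
    have e1: "exp (pi * Im (Q - z) * (Re (Q - z) - Q / 2)) = inverse E"
      using False by (simp add: E_def exp_minus[symmetric] algebra_simps)
    then have e2: "exp (- (pi * Im (Q - z) * (Re (Q - z) - Q / 2))) = E" by (simp add: exp_minus)
    have b1: "norm (S0 (Q - z)) \<le> C * inverse E" and b2: "inverse (norm (S0 (Q - z))) \<le> C * E"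
      using C(2)[of "Q - z"] z False unfolding e1 e2 by auto
    have "norm (S0 z) * norm (S0 (Q - z)) = norm c"
      using c(2)[of z] z e by (simp add: norm_mult[symmetric])
    then have n: "norm (S0 z) = norm c * inverse (norm (S0 (Q - z)))"
      by (simp add: S0_nonzero field_simps)
    have "norm (S0 z) \<le> norm c * (C * E)" unfolding n using b2 by (intro mult_left_mono) auto
    also have "\<dots> \<le> C' * E" using C(1) cp E by (auto simp: C'_def algebra_simps intro!: mult_right_mono)
    finally have r1: "norm (S0 z) \<le> C' * E" .
    have "inverse (norm (S0 z)) = inverse (norm c) * norm (S0 (Q - z))" unfolding n by simp
    also have "\<dots> \<le> inverse (norm c) * (C * inverse E)" using b1 by (intro mult_left_mono) auto
    also have "\<dots> \<le> C' * inverse E" using C(1) cp E by (auto simp: C'_def algebra_simps intro!: mult_right_mono)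
    finally show ?thesis using r1 by (simp add: E_def exp_minus)
  qed
  have "0 < C'" using C(1) cp by (simp add: C'_def add_pos_pos)
  then show ?thesis using main that by blast
qed

section \<open>Meromorphic continuation\<close>

lemma nome_ne_1: "0 < Re z \<Longrightarrow> Re z < 1 / b \<Longrightarrow> nome z \<noteq> 1"
  using exp_expint_jc[of z] by (metis exp_not_eq_zero right_minus_eq)

text \<open>
  The continuation by \<open>n\<close> steps of the functional equation, valid for
  \<open>n b < Re z < n b + Q\<close>.
\<close>

definition Gb_step :: "int \<Rightarrow> complex \<Rightarrow> complex" where
  "Gb_step n z = (if 0 \<le> n then (\<Prod>j<nat n. 1 - nome (z - of_nat (Suc j) * of_real b))
      else (\<Prod>j<nat (- n). 1 / (1 - nome (z + of_nat j * of_real b)))) * Gb_strip b (z - of_int n * of_real b)"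

definition step_strip :: "int \<Rightarrow> complex set" where
  "step_strip n = {z. n * b < Re z \<and> Re z < n * b + Q}"

lemma open_step_strip: "open (step_strip n)"
  unfolding step_strip_def by (rule open_Re_strip)

lemma Gb_step_Suc:
  assumes z: "z \<in> step_strip n" "z \<in> step_strip (n + 1)"
  shows "Gb_step (n + 1) z = Gb_step n z"
proof -
  define w where "w = z - of_int (n + 1) * of_real b"
  have w: "0 < Re w" "Re w < 1 / b"
    using z by (auto simp: w_def step_strip_def Qb_def algebra_simps)
  have wb: "z - of_int n * of_real b = w + b" by (simp add: w_def algebra_simps)
  have FE: "Gb_strip b (z - of_int n * of_real b) = (1 - nome w) * Gb_strip b w"
    unfolding wb using Gb_strip_add_b[OF w] by simp
  have ne: "1 - nome w \<noteq> 0" using nome_ne_1[OF w] by simp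
  show ?thesis
  proof (cases "0 \<le> n")
    case True
    then have nS: "nat (n + 1) = Suc (nat n)" by simp
    have zS: "z - of_nat (Suc (nat n)) * of_real b = w" using True by (simp add: w_def)
    show ?thesis unfolding Gb_step_def w_def[symmetric] FE nS prod.lessThan_Suc zS using True by simp
  next
    case False
    then have e: "nat (- n) = Suc (nat (- (n + 1)))" by simp
    have w': "z + of_nat (nat (- (n + 1))) * of_real b = w" using False by (simp add: w_def algebra_simps)
    have "Gb_step n z = (\<Prod>j<nat (- (n + 1)). 1 / (1 - nome (z + of_nat j * of_real b))) *
       (1 / (1 - nome w)) * ((1 - nome w) * Gb_strip b w)"
      using False unfolding Gb_step_def FE e prod.lessThan_Suc w' by simp
    also have "\<dots> = (\<Prod>j<nat (- (n + 1)). 1 / (1 - nome (z + of_nat j * of_real b))) * Gb_strip b w"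
      using ne by simp
    also have "\<dots> = Gb_step (n + 1) z"
    proof (cases "n + 1 = 0")
      case False
      with \<open>\<not> 0 \<le> n\<close> have "\<not> 0 \<le> n + 1" by simp
      then show ?thesis unfolding Gb_step_def w_def[symmetric] by simp
    qed (simp add: Gb_step_def w_def)
    finally show ?thesis by simp
  qed
qed

text \<open>A point common to two of the strips lies in every strip between them, so the one-step
  comparison can be iterated.\<close>

lemma Gb_step_eq:
  assumes "m \<le> n" "z \<in> step_strip m" "z \<in> step_strip n"
  shows "Gb_step m z = Gb_step n z"
  using assms
proof (induction n rule: int_ge_induct)
  case (step i)
  have "m * b \<le> i * b" using step.hyps b_pos by simp
  then have "z \<in> step_strip i"
    using step.prems b_pos unfolding step_strip_def mem_Collect_eq of_int_add of_int_1 distrib_right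
    by linarith
  with step show ?case using Gb_step_Suc[of z i] by simp
qed simp

text \<open>The index \<open>n\<close> places \<open>Re z - n * b\<close> between
  \<open>b / 2\<close> and \<open>3 * b / 2\<close>, hence inside the basic strip because
  \<open>2 * b < Q\<close>. The half keeps the point off the boundary.\<close>

definition Gb_ext :: "complex \<Rightarrow> complex" where
  "Gb_ext z = Gb_step \<lfloor>Re z / b - 1 / 2\<rfloor> z"

lemma Gb_ext_index: "z \<in> step_strip \<lfloor>Re z / b - 1 / 2\<rfloor>"
proof -
  define n where "n = \<lfloor>Re z / b - 1 / 2\<rfloor>"
  have "real_of_int n \<le> Re z / b - 1 / 2" "Re z / b - 1 / 2 < real_of_int n + 1"
    unfolding n_def by linarith+
  then have "real_of_int n * b < Re z" "Re z < real_of_int n * b + 2 * b"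
    using b_pos by (auto simp: field_simps)
  moreover have "2 * b < Q" using b_less_half_Q by simp
  ultimately show ?thesis by (auto simp: step_strip_def n_def[symmetric])
qed

lemma Gb_ext_eq: "z \<in> step_strip n \<Longrightarrow> Gb_ext z = Gb_step n z"
  using Gb_step_eq[of n _ z] Gb_step_eq[of _ n z] Gb_ext_index[of z]
  unfolding Gb_ext_def by (metis linear)

lemma meromorphic_nome_diff: "(\<lambda>z. 1 - nome (z + c)) meromorphic_on A"
  unfolding nome_def[abs_def] by (auto intro!: analytic_on_imp_meromorphic_on analytic_intros)

lemma Gb_step_meromorphic: "Gb_step n meromorphic_on step_strip n"
proof -
  have "(\<lambda>z. Gb_strip b (z - of_int n * of_real b)) holomorphic_on step_strip n"
    by (rule holomorphic_on_compose_gen[OF _ holomorphic_Gb_strip, unfolded o_def])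
       (auto intro!: holomorphic_intros simp: step_strip_def)
  then have 1: "(\<lambda>z. Gb_strip b (z - of_int n * of_real b)) meromorphic_on step_strip n"
    by (simp add: analytic_on_imp_meromorphic_on analytic_on_open open_step_strip)
  have 2: "(\<lambda>z. \<Prod>j<k. 1 - nome (z - of_nat (Suc j) * of_real b)) meromorphic_on A" for k A
  proof (rule meromorphic_on_prod)
    show "(\<lambda>z. 1 - nome (z - of_nat (Suc j) * of_real b)) meromorphic_on A" for j
      using meromorphic_nome_diff[of "- (of_nat (Suc j) * of_real b)" A] by (simp only: add_uminus_conv_diff)
  qed
  have 3: "(\<lambda>z. \<Prod>j<k. 1 / (1 - nome (z + of_nat j * of_real b))) meromorphic_on A" for k A
    by (intro meromorphic_intros meromorphic_nome_diff)
  show ?thesis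
  proof (cases "0 \<le> n")
    case True
    then have "Gb_step n = (\<lambda>z. (\<Prod>j<nat n. 1 - nome (z - of_nat (Suc j) * of_real b)) * Gb_strip b (z - of_int n * of_real b))"
      by (simp add: Gb_step_def fun_eq_iff)
    then show ?thesis using meromorphic_on_mult[OF 2 1] by (simp only:)
  next
    case False
    then have "Gb_step n = (\<lambda>z. (\<Prod>j<nat (- n). 1 / (1 - nome (z + of_nat j * of_real b))) * Gb_strip b (z - of_int n * of_real b))"
      by (simp add: Gb_step_def fun_eq_iff)
    then show ?thesis using meromorphic_on_mult[OF 3 1] by (simp only:)
  qed
qed

lemma Gb_ext_meromorphic: "Gb_ext meromorphic_on UNIV"
proof -
  have "Gb_ext meromorphic_on {z}" for z
  proof -
  define n where "n = \<lfloor>Re z / b - 1 / 2\<rfloor>"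
  have z: "z \<in> step_strip n" unfolding n_def by (rule Gb_ext_index)
  have "Gb_step n meromorphic_on {z}"
    by (rule meromorphic_on_subset[OF Gb_step_meromorphic]) (use z in auto)
  moreover have "\<forall>\<^sub>F w in at z. Gb_ext w = Gb_step n w"
    using eventually_at_in_open'[OF open_step_strip z] by eventually_elim (rule Gb_ext_eq)
  ultimately show ?thesis
    by (subst meromorphic_on_cong[where g="Gb_step n" and B="{z}"]) auto
  qed
  then show ?thesis using meromorphic_on_meromorphic_at by blast
qed

text \<open>The choice in \<open>Gb\<close> needs a witness, namely \<open>Gb_ext\<close> with its
  removable singularities removed and its poles set to \<open>0\<close>. In the basic strip
  \<open>Gb_ext\<close> is analytic, so its values there survive the normalisation.\<close>

lemma Gb_spec:
  "Gb b nicely_meromorphic_on UNIV \<and> (\<forall>z. 0 < Re z \<and> Re z < Q \<longrightarrow> Gb b z = Gb_strip b z)"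
proof -
  have 1: "remove_sings Gb_ext nicely_meromorphic_on UNIV"
    by (rule remove_sings_nicely_meromorphic[OF Gb_ext_meromorphic])
  have 2: "remove_sings Gb_ext z = Gb_strip b z" if "0 < Re z \<and> Re z < Q" for z
  proof -
  from that have z0: "z \<in> step_strip 0" by (simp add: step_strip_def)
  have eq: "Gb_ext w = Gb_strip b w" if "w \<in> step_strip 0" for w
    using Gb_ext_eq[OF that] by (simp add: Gb_step_def)
  have "Gb_strip b holomorphic_on step_strip 0"
    using holomorphic_Gb_strip by (simp add: step_strip_def)
  then have "Gb_ext holomorphic_on step_strip 0"
    by (rule holomorphic_transform) (simp add: eq)
  then have "Gb_ext analytic_on {z}" using z0 open_step_strip analytic_at by blast
  then show ?thesis by (simp add: eq[OF z0])
  qed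
  from 1 2 have "\<exists>g. g nicely_meromorphic_on UNIV \<and> (\<forall>z. 0 < Re z \<and> Re z < Q \<longrightarrow> g z = Gb_strip b z)"
    by blast
  from someI_ex[OF this] show ?thesis unfolding Gb_def .
qed

lemma Gb_meromorphic: "Gb b meromorphic_on A"
  using Gb_spec by (auto simp: nicely_meromorphic_on_def intro: meromorphic_on_subset)

text \<open>A meromorphic function on the plane vanishes off a sparse set or is nonzero off one, and
  the difference of the two sides vanishes near \<open>1 / (2 * b)\<close>. Punctured neighbourhoods
  are essential: at \<open>z = 0\<close> the right side is \<open>0\<close>, since
  \<open>nome 0 = 1\<close>, whereas \<open>Gb b b\<close> is not.\<close>

lemma Gb_add_b:
  fixes z0 :: complex
  shows "\<forall>\<^sub>F z::complex in at z0. Gb b (z + b) = (1 - nome z) * Gb b z"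
proof -
  define h where "h = (\<lambda>z::complex. Gb b (z + b) - (1 - nome z) * Gb b z)"
  have h: "h meromorphic_on UNIV"
  proof -
    have "(\<lambda>z::complex. Gb b (z + b)) meromorphic_on UNIV"
      by (rule meromorphic_on_compose[OF Gb_meromorphic[of UNIV]]) (auto intro!: analytic_intros)
    moreover have m: "(\<lambda>z. 1 - nome z) meromorphic_on UNIV"
      using meromorphic_nome_diff[of 0 UNIV] by simp
    ultimately show ?thesis
      unfolding h_def
      by (intro meromorphic_on_diff[OF _ meromorphic_on_mult[OF m]] Gb_meromorphic)
  qed
  have "(\<forall>\<^sub>\<approx>z\<in>UNIV. h z = 0) \<or> (\<forall>\<^sub>\<approx>z\<in>UNIV. h z \<noteq> 0)"
    by (intro meromorphic_imp_constant_or_avoid[OF h]) auto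
  moreover have "\<not> (\<forall>\<^sub>\<approx>z\<in>UNIV. h z \<noteq> 0)"
  proof
    assume "\<forall>\<^sub>\<approx>z\<in>UNIV. h z \<noteq> 0"
    let ?p = "complex_of_real (1 / (2 * b))"
    have "\<forall>\<^sub>F z in at ?p. h z \<noteq> 0"
      using \<open>\<forall>\<^sub>\<approx>z\<in>UNIV. h z \<noteq> 0\<close> by (simp add: eventually_cosparse_open_eq)
    moreover have "\<forall>\<^sub>F z in at ?p. z \<in> {z. 0 < Re z \<and> Re z < 1 / b}"
      by (rule eventually_at_in_open'[OF open_Re_strip]) (use b_pos in \<open>auto simp: field_simps\<close>)
    ultimately have "\<forall>\<^sub>F z in at ?p. False"
    proof eventually_elim
      case (elim z)
      then have z: "0 < Re z" "Re z < 1 / b" by auto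
      then have "Gb b (z + b) = Gb_strip b (z + b)" "Gb b z = Gb_strip b z"
        using Gb_spec b_pos by (auto simp: Qb_def)
      then have "h z = 0" using Gb_strip_add_b[OF z] by (simp add: h_def)
      with elim show False by simp
    qed
    then show False by simp
  qed
  ultimately have "\<forall>\<^sub>\<approx>z\<in>UNIV. h z = 0" by blast
  then have "\<forall>\<^sub>F z in at z0. h z = 0" by (simp add: eventually_cosparse_open_eq)
  then show ?thesis by eventually_elim (simp add: h_def)
qed

text \<open>The multiplier of \<open>Sb\<close> under \<open>w \<mapsto> w + b\<close>. It is also,
  up to a constant, the quantum number of \<open>w / b\<close>, which is why the coefficients of
  \<open>E\<close> and \<open>F\<close> can meet the multipliers of the kernel.\<close>

definition sfac :: "complex \<Rightarrow> complex" where
  "sfac = (\<lambda>w::complex. 2 * sin (pi * b * w))"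

lemma sfac_eq: "sfac w = - \<i> * (exp (pi * \<i> * b * w) - exp (- (pi * \<i> * b * w)))"
proof -
  have "sin (pi * b * w) = - \<i> / 2 * (exp (\<i> * (pi * b * w)) - exp (- (\<i> * (pi * b * w))))"
    unfolding sin_exp_eq by (simp add: divide_simps)
  then show ?thesis by (simp add: sfac_def mult_ac)
qed

text \<open>By \<open>b * (Q - b) = 1\<close>, the quadratic exponent changes by
  \<open>pi * i / 2 - pi * i * b * w\<close>. This symmetrises \<open>1 - nome w\<close> into a
  sine.\<close>

lemma exp_quadratic_add_b:
  fixes w :: complex
  shows "exp (pi * \<i> * (w + b) * (of_real Q - (w + b)) / 2) * (1 - nome w) = sfac w * exp (pi * \<i> * w * (of_real Q - w) / 2)"
proof -
  have *: "P * (v + c) * (q - (v + c)) / 2 = P * v * (q - v) / 2 + (P / 2 - P * c * v)"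
    if "c * d = 1" "q = c + d" for P v c d q :: complex
  proof -
    have "(v + c) * (q - (v + c)) = v * (q - v) + (c * d - 2 * (c * v))"
      unfolding that(2) by (simp add: algebra_simps)
    then have "P * (v + c) * (q - (v + c)) = P * (v * (q - v) + (1 - 2 * (c * v)))"
      unfolding that(1) by (simp only: mult.assoc)
    then show ?thesis by (simp add: distrib_left right_diff_distrib add_divide_distrib diff_divide_distrib mult.assoc)
  qed
  have "complex_of_real b * complex_of_real (1 / b) = 1" using b_pos by simp
  moreover have "complex_of_real Q = complex_of_real b + complex_of_real (1 / b)"
    by (simp only: Qb_def of_real_add)
  ultimately have "pi * \<i> * (w + b) * (of_real Q - (w + b)) / 2 = pi * \<i> * w * (of_real Q - w) / 2 + (pi * \<i> / 2 - pi * \<i> * b * w)"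
    by (rule *)
  also have "pi * \<i> / 2 = \<i> * (pi / 2)" by simp
  finally have "pi * \<i> * (w + b) * (of_real Q - (w + b)) / 2 = pi * \<i> * w * (of_real Q - w) / 2 + (\<i> * (pi / 2) - pi * \<i> * b * w)" .
  moreover have "exp (A + (B - C)) = exp A * (exp B * exp (- C))" for A B C :: complex
    by (simp add: exp_add[symmetric])
  ultimately have 1: "exp (pi * \<i> * (w + b) * (of_real Q - (w + b)) / 2)
      = exp (pi * \<i> * w * (of_real Q - w) / 2) * (exp (\<i> * (pi / 2)) * exp (- (pi * \<i> * b * w)))"
    by (simp only:)
  have 2: "exp (\<i> * complex_of_real (pi / 2)) = \<i>" by (simp only: cis_conv_exp[symmetric] cis_pi_half)
  have 3: "nome w = exp (pi * \<i> * b * w) * exp (pi * \<i> * b * w)"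
    unfolding nome_def exp_add[symmetric] by (rule arg_cong[of _ _ exp]) simp
  have "\<i> * u * (1 - v * v) = - \<i> * (v - u)" if "u * v = 1" for u v :: complex
  proof -
    have "\<i> * u * (1 - v * v) = \<i> * (u - (u * v) * v)" by (simp add: algebra_simps)
    then show ?thesis unfolding that by (simp add: algebra_simps)
  qed
  then have 4: "\<i> * exp (- (pi * \<i> * b * w)) * (1 - nome w) = sfac w"
    unfolding sfac_eq 3 by (simp only: exp_minus_inverse mult.commute[of "exp (- (pi * \<i> * b * w))" "exp (pi * \<i> * b * w)"])
  show ?thesis unfolding 1 2 4[symmetric] by (simp only: mult.assoc mult.commute mult.left_commute)
qed

section \<open>Difference equation and decisive poles of \<open>Sb\<close>\<close>

lemma Sb_strip: "0 < Re z \<Longrightarrow> Re z < Q \<Longrightarrow> Sb b z = S0 z"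
  using Gb_spec by (simp add: Sb_def S0_def)

lemma S0_add_b:
  fixes w :: complex
  assumes "0 < Re w" "Re w < 1 / b"
  shows "S0 (w + b) = sfac w * S0 w"
proof -
  have "S0 (w + b) = exp (pi * \<i> * (w + b) * (of_real Q - (w + b)) / 2) * (1 - nome w) * Gb_strip b w"
    unfolding S0_def using Gb_strip_add_b[OF assms] by simp
  then show ?thesis unfolding exp_quadratic_add_b by (simp add: S0_def)
qed

lemma Sb_add_b:
  fixes z0 :: complex
  shows "\<forall>\<^sub>F z::complex in at z0. Sb b (z + b) = sfac z * Sb b z"
  using Gb_add_b[of z0]
proof eventually_elim
  case (elim z)
  have "Sb b (z + b) = exp (pi * \<i> * (z + b) * (of_real Q - (z + b)) / 2) * (1 - nome z) * Gb b z"
    unfolding Sb_def using elim by simp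
  then show ?case unfolding exp_quadratic_add_b by (simp add: Sb_def)
qed

lemma holomorphic_S0: "S0 holomorphic_on {z. 0 < Re z \<and> Re z < Q}"
  unfolding S0_def[abs_def] by (intro holomorphic_intros holomorphic_Gb_strip) auto

lemma isCont_S0: "0 < Re z \<Longrightarrow> Re z < Q \<Longrightarrow> isCont S0 z"
  using holomorphic_on_imp_continuous_on[OF holomorphic_S0] open_Re_strip
  by (simp add: continuous_on_eq_continuous_at)

text \<open>On the imaginary axis away from \<open>0\<close> the factor \<open>1 - nome w\<close> is
  nonzero, so the punctured difference equation gives \<open>Gb\<close> a finite limit at
  \<open>w\<close>. There is then no pole, and the normalised value equals the limit. This treats
  \<open>Sb b (2 i \<alpha>)\<close>, which lies on the edge of the strip.\<close>

lemma Sb_imaginary: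
  fixes w :: complex
  assumes "Re w = 0" "Im w \<noteq> 0"
  shows "S0 (w + b) = sfac w * Sb b w"
proof -
  have s: "sfac w \<noteq> 0"
  proof
    assume "sfac w = 0"
    then have "exp (pi * \<i> * b * w) = exp (- (pi * \<i> * b * w))" by (simp add: sfac_eq)
    then have "norm (exp (pi * \<i> * b * w)) = norm (exp (- (pi * \<i> * b * w)))" by simp
    then show False using assms b_pos by (simp add: norm_exp_eq_Re)
  qed
  have nome1: "1 - nome w \<noteq> 0"
    using exp_quadratic_add_b[of w] s by auto
  have e: "\<forall>\<^sub>F z::complex in at w. 1 - nome z \<noteq> 0"
  proof -
    have "isCont (\<lambda>z. 1 - nome z) w" by (auto simp: nome_def intro!: continuous_intros)
    then show ?thesis using nome1 by (intro tendsto_imp_eventually_ne) (auto simp: isCont_def)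
  qed
  have lim: "((\<lambda>z::complex. Gb b (z + b) / (1 - nome z)) \<longlongrightarrow> Gb_strip b (w + b) / (1 - nome w)) (at w)"
  proof (intro tendsto_divide)
    have r: "0 < Re (w + b)" "Re (w + b) < Q" using assms b_pos b_less_half_Q Q_pos by auto
    have "isCont (Gb_strip b) (w + b)"
      using r holomorphic_on_imp_continuous_on[OF holomorphic_Gb_strip] open_Re_strip
      by (simp add: continuous_on_eq_continuous_at)
    then have l: "((\<lambda>z::complex. Gb_strip b (z + b)) \<longlongrightarrow> Gb_strip b (w + b)) (at w)"
      by (rule isCont_tendsto_compose) (intro tendsto_intros)
    have "isCont (\<lambda>z::complex. z + b) w" by (intro continuous_intros)
    then have "\<forall>\<^sub>F z::complex in at w. z + b \<in> {z. 0 < Re z \<and> Re z < Q}"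
      using r by (intro topological_tendstoD[OF _ open_Re_strip]) (auto simp: isCont_def)
    then have "\<forall>\<^sub>F z::complex in at w. Gb_strip b (z + b) = Gb b (z + b)"
      by eventually_elim (use Gb_spec in auto)
    with l show "((\<lambda>z::complex. Gb b (z + b)) \<longlongrightarrow> Gb_strip b (w + b)) (at w)"
      using tendsto_cong by force
    show "((\<lambda>z. 1 - nome z) \<longlongrightarrow> 1 - nome w) (at w)"
      unfolding nome_def by (intro tendsto_intros)
  qed (rule nome1)
  have "\<forall>\<^sub>F z::complex in at w. Gb b (z + b) / (1 - nome z) = Gb b z"
    using Gb_add_b[of w] e by eventually_elim simp
  with lim have lim': "(Gb b \<longlongrightarrow> Gb_strip b (w + b) / (1 - nome w)) (at w)"
    using tendsto_cong by force
  then have "\<not> is_pole (Gb b) w"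
    using not_tendsto_and_filterlim_at_infinity[of "at w" "Gb b"] by (auto simp: is_pole_def)
  then have "Gb b \<midarrow>w\<rightarrow> Gb b w"
    using Gb_spec by (auto simp: nicely_meromorphic_on_def)
  with lim' have "Gb b w = Gb_strip b (w + b) / (1 - nome w)" using LIM_unique by blast
  then have "Gb_strip b (w + b) = (1 - nome w) * Gb b w" using nome1 by simp
  then have "S0 (w + b) = exp (pi * \<i> * (w + b) * (of_real Q - (w + b)) / 2) * (1 - nome w) * Gb b w"
    unfolding S0_def by simp
  then show ?thesis unfolding exp_quadratic_add_b by (simp add: Sb_def)
qed

lemma sfac_eventually_nonzero: "\<forall>\<^sub>F z in at z0. sfac z \<noteq> 0"
proof -
  have a: "sfac analytic_on UNIV"
    unfolding sfac_def by (auto intro!: analytic_intros)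
  have "\<not> (\<forall>\<^sub>\<approx>z\<in>UNIV. sfac z = 0)"
  proof
    assume "\<forall>\<^sub>\<approx>z\<in>UNIV. sfac z = 0"
    then have "\<forall>\<^sub>F z in at (complex_of_real (1 / (2 * b))). sfac z = 0"
      by (simp add: eventually_cosparse_open_eq)
    then have "sfac \<midarrow>complex_of_real (1 / (2 * b))\<rightarrow> 0" by (rule tendsto_eventually)
    moreover have "isCont sfac (complex_of_real (1 / (2 * b)))"
      unfolding sfac_def by (intro continuous_intros)
    ultimately have s0: "sfac (complex_of_real (1 / (2 * b))) = 0"
      by (blast intro: LIM_unique dest: isContD)
    have "complex_of_real (pi * b) * complex_of_real (1 / (2 * b)) = complex_of_real (pi / 2)" using b_pos by simp
    then have "sfac (complex_of_real (1 / (2 * b))) = 2 * sin (complex_of_real (pi / 2))"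
      unfolding sfac_def by (simp only:)
    also have "\<dots> = 2" by (simp only: sin_of_real sin_pi_half) simp
    finally show False using s0 by simp
  qed
  moreover have "(\<forall>\<^sub>\<approx>z\<in>UNIV. sfac z = 0) \<or> (\<forall>\<^sub>\<approx>z\<in>UNIV. sfac z \<noteq> 0)"
    by (intro meromorphic_imp_constant_or_avoid analytic_on_imp_meromorphic_on a) auto
  ultimately have "\<forall>\<^sub>\<approx>z\<in>UNIV. sfac z \<noteq> 0" by blast
  then show ?thesis by (simp add: eventually_cosparse_open_eq)
qed

lemma eventually_at_shift_strip:
  assumes "0 < Re (z0 + c)" "Re (z0 + c) < Q"
  shows "\<forall>\<^sub>F z in at z0. Sb b (z + c) = S0 (z + c)" "((\<lambda>z. S0 (z + c)) \<longlongrightarrow> S0 (z0 + c)) (at z0)"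
proof -
  have "isCont (\<lambda>z. z + c) z0" by (intro continuous_intros)
  then have "\<forall>\<^sub>F z in at z0. z + c \<in> {z. 0 < Re z \<and> Re z < Q}"
    using assms by (intro topological_tendstoD[OF _ open_Re_strip]) (auto simp: isCont_def)
  then show "\<forall>\<^sub>F z in at z0. Sb b (z + c) = S0 (z + c)"
    by eventually_elim (simp add: Sb_strip)
  show "((\<lambda>z. S0 (z + c)) \<longlongrightarrow> S0 (z0 + c)) (at z0)"
    by (rule isCont_tendsto_compose[OF isCont_S0[OF assms]]) (intro tendsto_intros)
qed

lemma tendsto_sfac: "(sfac \<longlongrightarrow> sfac z0) (at z0)"
  unfolding sfac_def by (intro tendsto_intros)

text \<open>Near \<open>0\<close> the function is \<open>S0 (z + b) / sfac z\<close>: the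
  denominator vanishes while the numerator tends to \<open>S0 b\<close>, which is nonzero.\<close>

lemma is_pole_Sb_0: "is_pole (Sb b) 0"
proof -
  have r: "0 < Re (0 + complex_of_real b)" "Re (0 + complex_of_real b) < Q" using b_pos b_less_half_Q Q_pos by auto
  have "filterlim sfac (at 0) (at 0)"
    using tendsto_sfac[of 0] sfac_eventually_nonzero[of 0] by (simp add: filterlim_at sfac_def)
  then have "filterlim (\<lambda>z::complex. S0 (z + b) / sfac z) at_infinity (at 0)"
    by (rule filterlim_divide_at_infinity[OF eventually_at_shift_strip(2)[OF r] _ S0_nonzero])
  moreover have ev: "\<forall>\<^sub>F z::complex in at 0. S0 (z + b) / sfac z = Sb b z"
    using Sb_add_b[of 0] sfac_eventually_nonzero[of 0] eventually_at_shift_strip(1)[OF r]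
    by eventually_elim simp
  ultimately show ?thesis unfolding is_pole_def by (simp only: filterlim_cong[OF refl refl ev])
qed

text \<open>Near \<open>p = 1 / b\<close> the product \<open>sfac z * S0 z\<close> equals
  \<open>Sb b (z + b)\<close> and has a zero coming from the sine; moreover
  \<open>p + b = Q\<close>.\<close>

lemma is_pole_inverse_Sb_Q: "is_pole (\<lambda>z. 1 / Sb b z) Q"
proof -
  define p where "p = complex_of_real (1 / b)"
  have r: "0 < Re (p + 0)" "Re (p + 0) < Q" using b_pos by (auto simp: p_def Qb_def)
  have s0: "sfac p = 0" using b_pos by (simp add: p_def sfac_def)
  have "filterlim (\<lambda>z. sfac z * S0 (z + 0)) (at 0) (at p)"
    unfolding filterlim_at
  proof
    show "((\<lambda>z. sfac z * S0 (z + 0)) \<longlongrightarrow> 0) (at p)"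
      using tendsto_mult[OF tendsto_sfac[of p] eventually_at_shift_strip(2)[OF r]] by (simp add: s0)
    show "\<forall>\<^sub>F z::complex in at p. sfac z * S0 (z + 0) \<in> UNIV \<and> sfac z * S0 (z + 0) \<noteq> 0"
      using sfac_eventually_nonzero[of p] by eventually_elim (simp add: S0_nonzero)
  qed
  then have "filterlim (\<lambda>z. 1 / (sfac z * S0 (z + 0))) at_infinity (at p)"
    by (intro filterlim_divide_at_infinity[OF tendsto_const]) auto
  moreover have ev: "\<forall>\<^sub>F z::complex in at p. 1 / (sfac z * S0 (z + 0)) = 1 / Sb b (z + b)"
    using Sb_add_b[of p] eventually_at_shift_strip(1)[OF r] by eventually_elim simp
  ultimately have "filterlim (\<lambda>z::complex. 1 / Sb b (z + b)) at_infinity (at p)"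
    by (simp only: filterlim_cong[OF refl refl ev])
  then have "is_pole (\<lambda>z::complex. 1 / Sb b (z + b)) p" by (simp add: is_pole_def)
  then have "is_pole (\<lambda>z. 1 / Sb b z) (p + b)"
    using is_pole_shift_iff[of "\<lambda>z. 1 / Sb b z" "complex_of_real b" p] by (simp only: o_def add.commute)
  moreover have "p + b = Q" by (simp add: p_def Qb_def)
  ultimately show ?thesis by simp
qed

lemma is_pole_rotate:
  assumes "is_pole f (c + \<i> * r)"
  shows "is_pole (\<lambda>r. f (c + \<i> * r)) r"
proof -
  have "filterlim (\<lambda>r. c + \<i> * r) (at (c + \<i> * r)) (at r)"
    unfolding filterlim_at by (auto intro!: tendsto_intros simp: eventually_at_filter)
  with assms show ?thesis unfolding is_pole_def using filterlim_compose by blast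
qed

text \<open>The pole of \<open>Sb b (i r)\<close> at \<open>r = 0\<close> forces
  \<open>h < 0\<close>. The point where the second denominator argument equals \<open>Q\<close> has
  imaginary part \<open>- Q / 2\<close> and forces the other inequality.\<close>

lemma separates_bounds:
  assumes "separates b l1 l2 y \<alpha> z h"
  shows "- Q / 2 < h" "h < 0"
proof -
  have "is_pole (\<lambda>r. Sb b (0 + \<i> * r)) 0"
    using is_pole_Sb_0 by (intro is_pole_rotate) simp
  then show "h < 0" using assms unfolding separates_def by fastforce
  let ?c = "Q / 2 + \<i> * \<alpha> - \<i> * l1 - \<i> * l2 :: complex"
  let ?r = "- \<i> * (Q - ?c)"
  have "is_pole (\<lambda>r. 1 / Sb b (?c + \<i> * r)) ?r"
    using is_pole_inverse_Sb_Q by (intro is_pole_rotate) (simp add: algebra_simps)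
  then have "Im ?r < h" using assms unfolding separates_def by blast
  then show "- Q / 2 < h" by simp
qed

end

section \<open>Estimates for the kernel\<close>

locale cg_kernel_setup = qdilog +
  fixes l1 l2 :: real
  assumes l1_nonneg: "0 \<le> l1" and l2_nonneg: "0 \<le> l2"
begin

text \<open>
  The kernel at complex \<open>x\<close>, \<open>y\<close> with \<open>S0\<close> in place of \<open>Sb\<close>.  For \<open>s = b\<close> it is the function
  whose difference under \<open>r \<mapsto> r - i b\<close> appears in the relation for \<open>F\<close>.
\<close>

definition ker :: "real \<Rightarrow> complex \<Rightarrow> complex \<Rightarrow> real \<Rightarrow> complex \<Rightarrow> complex" where
  "ker s = (\<lambda>(x::complex) (y::complex) (\<alpha>::real) (r::complex). exp (pi * (Q / 2 + \<i> * x + \<i> * l1) * (r + \<alpha> - l1 - y))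
     * S0 (\<i> * \<alpha> - \<i> * y - \<i> * l1 + \<i> * r - s) * S0 (\<i> * r) * S0 (2 * \<i> * \<alpha> + \<i> * r)
     / (S0 (Q / 2 + \<i> * \<alpha> - \<i> * (x + y) + \<i> * r - s)
        * S0 (Q / 2 + \<i> * \<alpha> - \<i> * l1 - \<i> * l2 + \<i> * r - s)
        * S0 (Q / 2 + \<i> * \<alpha> - \<i> * l1 + \<i> * l2 + \<i> * r - s)))"

text \<open>Here \<open>1 / Sb b (2 i \<alpha>)\<close> is replaced by an expression that is regular at \<open>\<alpha> = 0\<close>.\<close>

definition pre :: "complex \<Rightarrow> complex \<Rightarrow> real \<Rightarrow> complex" where
  "pre = (\<lambda>(x::complex) (y::complex) (\<alpha>::real). S0 (Q / 2 + \<i> * \<alpha> - \<i> * (x + y)) / S0 (Q / 2 - \<i> * y + \<i> * l2)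
     * (S0 (Q / 2 + \<i> * \<alpha> - \<i> * l1 + \<i> * l2) * sfac (2 * \<i> * \<alpha>) / S0 (2 * \<i> * \<alpha> + b)))"

text \<open>On the line \<open>Im r = - k\<close>, every argument of \<open>S0\<close> in
  \<open>ker s\<close> keeps distance \<open>e\<close> from the edges of the strip. The last two
  conditions concern the growth in \<open>r\<close>: the coefficient \<open>Q / 2 - Im x\<close> in
  the exponential is positive, and the combined exponent of all factors is at most
  \<open>- 2 * e\<close> times \<open>pi * \<bar>Re r\<bar>\<close>.\<close>

definition ker_ok :: "real \<Rightarrow> real \<Rightarrow> real \<Rightarrow> complex \<Rightarrow> complex \<Rightarrow> bool" where
  "ker_ok e s k x y \<longleftrightarrow> 0 \<le> s \<and> s \<le> b \<and> e \<le> k \<and> k \<le> Q - e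
     \<and> e \<le> Im y + k - s \<and> Im y + k - s \<le> Q - e
     \<and> e \<le> Q / 2 + k - s \<and> Q / 2 + k - s \<le> Q - e
     \<and> e \<le> Q / 2 + Im x + Im y + k - s \<and> Q / 2 + Im x + Im y + k - s \<le> Q - e
     \<and> Im x \<le> Q / 2 - e \<and> - 2 * Im x - Q + 2 * s \<le> - 2 * e"

definition pre_ok :: "real \<Rightarrow> complex \<Rightarrow> complex \<Rightarrow> bool" where
  "pre_ok e x y \<longleftrightarrow> e \<le> Q / 2 + Im x + Im y \<and> Q / 2 + Im x + Im y \<le> Q - e
     \<and> e \<le> Q / 2 + Im y \<and> Q / 2 + Im y \<le> Q - e"

text \<open>All imaginary parts in the kernel differ from the contour variable \<open>u\<close> by
  at most some \<open>T\<close> depending on the parameters. Replacing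
  \<open>\<bar>Im z\<bar>\<close> by \<open>\<bar>u\<bar>\<close> costs the factor
  \<open>exp (pi * Q * T)\<close> and lets the exponents of different factors be added.\<close>

lemma S0_bounds_shifted:
  assumes e: "0 < e" "e \<le> Q / 2"
  obtains C where "0 < C"
    "\<And>z \<sigma> u T. Re z = \<sigma> \<Longrightarrow> e \<le> \<sigma> \<Longrightarrow> \<sigma> \<le> Q - e \<Longrightarrow> \<bar>Im z - u\<bar> \<le> T \<Longrightarrow>
      norm (S0 z) \<le> C * exp (pi * Q * T + pi * \<bar>u\<bar> * (\<sigma> - Q / 2))"
    "\<And>z \<sigma> u T. Re z = \<sigma> \<Longrightarrow> e \<le> \<sigma> \<Longrightarrow> \<sigma> \<le> Q - e \<Longrightarrow> \<bar>Im z - u\<bar> \<le> T \<Longrightarrow>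
      inverse (norm (S0 z)) \<le> C * exp (pi * Q * T - pi * \<bar>u\<bar> * (\<sigma> - Q / 2))"
proof -
  obtain C where C: "0 < C" "\<And>z::complex. e \<le> Re z \<Longrightarrow> Re z \<le> Q - e \<Longrightarrow>
      norm (S0 z) \<le> C * exp (pi * \<bar>Im z\<bar> * (Re z - Q / 2))"
    "\<And>z::complex. e \<le> Re z \<Longrightarrow> Re z \<le> Q - e \<Longrightarrow>
      inverse (norm (S0 z)) \<le> C * exp (- (pi * \<bar>Im z\<bar> * (Re z - Q / 2)))"
    using S0_bounds[OF e] by blast
  show ?thesis
  proof (rule that[of C])
    fix z :: complex and \<sigma> u T :: real
    assume z: "Re z = \<sigma>" "e \<le> \<sigma>" "\<sigma> \<le> Q - e" "\<bar>Im z - u\<bar> \<le> T"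
    have "\<bar>(\<bar>Im z\<bar> - \<bar>u\<bar>) * (\<sigma> - Q / 2)\<bar> = \<bar>\<bar>Im z\<bar> - \<bar>u\<bar>\<bar> * \<bar>\<sigma> - Q / 2\<bar>" by (rule abs_mult)
    also have "\<dots> \<le> T * Q" using z e Q_pos by (intro mult_mono) auto
    finally have w: "\<bar>(\<bar>Im z\<bar> - \<bar>u\<bar>) * (\<sigma> - Q / 2)\<bar> \<le> T * Q" .
    define a1 where "a1 = pi * \<bar>Im z\<bar> * (\<sigma> - Q / 2)"
    define a2 where "a2 = pi * \<bar>u\<bar> * (\<sigma> - Q / 2)"
    have "\<bar>a1 - a2\<bar> = pi * \<bar>(\<bar>Im z\<bar> - \<bar>u\<bar>) * (\<sigma> - Q / 2)\<bar>"
    proof -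
      have "a1 - a2 = pi * ((\<bar>Im z\<bar> - \<bar>u\<bar>) * (\<sigma> - Q / 2))"
        unfolding a1_def a2_def by (simp only: left_diff_distrib right_diff_distrib mult.assoc)
      then show ?thesis by (simp only: abs_mult abs_of_nonneg[OF pi_ge_zero])
    qed
    also have "\<dots> \<le> pi * (T * Q)" by (rule mult_left_mono[OF w]) simp
    also have "\<dots> = pi * Q * T" by simp
    finally have "a1 \<le> pi * Q * T + a2 \<and> - a1 \<le> pi * Q * T - a2" by linarith
    then have k: "pi * \<bar>Im z\<bar> * (\<sigma> - Q / 2) \<le> pi * Q * T + pi * \<bar>u\<bar> * (\<sigma> - Q / 2)"
      "- (pi * \<bar>Im z\<bar> * (\<sigma> - Q / 2)) \<le> pi * Q * T - pi * \<bar>u\<bar> * (\<sigma> - Q / 2)"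
      unfolding a1_def a2_def by blast+
    show "norm (S0 z) \<le> C * exp (pi * Q * T + pi * \<bar>u\<bar> * (\<sigma> - Q / 2))"
      by (rule order.trans[OF C(2)[of z]]) (use z(1-3) k(1) C(1) in \<open>auto intro!: mult_left_mono\<close>)
    show "inverse (norm (S0 z)) \<le> C * exp (pi * Q * T - pi * \<bar>u\<bar> * (\<sigma> - Q / 2))"
      by (rule order.trans[OF C(3)[of z]]) (use z(1-3) k(2) C(1) in \<open>auto intro!: mult_left_mono\<close>)
  qed (rule C(1))
qed

text \<open>In the sum of the exponents of the exponential and the six \<open>S0\<close> factors,
  \<open>k\<close> and \<open>Im y\<close> cancel and the coefficient
  \<open>- 2 * Im x - Q + 2 * s\<close> of \<open>pi * \<bar>u\<bar>\<close> remains. Growth in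
  \<open>\<alpha>\<close> is tolerated, since the test functions will absorb any
  exponential.\<close>

lemma norm_ker_bound:
  assumes e: "0 < e" "e \<le> Q / 2" and M: "0 \<le> M"
  obtains C D where "0 \<le> C" "0 \<le> D"
    "\<And>s k x y \<alpha> u. ker_ok e s k x y \<Longrightarrow> \<bar>Re x\<bar> \<le> M \<Longrightarrow> \<bar>Re y\<bar> \<le> M \<Longrightarrow> 0 \<le> \<alpha> \<Longrightarrow>
      norm (ker s x y \<alpha> (Complex u (- k))) \<le> C * exp (D * \<alpha>) * exp (- (2 * pi * e) * \<bar>u\<bar>)"
proof -
  obtain C where C: "0 < C"
    "\<And>z \<sigma> u T. Re z = \<sigma> \<Longrightarrow> e \<le> \<sigma> \<Longrightarrow> \<sigma> \<le> Q - e \<Longrightarrow> \<bar>Im z - u\<bar> \<le> T \<Longrightarrow>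
      norm (S0 z) \<le> C * exp (pi * Q * T + pi * \<bar>u\<bar> * (\<sigma> - Q / 2))"
    "\<And>z \<sigma> u T. Re z = \<sigma> \<Longrightarrow> e \<le> \<sigma> \<Longrightarrow> \<sigma> \<le> Q - e \<Longrightarrow> \<bar>Im z - u\<bar> \<le> T \<Longrightarrow>
      inverse (norm (S0 z)) \<le> C * exp (pi * Q * T - pi * \<bar>u\<bar> * (\<sigma> - Q / 2))"
    using S0_bounds_shifted[OF e] by blast
  define N where "N = 2 * M + 2 * l1 + 2 * l2"
  show ?thesis
  \<comment> \<open>Each of the six \<open>S0\<close> factors costs \<open>pi * Q * T\<close> and
    the exponential \<open>2 * pi * Q * T\<close>; with \<open>T = 2 * \<alpha> + N\<close> the
    total \<open>8 * pi * Q * T\<close> splits into these two constants.\<close>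
  proof (rule that[of "C ^ 6 * exp (8 * pi * Q * N)" "16 * pi * Q"])
    fix s k :: real and x y :: complex and \<alpha> u :: real
    assume ok: "ker_ok e s k x y" and x: "\<bar>Re x\<bar> \<le> M" and y: "\<bar>Re y\<bar> \<le> M" and \<alpha>: "0 \<le> \<alpha>"
    define T where "T = 2 * \<alpha> + N"
    define r where "r = Complex u (- k)"
    define X where "X = Im x"
    define Y where "Y = Im y"
    note ok' = ok[unfolded ker_ok_def, folded X_def Y_def]
    define A1 where "A1 = pi * Q * T + pi * \<bar>u\<bar> * (Y + k - s - Q / 2)"
    define A2 where "A2 = pi * Q * T + pi * \<bar>u\<bar> * (k - Q / 2)"
    define B1 where "B1 = pi * Q * T - pi * \<bar>u\<bar> * (Q / 2 + X + Y + k - s - Q / 2)"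
    define B2 where "B2 = pi * Q * T - pi * \<bar>u\<bar> * (Q / 2 + k - s - Q / 2)"
    define P where "P = Re (pi * (Q / 2 + \<i> * x + \<i> * l1) * (r + \<alpha> - l1 - y))"
    have bounds: "norm (S0 (\<i> * \<alpha> - \<i> * y - \<i> * l1 + \<i> * r - s)) \<le> C * exp A1"
      "norm (S0 (\<i> * r)) \<le> C * exp A2" "norm (S0 (2 * \<i> * \<alpha> + \<i> * r)) \<le> C * exp A2"
      "inverse (norm (S0 (Q / 2 + \<i> * \<alpha> - \<i> * (x + y) + \<i> * r - s))) \<le> C * exp B1"
      "inverse (norm (S0 (Q / 2 + \<i> * \<alpha> - \<i> * l1 - \<i> * l2 + \<i> * r - s))) \<le> C * exp B2"
      "inverse (norm (S0 (Q / 2 + \<i> * \<alpha> - \<i> * l1 + \<i> * l2 + \<i> * r - s))) \<le> C * exp B2"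
      unfolding A1_def A2_def B1_def B2_def
      using ok' x y \<alpha> l1_nonneg l2_nonneg
      by (intro C(2) C(3); simp add: r_def T_def N_def X_def Y_def; linarith)+
    have P: "P \<le> pi * \<bar>u\<bar> * (Q / 2 - X) + 2 * pi * Q * T"
    proof -
      have "P = pi * ((Q / 2 - X) * u + (Q / 2 - X) * (\<alpha> - l1 - Re y) + (Re x + l1) * (k + Y))"
        by (simp add: P_def r_def X_def Y_def algebra_simps add_divide_distrib diff_divide_distrib)
      also have "\<dots> \<le> pi * ((Q / 2 - X) * \<bar>u\<bar> + Q * T + T * Q)"
      proof -
        have q: "0 \<le> Q / 2 - X" "Q / 2 - X \<le> Q" using ok' e by linarith+
        have p1: "(Q / 2 - X) * u \<le> (Q / 2 - X) * \<bar>u\<bar>" using q by (intro mult_left_mono) auto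
        have "(Q / 2 - X) * (\<alpha> - l1 - Re y) \<le> (Q / 2 - X) * T"
          using q x y \<alpha> l1_nonneg l2_nonneg M by (intro mult_left_mono) (auto simp: T_def N_def)
        also have "\<dots> \<le> Q * T"
          using q \<alpha> l1_nonneg l2_nonneg M by (intro mult_right_mono) (auto simp: T_def N_def)
        finally have p2: "(Q / 2 - X) * (\<alpha> - l1 - Re y) \<le> Q * T" .
        have ky: "0 \<le> k + Y" "k + Y \<le> 2 * Q" using ok' e b_pos b_less_half_Q by linarith+
        have "(Re x + l1) * (k + Y) \<le> (M + l1) * (k + Y)" using ky x by (intro mult_right_mono) auto
        also have "\<dots> \<le> (M + l1) * (2 * Q)" using ky M l1_nonneg by (intro mult_left_mono) auto
        also have "\<dots> \<le> T * Q"
        proof -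
          have "2 * (M + l1) \<le> T" using \<alpha> l2_nonneg l1_nonneg by (simp add: T_def N_def)
          then have "2 * (M + l1) * Q \<le> T * Q" using Q_pos by (intro mult_right_mono) auto
          then show ?thesis by (simp add: mult_ac)
        qed
        finally have p3: "(Re x + l1) * (k + Y) \<le> T * Q" .
        show ?thesis by (rule mult_left_mono[OF add_mono[OF add_mono[OF p1 p2] p3]]) simp
      qed
      also have "\<dots> = pi * \<bar>u\<bar> * (Q / 2 - X) + 2 * pi * Q * T" by (simp add: algebra_simps)
      finally show ?thesis .
    qed
    have exps: "exp P * exp A1 * exp A2 * exp A2 * exp B1 * exp B2 * exp B2
        \<le> exp (8 * pi * Q * N) * exp (16 * pi * Q * \<alpha>) * exp (- (2 * pi * e) * \<bar>u\<bar>)"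
    proof -
      have "P + A1 + A2 + A2 + B1 + B2 + B2
          \<le> 8 * pi * Q * T + (pi * \<bar>u\<bar>) * (- 2 * X - Q + 2 * s)"
        using P unfolding A1_def A2_def B1_def B2_def by (simp add: algebra_simps)
      also have "\<dots> \<le> 8 * pi * Q * T + (pi * \<bar>u\<bar>) * (- 2 * e)"
        using ok' by (intro add_left_mono mult_left_mono) auto
      also have "\<dots> = 8 * pi * Q * N + 16 * pi * Q * \<alpha> + - (2 * pi * e) * \<bar>u\<bar>"
        by (simp add: T_def algebra_simps)
      finally show ?thesis unfolding exp_add[symmetric] exp_le_cancel_iff .
    qed
    have "norm (ker s x y \<alpha> r) = exp P * norm (S0 (\<i> * \<alpha> - \<i> * y - \<i> * l1 + \<i> * r - s))
        * norm (S0 (\<i> * r)) * norm (S0 (2 * \<i> * \<alpha> + \<i> * r))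
        * inverse (norm (S0 (Q / 2 + \<i> * \<alpha> - \<i> * (x + y) + \<i> * r - s)))
        * inverse (norm (S0 (Q / 2 + \<i> * \<alpha> - \<i> * l1 - \<i> * l2 + \<i> * r - s)))
        * inverse (norm (S0 (Q / 2 + \<i> * \<alpha> - \<i> * l1 + \<i> * l2 + \<i> * r - s)))"
      unfolding ker_def P_def norm_divide norm_mult norm_exp_eq_Re divide_inverse inverse_mult_distrib norm_inverse
      by (simp only: mult.assoc)
    also have "\<dots> \<le> exp P * (C * exp A1) * (C * exp A2) * (C * exp A2) * (C * exp B1) * (C * exp B2) * (C * exp B2)"
      using C(1) bounds
      by (intro mult_mono; simp)
    also have "\<dots> = C ^ 6 * (exp P * exp A1 * exp A2 * exp A2 * exp B1 * exp B2 * exp B2)"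
      by (simp add: eval_nat_numeral)
    also have "\<dots> \<le> C ^ 6 * (exp (8 * pi * Q * N) * exp (16 * pi * Q * \<alpha>) * exp (- (2 * pi * e) * \<bar>u\<bar>))"
      using C(1) by (intro mult_left_mono exps) auto
    finally show "norm (ker s x y \<alpha> (Complex u (- k))) \<le> C ^ 6 * exp (8 * pi * Q * N) * exp (16 * pi * Q * \<alpha>) * exp (- (2 * pi * e) * \<bar>u\<bar>)"
      by (simp only: r_def mult.assoc)
  qed (use C(1) Q_pos in auto)
qed

lemma norm_sfac_imaginary:
  assumes "0 \<le> \<alpha>"
  shows "norm (sfac (2 * \<i> * of_real \<alpha>)) \<le> 2 * exp (2 * pi * b * \<alpha>)"
proof -
  let ?w = "pi * \<i> * b * (2 * \<i> * of_real \<alpha>) :: complex"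
  have "norm (sfac (2 * \<i> * of_real \<alpha>)) = norm (exp ?w - exp (- ?w))"
    unfolding sfac_eq norm_mult by simp
  also have "\<dots> \<le> norm (exp ?w) + norm (exp (- ?w))" by (rule norm_triangle_ineq4)
  also have "\<dots> = exp (- (2 * pi * b * \<alpha>)) + exp (2 * pi * b * \<alpha>)"
    by (simp add: norm_exp_eq_Re mult_ac)
  also have "\<dots> \<le> exp (2 * pi * b * \<alpha>) + exp (2 * pi * b * \<alpha>)"
    using assms b_pos by (intro add_right_mono) auto
  finally show ?thesis by simp
qed

lemma norm_pre_bound:
  assumes e: "0 < e" "e \<le> b" and M: "0 \<le> M"
  obtains C D where "0 \<le> C" "0 \<le> D"
    "\<And>x y \<alpha>. pre_ok e x y \<Longrightarrow> \<bar>Re x\<bar> \<le> M \<Longrightarrow> \<bar>Re y\<bar> \<le> M \<Longrightarrow> 0 \<le> \<alpha> \<Longrightarrow>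
      norm (pre x y \<alpha>) \<le> C * exp (D * \<alpha>)"
proof -
  have e': "e \<le> Q / 2" using e b_less_half_Q by simp
  obtain C where C: "0 < C"
    "\<And>z \<sigma> u T. Re z = \<sigma> \<Longrightarrow> e \<le> \<sigma> \<Longrightarrow> \<sigma> \<le> Q - e \<Longrightarrow> \<bar>Im z - u\<bar> \<le> T \<Longrightarrow>
      norm (S0 z) \<le> C * exp (pi * Q * T + pi * \<bar>u\<bar> * (\<sigma> - Q / 2))"
    "\<And>z \<sigma> u T. Re z = \<sigma> \<Longrightarrow> e \<le> \<sigma> \<Longrightarrow> \<sigma> \<le> Q - e \<Longrightarrow> \<bar>Im z - u\<bar> \<le> T \<Longrightarrow>
      inverse (norm (S0 z)) \<le> C * exp (pi * Q * T - pi * \<bar>u\<bar> * (\<sigma> - Q / 2))"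
    using S0_bounds_shifted[OF e(1) e'] by blast
  have C1: "norm (S0 z) \<le> C * exp (pi * Q * T)" if "e \<le> Re z" "Re z \<le> Q - e" "\<bar>Im z\<bar> \<le> T" for z T
    using C(2)[OF refl that(1,2), of 0 T] that by simp
  have C2: "inverse (norm (S0 z)) \<le> C * exp (pi * Q * T)" if "e \<le> Re z" "Re z \<le> Q - e" "\<bar>Im z\<bar> \<le> T" for z T
    using C(3)[OF refl that(1,2), of 0 T] that by simp
  define N where "N = 2 * M + 2 * l1 + 2 * l2"
  show ?thesis
  proof (rule that[of "2 * C ^ 4 * exp (4 * pi * Q * N)" "8 * pi * Q + 2 * pi * b"])
    fix x y :: complex and \<alpha> :: real
    assume ok: "pre_ok e x y" and x: "\<bar>Re x\<bar> \<le> M" and y: "\<bar>Re y\<bar> \<le> M" and \<alpha>: "0 \<le> \<alpha>"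
    define T where "T = 2 * \<alpha> + N"
    define E where "E = exp (pi * Q * T)"
    note ok' = ok[unfolded pre_ok_def]
    have bQ: "b \<le> Q - e" using e b_less_half_Q by linarith
    have bounds: "norm (S0 (Q / 2 + \<i> * \<alpha> - \<i> * (x + y))) \<le> C * E"
      "inverse (norm (S0 (Q / 2 - \<i> * y + \<i> * l2))) \<le> C * E"
      "norm (S0 (Q / 2 + \<i> * \<alpha> - \<i> * l1 + \<i> * l2)) \<le> C * E"
      "inverse (norm (S0 (2 * \<i> * \<alpha> + b))) \<le> C * E"
      unfolding E_def
      using ok' x y \<alpha> l1_nonneg l2_nonneg M e e' bQ
      by (intro C1 C2; simp add: T_def N_def; linarith)+
    have "norm (pre x y \<alpha>) = norm (S0 (Q / 2 + \<i> * \<alpha> - \<i> * (x + y))) * inverse (norm (S0 (Q / 2 - \<i> * y + \<i> * l2)))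
       * (norm (S0 (Q / 2 + \<i> * \<alpha> - \<i> * l1 + \<i> * l2)) * norm (sfac (2 * \<i> * \<alpha>)) * inverse (norm (S0 (2 * \<i> * \<alpha> + b))))"
      unfolding pre_def norm_divide norm_mult divide_inverse norm_inverse by (simp only: mult.assoc)
    also have "\<dots> \<le> (C * E) * (C * E) * ((C * E) * (2 * exp (2 * pi * b * \<alpha>)) * (C * E))"
      using C(1) bounds norm_sfac_imaginary[OF \<alpha>]
      by (intro mult_mono) (simp_all add: E_def)
    also have "\<dots> = 2 * C ^ 4 * (E * E * E * E * exp (2 * pi * b * \<alpha>))"
      by (simp add: eval_nat_numeral)
    also have "E * E * E * E * exp (2 * pi * b * \<alpha>) = exp (4 * pi * Q * N) * exp ((8 * pi * Q + 2 * pi * b) * \<alpha>)"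
      unfolding E_def exp_add[symmetric] by (rule arg_cong[of _ _ exp]) (simp add: T_def algebra_simps)
    finally show "norm (pre x y \<alpha>) \<le> 2 * C ^ 4 * exp (4 * pi * Q * N) * exp ((8 * pi * Q + 2 * pi * b) * \<alpha>)"
      by (simp only: mult.assoc)
  qed (use C(1) Q_pos b_pos in auto)
qed

text \<open>A class that contains the test functions and is preserved by the actions of
  \<open>E\<close>, \<open>F\<close> and \<open>K\<close>. Decay faster than every exponential in
  \<open>\<alpha>\<close>, locally uniformly in \<open>z\<close>, beats the growth of the kernel
  whatever its rate.\<close>

definition decaying :: "(real \<Rightarrow> complex \<Rightarrow> complex) \<Rightarrow> bool" where
  "decaying g \<longleftrightarrow> continuous_on UNIV (\<lambda>p. g (fst p) (snd p)) \<and> (\<forall>\<alpha>. g \<alpha> holomorphic_on UNIV) \<and>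
     (\<forall>M R. \<exists>C. \<forall>\<alpha>\<ge>0. \<forall>z. norm z \<le> R \<longrightarrow> norm (g \<alpha> z) \<le> C * exp (- M * \<alpha>))"

definition integrand :: "real \<Rightarrow> (real \<Rightarrow> complex \<Rightarrow> complex) \<Rightarrow> complex \<Rightarrow> complex \<Rightarrow> real \<times> real \<Rightarrow> complex" where
  "integrand k g x y = (\<lambda>(\<alpha>, u). indicator {0..} \<alpha> *\<^sub>R (pre x y \<alpha> * ker 0 x y \<alpha> (Complex u (- k)) * g \<alpha> (x + y)))"

text \<open>One integral over the plane of pairs \<open>(\<alpha>, u)\<close> instead of two
  iterated ones, so that a single dominating function serves for integrability and holomorphy. The
  arguments \<open>x\<close> and \<open>y\<close> may be complex; the height of the line in
  \<open>r\<close> is \<open>- k\<close>.\<close>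

definition Phi :: "real \<Rightarrow> (real \<Rightarrow> complex \<Rightarrow> complex) \<Rightarrow> complex \<Rightarrow> complex \<Rightarrow> complex" where
  "Phi k g x y = integral\<^sup>L lborel (integrand k g x y)"

lemma norm_integrand_bound:
  assumes e: "0 < e" "e \<le> b" and M: "0 \<le> M" and g: "decaying g"
  obtains C where "0 \<le> C"
    "\<And>k x y p. ker_ok e 0 k x y \<Longrightarrow> pre_ok e x y \<Longrightarrow> norm x \<le> M \<Longrightarrow> norm y \<le> M \<Longrightarrow>
      norm (integrand k g x y p) \<le> C * (exp (- 1 * \<bar>fst p\<bar>) * exp (- (2 * pi * e) * \<bar>snd p\<bar>))"
proof -
  have e': "e \<le> Q / 2" using e b_less_half_Q by simp
  obtain C1 D1 where C1: "0 \<le> C1" "0 \<le> D1"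
    "\<And>s k x y \<alpha> u. ker_ok e s k x y \<Longrightarrow> \<bar>Re x\<bar> \<le> M \<Longrightarrow> \<bar>Re y\<bar> \<le> M \<Longrightarrow> 0 \<le> \<alpha> \<Longrightarrow>
      norm (ker s x y \<alpha> (Complex u (- k))) \<le> C1 * exp (D1 * \<alpha>) * exp (- (2 * pi * e) * \<bar>u\<bar>)"
    using norm_ker_bound[OF e(1) e' M] by blast
  obtain C2 D2 where C2: "0 \<le> C2" "0 \<le> D2"
    "\<And>x y \<alpha>. pre_ok e x y \<Longrightarrow> \<bar>Re x\<bar> \<le> M \<Longrightarrow> \<bar>Re y\<bar> \<le> M \<Longrightarrow> 0 \<le> \<alpha> \<Longrightarrow>
      norm (pre x y \<alpha>) \<le> C2 * exp (D2 * \<alpha>)"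
    using norm_pre_bound[OF e M] by blast
  \<comment> \<open>The rate \<open>D1 + D2 + 1\<close> cancels the growth of \<open>ker\<close> and
    \<open>pre\<close> and leaves \<open>exp (- \<alpha>)\<close>.\<close>
  have "\<exists>C. \<forall>\<alpha>\<ge>0. \<forall>z. norm z \<le> 2 * M \<longrightarrow> norm (g \<alpha> z) \<le> C * exp (- (D1 + D2 + 1) * \<alpha>)"
    using g unfolding decaying_def by blast
  then obtain C3 where C3: "\<And>\<alpha> z. 0 \<le> \<alpha> \<Longrightarrow> norm z \<le> 2 * M \<Longrightarrow> norm (g \<alpha> z) \<le> C3 * exp (- (D1 + D2 + 1) * \<alpha>)"
    by blast
  have C3n: "0 \<le> C3" using order.trans[OF norm_ge_zero C3[of 0 0]] M by simp
  show ?thesis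
  proof (rule that[of "C2 * C1 * C3"])
    fix k x y and p :: "real \<times> real"
    assume ok: "ker_ok e 0 k x y" "pre_ok e x y" and x: "norm x \<le> M" and y: "norm y \<le> M"
    obtain \<alpha> u where p: "p = (\<alpha>, u)" by force
    have xr: "\<bar>Re x\<bar> \<le> M" "\<bar>Re y\<bar> \<le> M"
      using x y abs_Re_le_cmod[of x] abs_Re_le_cmod[of y] by auto
    have xy: "norm (x + y) \<le> 2 * M" using x y norm_triangle_ineq[of x y] by simp
    show "norm (integrand k g x y p) \<le> C2 * C1 * C3 * (exp (- 1 * \<bar>fst p\<bar>) * exp (- (2 * pi * e) * \<bar>snd p\<bar>))"
    proof (cases "0 \<le> \<alpha>")
      case True
      have "norm (integrand k g x y p) = norm (pre x y \<alpha>) * norm (ker 0 x y \<alpha> (Complex u (- k))) * norm (g \<alpha> (x + y))"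
        using True by (simp add: integrand_def p norm_mult)
      also have "\<dots> \<le> (C2 * exp (D2 * \<alpha>)) * (C1 * exp (D1 * \<alpha>) * exp (- (2 * pi * e) * \<bar>u\<bar>)) * (C3 * exp (- (D1 + D2 + 1) * \<alpha>))"
        using C1(1) C2(1)
        by (intro mult_mono C2(3)[OF ok(2) xr True] C1(3)[OF ok(1) xr True] C3[OF True xy] mult_nonneg_nonneg) auto
      also have "\<dots> = C2 * C1 * C3 * ((exp (D2 * \<alpha>) * exp (D1 * \<alpha>) * exp (- (D1 + D2 + 1) * \<alpha>)) * exp (- (2 * pi * e) * \<bar>u\<bar>))"
        by simp
      also have "exp (D2 * \<alpha>) * exp (D1 * \<alpha>) * exp (- (D1 + D2 + 1) * \<alpha>) = exp (- 1 * \<bar>\<alpha>\<bar>)"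
        unfolding exp_add[symmetric] using True by (intro arg_cong[of _ _ exp]) (simp add: algebra_simps)
      finally show ?thesis by (simp add: p)
    next
      case False
      then show ?thesis using C1(1) C2(1) C3n by (simp add: integrand_def p)
    qed
  qed (use C1 C2 C3n in auto)
qed

section \<open>Integrability and holomorphic dependence of the double integral\<close>

lemma integrable_exp_product:
  assumes "0 < d"
  shows "integrable lborel (\<lambda>p::real \<times> real. exp (- 1 * \<bar>fst p\<bar>) * exp (- d * \<bar>snd p\<bar>))"
proof -
  have i1: "integrable lborel (\<lambda>u::real. exp (- 1 * \<bar>u\<bar>))" by (rule integrable_exp_minus_abs) simp
  have i2: "integrable lborel (\<lambda>u::real. exp (- d * \<bar>u\<bar>))" by (rule integrable_exp_minus_abs[OF assms])
  have "integrable (lborel \<Otimes>\<^sub>M lborel) (\<lambda>p::real \<times> real. exp (- 1 * \<bar>fst p\<bar>) * exp (- d * \<bar>snd p\<bar>))"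
  proof (rule lborel_pair.Fubini_integrable)
    show "(\<lambda>p::real \<times> real. exp (- 1 * \<bar>fst p\<bar>) * exp (- d * \<bar>snd p\<bar>)) \<in> borel_measurable (lborel \<Otimes>\<^sub>M lborel)"
      by measurable
    show "integrable lborel (\<lambda>x::real. LINT y|lborel. norm (exp (- 1 * \<bar>fst (x, y)\<bar>) * exp (- d * \<bar>snd (x, y)\<bar>)))"
      using i1 i2 by (simp add: abs_mult)
    show "AE x in lborel. integrable lborel (\<lambda>y. exp (- 1 * \<bar>fst (x, y)\<bar>) * exp (- d * \<bar>snd (x, y)\<bar>))"
      using i2 by simp
  qed
  then show ?thesis by (simp add: lborel_prod)
qed

lemma continuous_on_S0_compose:
  assumes "continuous_on A f" "\<And>z. z \<in> A \<Longrightarrow> 0 < Re (f z)" "\<And>z. z \<in> A \<Longrightarrow> Re (f z) < Q"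
  shows "continuous_on A (\<lambda>z. S0 (f z))"
  by (rule continuous_on_compose2[OF holomorphic_on_imp_continuous_on[OF holomorphic_S0] assms(1)])
     (use assms in auto)

lemma holomorphic_on_S0_compose:
  assumes "f holomorphic_on A" "\<And>z. z \<in> A \<Longrightarrow> 0 < Re (f z)" "\<And>z. z \<in> A \<Longrightarrow> Re (f z) < Q"
  shows "(\<lambda>z. S0 (f z)) holomorphic_on A"
  using holomorphic_on_compose_gen[OF assms(1) holomorphic_S0] assms by (auto simp: o_def)

lemma continuous_on_integrand:
  assumes e: "0 < e" and ok: "ker_ok e 0 k x y" "pre_ok e x y" and g: "decaying g"
  shows "continuous_on UNIV (\<lambda>p::real \<times> real. pre x y (fst p) * ker 0 x y (fst p) (Complex (snd p) (- k)) * g (fst p) (x + y))"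
proof -
  note ok' = ok(1)[unfolded ker_ok_def] ok(2)[unfolded pre_ok_def]
  have "continuous_on UNIV (\<lambda>p::real \<times> real. g (fst (fst p, x + y)) (snd (fst p, x + y)))"
    using g unfolding decaying_def
    by (intro continuous_on_compose2[of UNIV "\<lambda>p. g (fst p) (snd p)" UNIV "\<lambda>p. (fst p, x + y)"])
       (auto intro!: continuous_intros)
  then have 1: "continuous_on UNIV (\<lambda>p::real \<times> real. g (fst p) (x + y))" by simp
  have bQ: "b < Q" using b_less_half_Q Q_pos by linarith
  have 2: "continuous_on UNIV (\<lambda>p::real \<times> real. pre x y (fst p))"
    unfolding pre_def sfac_def
    by (intro continuous_intros continuous_on_S0_compose)
       (use e ok' bQ b_pos in \<open>auto simp: S0_nonzero\<close>)
  have 3: "continuous_on UNIV (\<lambda>p::real \<times> real. ker 0 x y (fst p) (Complex (snd p) (- k)))"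
    unfolding ker_def Complex_eq
    by (intro continuous_intros continuous_on_S0_compose)
       (use e ok' in \<open>auto simp: S0_nonzero\<close>)
  show ?thesis by (intro continuous_intros 1 2 3)
qed

lemma integrand_measurable:
  assumes "0 < e" "ker_ok e 0 k x y" "pre_ok e x y" "decaying g"
  shows "integrand k g x y \<in> borel_measurable borel"
proof -
  have "(\<lambda>p::real \<times> real. indicator {0..} (fst p) :: real) \<in> borel_measurable (borel \<Otimes>\<^sub>M borel)"
    by measurable
  then have [measurable]: "(\<lambda>p::real \<times> real. indicator {0..} (fst p) :: real) \<in> borel_measurable borel"
    by (simp add: borel_prod)
  have [measurable]: "(\<lambda>p::real \<times> real. pre x y (fst p) * ker 0 x y (fst p) (Complex (snd p) (- k)) * g (fst p) (x + y)) \<in> borel_measurable borel"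
    by (rule borel_measurable_continuous_onI[OF continuous_on_integrand[OF assms]])
  show ?thesis unfolding integrand_def case_prod_beta by measurable
qed

lemma integrand_integrable:
  assumes e: "0 < e" "e \<le> b" and ok: "ker_ok e 0 k x y" "pre_ok e x y" and g: "decaying g"
  shows "integrable lborel (integrand k g x y)"
proof -
  obtain C where C: "0 \<le> C"
    "\<And>k' x' y' p. ker_ok e 0 k' x' y' \<Longrightarrow> pre_ok e x' y' \<Longrightarrow> norm x' \<le> max (norm x) (norm y) \<Longrightarrow> norm y' \<le> max (norm x) (norm y) \<Longrightarrow>
      norm (integrand k' g x' y' p) \<le> C * (exp (- 1 * \<bar>fst p\<bar>) * exp (- (2 * pi * e) * \<bar>snd p\<bar>))"
    using norm_integrand_bound[OF e _ g, of "max (norm x) (norm y)"] by (metis max.coboundedI1 norm_ge_zero)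
  show ?thesis
  proof (rule Bochner_Integration.integrable_bound)
    show "integrable lborel (\<lambda>p::real \<times> real. C * (exp (- 1 * \<bar>fst p\<bar>) * exp (- (2 * pi * e) * \<bar>snd p\<bar>)))"
      using e by (intro integrable_mult_right integrable_exp_product) auto
    show "integrand k g x y \<in> borel_measurable lborel"
      using integrand_measurable[OF e(1) ok g] by simp
    show "AE p in lborel. norm (integrand k g x y p) \<le> norm (C * (exp (- 1 * \<bar>fst p\<bar>) * exp (- (2 * pi * e) * \<bar>snd p\<bar>)))"
    proof (intro AE_I2)
      fix p :: "real \<times> real"
      have "norm (integrand k g x y p) \<le> C * (exp (- 1 * \<bar>fst p\<bar>) * exp (- (2 * pi * e) * \<bar>snd p\<bar>))"
        by (rule C(2)[OF ok]) auto
      also have "\<dots> \<le> norm \<dots>" by simp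
      finally show "norm (integrand k g x y p) \<le> norm (C * (exp (- 1 * \<bar>fst p\<bar>) * exp (- (2 * pi * e) * \<bar>snd p\<bar>)))" .
    qed
  qed
qed

text \<open>Every condition changes by at most the perturbation of the imaginary parts, except that
  the last one of \<open>ker_ok\<close> changes by up to twice as much; its margin carries the
  factor \<open>2\<close> for that reason.\<close>

lemma ok_perturb:
  assumes "0 < e" "\<bar>Im x - Im x0\<bar> + \<bar>Im y - Im y0\<bar> \<le> e"
  shows "ker_ok (2 * e) s k x0 y0 \<Longrightarrow> ker_ok e s k x y"
    and "pre_ok (2 * e) x0 y0 \<Longrightarrow> pre_ok e x y"
proof -
  have *: "\<bar>Im x - Im x0\<bar> \<le> e" "\<bar>Im y - Im y0\<bar> \<le> e" "\<bar>(Im x - Im x0) + (Im y - Im y0)\<bar> \<le> e"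
    using assms by linarith+
  show "ker_ok (2 * e) s k x0 y0 \<Longrightarrow> ker_ok e s k x y"
    using * assms(1) unfolding ker_ok_def by (elim conjE, intro conjI; linarith)
  show "pre_ok (2 * e) x0 y0 \<Longrightarrow> pre_ok e x y"
    using * assms(1) unfolding pre_ok_def by (elim conjE, intro conjI; linarith)
qed

lemma holomorphic_integrand:
  assumes e: "0 < e" and g: "decaying g" and fg: "f holomorphic_on A" "f' holomorphic_on A"
    and ok: "\<And>z. z \<in> A \<Longrightarrow> ker_ok e 0 k (f z) (f' z)" "\<And>z. z \<in> A \<Longrightarrow> pre_ok e (f z) (f' z)"
  shows "(\<lambda>z. integrand k g (f z) (f' z) p) holomorphic_on A"
proof -
  obtain \<alpha> u where p: "p = (\<alpha>, u)" by force
  note ok' = ok(1)[unfolded ker_ok_def] ok(2)[unfolded pre_ok_def]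
  have "g \<alpha> holomorphic_on UNIV" using g by (simp add: decaying_def)
  then have 1: "(\<lambda>z. g \<alpha> (f z + f' z)) holomorphic_on A"
    using holomorphic_on_compose_gen[of "\<lambda>z. f z + f' z" A "g \<alpha>" UNIV] fg
    by (auto simp: o_def intro!: holomorphic_intros)
  have 2: "(\<lambda>z. pre (f z) (f' z) \<alpha>) holomorphic_on A"
    unfolding pre_def
    by (intro holomorphic_intros holomorphic_on_S0_compose fg)
       (use e ok' in \<open>force simp: S0_nonzero\<close>)+
  have 3: "(\<lambda>z. ker 0 (f z) (f' z) \<alpha> (Complex u (- k))) holomorphic_on A"
    unfolding ker_def
    by (intro holomorphic_intros holomorphic_on_S0_compose fg)
       (use e ok' in \<open>force simp: S0_nonzero\<close>)+
  show ?thesis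
    unfolding integrand_def p case_prod_conv scaleR_conv_of_real
    by (intro holomorphic_intros 1 2 3)
qed

text \<open>On the ball of radius \<open>e\<close> the conditions persist with half the margin,
  which supplies one dominating function there. The functions \<open>f\<close> and \<open>f'\<close>
  are placeholders for the identity and a constant, so that continuation in \<open>x\<close> and in
  \<open>y\<close> are treated together.\<close>

lemma Phi_differentiable:
  assumes e: "0 < e" "e \<le> b" and g: "decaying g"
    and ff: "f holomorphic_on UNIV" "f' holomorphic_on UNIV"
    and near: "\<And>z. norm (z - z0) < e \<Longrightarrow> norm (f z - f z0) + norm (f' z - f' z0) \<le> e"
    and ok: "ker_ok (2 * e) 0 k (f z0) (f' z0)" "pre_ok (2 * e) (f z0) (f' z0)"
  shows "(\<lambda>z. Phi k g (f z) (f' z)) field_differentiable (at z0)"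
proof -
  define M where "M = norm (f z0) + norm (f' z0) + e"
  have M: "0 \<le> M" using e by (simp add: M_def add_nonneg_nonneg)
  obtain C where C: "0 \<le> C"
    "\<And>k x y p. ker_ok e 0 k x y \<Longrightarrow> pre_ok e x y \<Longrightarrow> norm x \<le> M \<Longrightarrow> norm y \<le> M \<Longrightarrow>
      norm (integrand k g x y p) \<le> C * (exp (- 1 * \<bar>fst p\<bar>) * exp (- (2 * pi * e) * \<bar>snd p\<bar>))"
    using norm_integrand_bound[OF e M g] by blast
  have near': "ker_ok e 0 k (f z) (f' z)" "pre_ok e (f z) (f' z)" "norm (f z) \<le> M" "norm (f' z) \<le> M"
    if "z \<in> ball z0 e" for z
  proof -
    have n: "norm (f z - f z0) + norm (f' z - f' z0) \<le> e"
      using near[of z] that by (simp add: dist_norm norm_minus_commute)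
    have "\<bar>Im (f z) - Im (f z0)\<bar> + \<bar>Im (f' z) - Im (f' z0)\<bar> \<le> e"
      using n abs_Im_le_cmod[of "f z - f z0"] abs_Im_le_cmod[of "f' z - f' z0"] by simp
    from ok_perturb[OF e(1) this] ok show "ker_ok e 0 k (f z) (f' z)" "pre_ok e (f z) (f' z)" by auto
    have "norm (f z - f z0) \<le> e" "norm (f' z - f' z0) \<le> e"
      using n norm_ge_zero[of "f z - f z0"] norm_ge_zero[of "f' z - f' z0"] by linarith+
    then show "norm (f z) \<le> M" "norm (f' z) \<le> M"
      using norm_triangle_sub[of "f z" "f z0"] norm_triangle_sub[of "f' z" "f' z0"]
        norm_ge_zero[of "f z0"] norm_ge_zero[of "f' z0"] unfolding M_def by linarith+
  qed
  have "((\<lambda>z. LINT p|lborel. integrand k g (f z) (f' z) p) has_field_derivative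
      (LINT p|lborel. deriv (\<lambda>z. integrand k g (f z) (f' z) p) z0)) (at z0)"
  proof (rule has_field_derivative_integral_dominated[OF e(1)])
    show "integrable lborel (\<lambda>p::real \<times> real. C * (exp (- 1 * \<bar>fst p\<bar>) * exp (- (2 * pi * e) * \<bar>snd p\<bar>)))"
      using e by (intro integrable_mult_right integrable_exp_product) auto
    show "(\<lambda>z. integrand k g (f z) (f' z) p) holomorphic_on ball z0 e" for p
      by (rule holomorphic_integrand[OF e(1) g])
         (use near' ff in \<open>auto intro: holomorphic_on_subset\<close>)
    fix z assume z: "z \<in> ball z0 e"
    show "(\<lambda>p. integrand k g (f z) (f' z) p) \<in> borel_measurable lborel"
      using integrand_measurable[OF e(1) near'(1,2)[OF z] g] by simp
    show "norm (integrand k g (f z) (f' z) p) \<le> C * (exp (- 1 * \<bar>fst p\<bar>) * exp (- (2 * pi * e) * \<bar>snd p\<bar>))" for p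
      by (rule C(2)) (rule near'[OF z])+
  qed
  then show ?thesis unfolding Phi_def field_differentiable_def by blast
qed

text \<open>At these heights the numerator arguments have real parts in \<open>(0, Q / 2)\<close>
  and the denominator arguments in \<open>(Q / 2, Q)\<close>, so every \<open>Sb\<close> is
  evaluated in the strip.\<close>

lemma kernel_integrand_eq_ker:
  fixes x y \<alpha> :: real
  assumes "- Q / 2 < Im r" "Im r < 0"
  shows "kernel_integrand b l1 l2 x y \<alpha> (x + y) r = ker 0 x y \<alpha> r"
proof -
  have "Sb b (\<i> * \<alpha> - \<i> * y - \<i> * l1 + \<i> * r) = S0 (\<i> * \<alpha> - \<i> * y - \<i> * l1 + \<i> * r)"
    "Sb b (\<i> * r) = S0 (\<i> * r)" "Sb b (2 * \<i> * \<alpha> + \<i> * r) = S0 (2 * \<i> * \<alpha> + \<i> * r)"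
    "Sb b (Q / 2 + \<i> * \<alpha> - \<i> * complex_of_real (x + y) + \<i> * r) = S0 (Q / 2 + \<i> * \<alpha> - \<i> * complex_of_real (x + y) + \<i> * r)"
    "Sb b (Q / 2 + \<i> * \<alpha> - \<i> * l1 - \<i> * l2 + \<i> * r) = S0 (Q / 2 + \<i> * \<alpha> - \<i> * l1 - \<i> * l2 + \<i> * r)"
    "Sb b (Q / 2 + \<i> * \<alpha> - \<i> * l1 + \<i> * l2 + \<i> * r) = S0 (Q / 2 + \<i> * \<alpha> - \<i> * l1 + \<i> * l2 + \<i> * r)"
    by (rule Sb_strip; use assms Q_pos in simp)+
  then show ?thesis unfolding kernel_integrand_def ker_def by simp
qed

section \<open>Independence of the contour and reduction of the transform to
  \<open>Phi\<close>\<close>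

lemma holomorphic_ker:
  assumes "\<And>r. r \<in> A \<Longrightarrow> \<exists>e>0. ker_ok e s (- Im r) x y"
  shows "ker s x y \<alpha> holomorphic_on A"
proof -
  have st: "0 < Im y - Im r - s" "Im y - Im r - s < Q" "0 < - Im r" "- Im r < Q"
    "0 < Q / 2 - Im r - s" "Q / 2 - Im r - s < Q"
    "0 < Q / 2 + Im x + Im y - Im r - s" "Q / 2 + Im x + Im y - Im r - s < Q" if r: "r \<in> A" for r
    using assms[OF r] unfolding ker_ok_def by auto
  show ?thesis
    unfolding ker_def
    by (intro holomorphic_intros holomorphic_on_S0_compose)
       (use st in \<open>force simp: S0_nonzero algebra_simps\<close>)+
qed

lemma ker_line_shift:
  fixes x y :: complex
  assumes h: "h1 \<le> h2" and \<alpha>: "0 \<le> \<alpha>" and e: "0 < e" "e \<le> Q / 2"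
    and hol: "\<And>r. h1 - e \<le> Im r \<Longrightarrow> Im r \<le> h2 + e \<Longrightarrow> ker_ok e s (- Im r) x y"
  shows "line_integral h1 (ker s x y \<alpha>) = line_integral h2 (ker s x y \<alpha>)"
    and "line_integrable h1 (ker s x y \<alpha>)" and "line_integrable h2 (ker s x y \<alpha>)"
proof -
  define M where "M = max \<bar>Re x\<bar> \<bar>Re y\<bar>"
  have M: "0 \<le> M" "\<bar>Re x\<bar> \<le> M" "\<bar>Re y\<bar> \<le> M" by (auto simp: M_def)
  obtain C D where C: "0 \<le> C" "0 \<le> D"
    "\<And>s k x y \<alpha> u. ker_ok e s k x y \<Longrightarrow> \<bar>Re x\<bar> \<le> M \<Longrightarrow> \<bar>Re y\<bar> \<le> M \<Longrightarrow> 0 \<le> \<alpha> \<Longrightarrow>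
      norm (ker s x y \<alpha> (Complex u (- k))) \<le> C * exp (D * \<alpha>) * exp (- (2 * pi * e) * \<bar>u\<bar>)"
    using norm_ker_bound[OF e M(1)] by blast
  have bd: "norm (ker s x y \<alpha> r) \<le> C * exp (D * \<alpha>) * exp (- (2 * pi * e) * \<bar>Re r\<bar>)"
    if "h1 \<le> Im r" "Im r \<le> h2" for r
    using C(3)[OF hol[of r] M(2,3) \<alpha>, of "Re r"] that e by simp
  have hl: "ker s x y \<alpha> holomorphic_on {r. h1 - e < Im r \<and> Im r < h2 + e}"
    by (rule holomorphic_ker) (use hol e in \<open>auto intro!: exI[of _ e]\<close>)
  have d: "0 < 2 * pi * e" using e by simp
  show "line_integral h1 (ker s x y \<alpha>) = line_integral h2 (ker s x y \<alpha>)"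
    by (rule line_integral_shift[OF hl _ h _ bd d]) (use e in auto)
  have ct: "continuous_on {r. h1 - e < Im r \<and> Im r < h2 + e} (ker s x y \<alpha>)"
    by (rule holomorphic_on_imp_continuous_on[OF hl])
  show "line_integrable h1 (ker s x y \<alpha>)" "line_integrable h2 (ker s x y \<alpha>)"
    by (rule line_integrable_exp_decay[where Rb=0, OF _ bd d];
        use h e in \<open>auto intro!: continuous_on_subset[OF ct]\<close>)+
qed

lemma ker_line_real:
  fixes x y :: real
  assumes "- Q / 2 < h" "h < 0" "- Q / 2 < h'" "h' < 0" "0 \<le> \<alpha>"
  shows "line_integral h (ker 0 x y \<alpha>) = line_integral h' (ker 0 x y \<alpha>)" "line_integrable h (ker 0 x y \<alpha>)"
proof -
  have *: "line_integral h1 (ker 0 x y \<alpha>) = line_integral h2 (ker 0 x y \<alpha>) \<and>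
      line_integrable h1 (ker 0 x y \<alpha>) \<and> line_integrable h2 (ker 0 x y \<alpha>)"
    if h: "h1 \<le> h2" "- Q / 2 < h1" "h2 < 0" for h1 h2
  proof -
    \<comment> \<open>Half the distance to the forbidden heights: the range of heights widened by
      \<open>e\<close> still has margin \<open>e\<close>.\<close>
    define e where "e = min (- h2) (Q / 2 + h1) / 2"
    have e: "0 < e" "2 * e \<le> - h2" "2 * e \<le> Q / 2 + h1" using h by (auto simp: e_def min_def)
    have "ker_ok e 0 (- Im r) x y" if "h1 - e \<le> Im r" "Im r \<le> h2 + e" for r
      using that e h b_pos Q_pos unfolding ker_ok_def by auto
    moreover have "e \<le> Q / 2" using e h Q_pos by linarith
    ultimately show ?thesis using ker_line_shift[OF h(1) assms(5) e(1)] by blast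
  qed
  show "line_integral h (ker 0 x y \<alpha>) = line_integral h' (ker 0 x y \<alpha>)" "line_integrable h (ker 0 x y \<alpha>)"
  proof (atomize (full), cases "h \<le> h'")
    case True
    then show "line_integral h (ker 0 x y \<alpha>) = line_integral h' (ker 0 x y \<alpha>) \<and> line_integrable h (ker 0 x y \<alpha>)"
      using *[OF True assms(1,4)] by simp
  next
    case False
    then have "h' \<le> h" by simp
    from *[OF this assms(3,2)]
    show "line_integral h (ker 0 x y \<alpha>) = line_integral h' (ker 0 x y \<alpha>) \<and> line_integrable h (ker 0 x y \<alpha>)"
      by simp
  qed
qed

lemma line_kernel_integrand:
  fixes x y :: real
  assumes "- Q / 2 < h" "h < 0" "0 < k" "k < Q / 2" "0 \<le> \<alpha>"
  shows "line_integral h (kernel_integrand b l1 l2 x y \<alpha> (x + y)) = line_integral (- k) (ker 0 x y \<alpha>)"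
    and "line_integrable h (kernel_integrand b l1 l2 x y \<alpha> (x + y))"
proof -
  have eq: "kernel_integrand b l1 l2 x y \<alpha> (x + y) (Complex u h) = ker 0 x y \<alpha> (Complex u h)" for u
    by (rule kernel_integrand_eq_ker) (use assms in auto)
  show "line_integral h (kernel_integrand b l1 l2 x y \<alpha> (x + y)) = line_integral (- k) (ker 0 x y \<alpha>)"
    unfolding line_integral_def eq unfolding line_integral_def[symmetric]
    by (rule ker_line_real(1)) (use assms in auto)
  show "line_integrable h (kernel_integrand b l1 l2 x y \<alpha> (x + y))"
    unfolding line_integrable_def eq unfolding line_integrable_def[symmetric]
    by (rule ker_line_real(2)[of h "- k"]) (use assms in auto)
qed

text \<open>Since the exponential factor is continuous, the pole of \<open>Sb\<close> is one of
  \<open>Gb\<close>, where a nicely meromorphic function takes the value \<open>0\<close>.\<close>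

lemma Sb_0: "Sb b 0 = 0"
proof -
  have p: "is_pole (Gb b) 0"
  proof -
    have "is_pole (Sb b) 0" by (rule is_pole_Sb_0)
    show ?thesis
    proof (rule ccontr)
      assume "\<not> is_pole (Gb b) 0"
      then have "Gb b \<midarrow>0\<rightarrow> Gb b 0"
        using Gb_spec by (auto simp: nicely_meromorphic_on_def)
      then have "((\<lambda>x. exp (pi * \<i> * x * (of_real Q - x) / 2) * Gb b x) \<longlongrightarrow> exp (pi * \<i> * 0 * (of_real Q - 0) / 2) * Gb b 0) (at 0)"
        by (intro tendsto_intros) auto
      then have "(Sb b \<longlongrightarrow> exp (pi * \<i> * 0 * (of_real Q - 0) / 2) * Gb b 0) (at 0)"
        by (simp add: Sb_def[abs_def])
      with is_pole_Sb_0 show False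
        using not_tendsto_and_filterlim_at_infinity[of "at (0::complex)" "Sb b"] by (auto simp: is_pole_def)
    qed
  qed
  have "\<not> Gb b \<midarrow>0\<rightarrow> Gb b 0"
    using p not_tendsto_and_filterlim_at_infinity[of "at (0::complex)" "Gb b"] by (auto simp: is_pole_def)
  then have "Gb b 0 = 0" using Gb_spec by (auto simp: nicely_meromorphic_on_def)
  then show ?thesis by (simp add: Sb_def)
qed

text \<open>At \<open>\<alpha> = 0\<close> the conventional value \<open>Sb b 0 = 0\<close> and
  division by zero make the left side \<open>0\<close>, which agrees with the value
  \<open>sfac 0 / S0 b = 0\<close> of the regular expression.\<close>

lemma inverse_Sb_imaginary:
  assumes "0 \<le> \<alpha>"
  shows "1 / Sb b (2 * \<i> * of_real \<alpha>) = sfac (2 * \<i> * of_real \<alpha>) / S0 (2 * \<i> * of_real \<alpha> + b)"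
proof (cases "\<alpha> = 0")
  case True
  then show ?thesis by (simp add: Sb_0 sfac_def)
next
  case False
  then have e: "S0 (2 * \<i> * of_real \<alpha> + b) = sfac (2 * \<i> * of_real \<alpha>) * Sb b (2 * \<i> * of_real \<alpha>)"
    by (intro Sb_imaginary) auto
  moreover have "sfac (2 * \<i> * of_real \<alpha>) \<noteq> 0"
    using e S0_nonzero by (metis mult_zero_left)
  ultimately show ?thesis by simp
qed

lemma cg_kernel_eq:
  fixes x y :: real
  assumes "- Q / 2 < h" "h < 0" "0 < k" "k < Q / 2" "0 \<le> \<alpha>"
  shows "cg_kernel b l1 l2 h x y \<alpha> (x + y) = pre x y \<alpha> * line_integral (- k) (ker 0 x y \<alpha>)"
proof -
  have "Sb b (Q / 2 + \<i> * \<alpha> - \<i> * complex_of_real (x + y)) = S0 (Q / 2 + \<i> * \<alpha> - \<i> * complex_of_real (x + y))"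
    "Sb b (Q / 2 + \<i> * \<alpha> - \<i> * l1 + \<i> * l2) = S0 (Q / 2 + \<i> * \<alpha> - \<i> * l1 + \<i> * l2)"
    "Sb b (Q / 2 - \<i> * y + \<i> * l2) = S0 (Q / 2 - \<i> * y + \<i> * l2)"
    by (rule Sb_strip; use Q_pos in simp)+
  note S = this
  have "cg_kernel b l1 l2 h x y \<alpha> (x + y) = S0 (Q / 2 + \<i> * \<alpha> - \<i> * complex_of_real (x + y)) / S0 (Q / 2 - \<i> * y + \<i> * l2)
     * (S0 (Q / 2 + \<i> * \<alpha> - \<i> * l1 + \<i> * l2) * (1 / Sb b (2 * \<i> * of_real \<alpha>))) * line_integral (- k) (ker 0 x y \<alpha>)"
    unfolding cg_kernel_def line_kernel_integrand(1)[OF assms] using S by simp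
  then show ?thesis unfolding inverse_Sb_imaginary[OF assms(5)] pre_def by simp
qed

lemma ok_real:
  fixes x y :: real
  assumes "0 < k" "k < Q / 2"
  obtains e where "0 < e" "e \<le> b" "ker_ok e 0 k x y" "pre_ok e x y"
proof -
  define e where "e = min (min b k) (min (Q / 2 - k) (Q / 4))"
  have e: "0 < e" using assms b_pos Q_pos by (simp add: e_def)
  have e': "e \<le> b" "e \<le> k" "e \<le> Q / 2 - k" "e \<le> Q / 4"
    unfolding e_def
    by (rule min.coboundedI1[OF min.cobounded1] min.coboundedI1[OF min.cobounded2]
        min.coboundedI2[OF min.cobounded1] min.coboundedI2[OF min.cobounded2])+
  show ?thesis
  proof (rule that[OF e e'(1)])
    show "ker_ok e 0 k x y" "pre_ok e x y"
      unfolding ker_ok_def pre_ok_def Im_complex_of_real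
      using assms b_pos e e' by (intro conjI; linarith)+
  qed
qed

text \<open>The heights \<open>h x y \<alpha>\<close> may vary with \<open>\<alpha>\<close> in any
  manner, but no kernel value depends on them. All are therefore replaced by \<open>- k\<close>,
  after which Fubini's theorem joins the integrals in \<open>\<alpha>\<close> and
  \<open>r\<close>.\<close>

lemma transform_eq_Phi:
  fixes x y :: real
  assumes sep: "\<And>x y \<alpha>. 0 \<le> \<alpha> \<Longrightarrow> separates b l1 l2 y \<alpha> (x + y) (h x y \<alpha>)"
    and g: "decaying g" and f: "\<And>\<alpha> z. 0 \<le> \<alpha> \<Longrightarrow> f \<alpha> z = g \<alpha> (of_real z)"
    and k: "0 < k" "k < Q / 2"
  shows "transform_converges b l1 l2 h f" "transform b l1 l2 h f x y = Phi k g x y"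
proof -
  have hh: "- Q / 2 < h x y \<alpha>" "h x y \<alpha> < 0" if "0 \<le> \<alpha>" for x y \<alpha>
    using separates_bounds[OF sep[OF that]] by auto
  have inner: "(LINT u|lborel. integrand k g x y (\<alpha>, u)) =
      indicator {0..} \<alpha> *\<^sub>R (cg_kernel b l1 l2 (h x y \<alpha>) x y \<alpha> (x + y) * f \<alpha> (x + y))" for x y \<alpha> :: real
  proof (cases "0 \<le> \<alpha>")
    case True
    then show ?thesis
      by (simp add: integrand_def cg_kernel_eq[OF hh[OF True] k True] f[OF True] line_integral_def mult_ac)
  qed (simp add: integrand_def)
  have int: "integrable (lborel \<Otimes>\<^sub>M lborel) (integrand k g x y)" for x y :: real
  proof -
    obtain e where "0 < e" "e \<le> b" "ker_ok e 0 k x y" "pre_ok e x y" by (rule ok_real[OF k])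
    then show ?thesis using integrand_integrable[OF _ _ _ _ g] by (simp add: lborel_prod)
  qed
  show "transform_converges b l1 l2 h f"
    unfolding transform_converges_def set_integrable_def
  proof (intro conjI allI impI)
    show "line_integrable (h x y \<alpha>) (kernel_integrand b l1 l2 x y \<alpha> (x + y))" if "0 \<le> \<alpha>" for x y \<alpha>
      by (rule line_kernel_integrand(2)[OF hh[OF that] k that])
    show "integrable lborel (\<lambda>\<alpha>. indicat_real {0..} \<alpha> *\<^sub>R (cg_kernel b l1 l2 (h x y \<alpha>) x y \<alpha> (x + y) * f \<alpha> (x + y)))" for x y
      using lborel_pair.integrable_fst'[OF int[of x y]] by (simp add: inner)
  qed
  have "transform b l1 l2 h f x y = (LINT \<alpha>|lborel. LINT u|lborel. integrand k g x y (\<alpha>, u))"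
    unfolding transform_def set_lebesgue_integral_def inner ..
  also have "\<dots> = integral\<^sup>L (lborel \<Otimes>\<^sub>M lborel) (integrand k g x y)"
    by (rule lborel_pair.integral_fst'[OF int])
  finally show "transform b l1 l2 h f x y = Phi k g x y" by (simp add: Phi_def lborel_prod)
qed

end

section \<open>Difference equations for the kernel\<close>

context qdilog
begin

lemma inverse_b_eq: "1 / b = Q - b"
  by (simp add: Qb_def)

lemma sfac_prod: "sfac (u + v) * sfac (u - v) = (sfac u)\<^sup>2 - (sfac v)\<^sup>2"
proof -
  have "sin (p + q) * sin (p - q) = (sin p)\<^sup>2 - (sin q)\<^sup>2" for p q :: complex
  proof -
    have "sin (p + q) * sin (p - q) = (sin p)\<^sup>2 * (cos q)\<^sup>2 - (cos p)\<^sup>2 * (sin q)\<^sup>2"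
      by (simp add: sin_add sin_diff power2_eq_square algebra_simps)
    also have "\<dots> = (sin p)\<^sup>2 * (1 - (sin q)\<^sup>2) - (1 - (sin p)\<^sup>2) * (sin q)\<^sup>2"
      by (simp only: cos_squared_eq)
    finally show ?thesis by (simp add: algebra_simps)
  qed
  from this[of "pi * b * u" "pi * b * v"] show ?thesis
    by (simp add: sfac_def distrib_left right_diff_distrib power_mult_distrib)
qed

lemma sfac_minus: "sfac (- w) = - sfac w"
  by (simp add: sfac_def)

lemma sfac_add_period: "sfac (w + complex_of_real (1 / b)) = - sfac w"
proof -
  have "pi * b * (w + complex_of_real (1 / b)) = pi * b * w + complex_of_real pi"
    using b_pos by (simp add: distrib_left)
  then show ?thesis by (simp add: sfac_def sin_plus_pi)
qed

lemma sfac_reflect: "sfac (complex_of_real (1 / b) - w) = sfac w"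
  using sfac_add_period[of "- w"] by (simp add: sfac_minus)

lemma sfac_exp:
  assumes "pi * \<i> * b * w = z"
  shows "sfac w = - \<i> * (exp z - 1 / exp z)"
  unfolding sfac_eq assms exp_minus by (simp add: divide_inverse)

text \<open>In terms of \<open>a = exp (pi * i * b * u)\<close> and
  \<open>c = exp (pi * i * b * v)\<close> the mixed terms, \<open>1 / (a * c^2)\<close> in the first
  case and \<open>a * c^2\<close> in the second, cancel and \<open>a - 1 / a\<close> is
  left.\<close>

lemma sfac_sum_exp:
  fixes u v :: complex
  shows "sfac (u + v) * exp (- (\<i> * (pi * b * v))) + exp (- (\<i> * (pi * b * (u + v)))) * sfac (- v) = sfac u"
    and "sfac (u + v) * exp (\<i> * (pi * b * v)) + exp (\<i> * (pi * b * (u + v))) * sfac (- v) = sfac u"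
proof -
  define a where "a = exp (pi * \<i> * b * u)"
  define c where "c = exp (pi * \<i> * b * v)"
  have nz: "a \<noteq> 0" "c \<noteq> 0" by (auto simp: a_def c_def)
  have 1: "sfac (u + v) = - \<i> * (a * c - 1 / (a * c))"
    by (subst sfac_exp[OF refl]) (simp add: a_def c_def distrib_left exp_add)
  have 2: "sfac (- v) = - \<i> * (1 / c - c)"
    by (subst sfac_exp[OF refl]) (simp add: c_def exp_minus field_simps)
  have 3: "sfac u = - \<i> * (a - 1 / a)"
    by (subst sfac_exp[OF refl]) (simp add: a_def)
  have 4: "exp (\<i> * (pi * b * v)) = c" "exp (\<i> * (pi * b * (u + v))) = a * c"
    unfolding a_def c_def exp_add[symmetric] by (rule arg_cong[of _ _ exp], simp add: algebra_simps)+
  show "sfac (u + v) * exp (- (\<i> * (pi * b * v))) + exp (- (\<i> * (pi * b * (u + v)))) * sfac (- v) = sfac u"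
    unfolding exp_minus 1 2 3 4 using nz by (simp add: field_simps)
  show "sfac (u + v) * exp (\<i> * (pi * b * v)) + exp (\<i> * (pi * b * (u + v))) * sfac (- v) = sfac u"
    unfolding 1 2 3 4 using nz by (simp add: field_simps)
qed

lemma S0_sub_b:
  fixes w :: complex
  assumes "b < Re w" "Re w < Q"
  shows "S0 w = sfac (w - b) * S0 (w - b)"
  using S0_add_b[of "w - b"] assms by (simp add: Qb_def)

lemma sfac_nonzero:
  fixes w :: complex
  assumes "0 < Re w" "Re w < 1 / b"
  shows "sfac w \<noteq> 0"
  using S0_add_b[OF assms] S0_nonzero by (metis mult_zero_left)

end

context cg_kernel_setup
begin

text \<open>The first identity of \<open>sfac_sum_exp\<close>, with \<open>u\<close> the first
  denominator argument of the kernel and \<open>- v\<close> its first numerator argument. The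
  exponentials are those that the kernel picks up under the shifts of \<open>x\<close> and
  \<open>y\<close>.\<close>

lemma E_relation:
  fixes x y r :: complex and \<alpha> :: real
  shows "sfac (Q / 2 + \<i> * (l1 - x)) * exp (- (pi * b * (r + \<alpha> - l1 - y)))
      + exp (- 2 * pi * b * x) * exp (- (\<i> * pi * b * (Q / 2 + \<i> * x + \<i> * l1))) * sfac (\<i> * \<alpha> - \<i> * y - \<i> * l1 + \<i> * r)
    = sfac (Q / 2 + \<i> * \<alpha> - \<i> * (x + y) + \<i> * r)"
proof -
  define u where "u = Q / 2 + \<i> * \<alpha> - \<i> * (x + y) + \<i> * r"
  define v where "v = - (\<i> * \<alpha> - \<i> * y - \<i> * l1 + \<i> * r)"
  have 1: "Q / 2 + \<i> * (l1 - x) = u + v" by (simp add: u_def v_def algebra_simps)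
  have 2: "- (pi * b * (r + \<alpha> - l1 - y)) = - (\<i> * (pi * b * v))"
    by (simp add: v_def algebra_simps)
  have 3: "exp (- 2 * pi * b * x) * exp (- (\<i> * pi * b * (Q / 2 + \<i> * x + \<i> * l1))) = exp (- (\<i> * (pi * b * (u + v))))"
    unfolding exp_add[symmetric] by (rule arg_cong[of _ _ exp]) (simp add: u_def v_def algebra_simps)
  have 4: "\<i> * \<alpha> - \<i> * y - \<i> * l1 + \<i> * r = - v" by (simp add: v_def)
  show ?thesis
    using sfac_sum_exp(1)[of u v] unfolding 1 2 3 4 u_def[symmetric] .
qed

text \<open>
  Written in terms of \<open>w = i \<alpha> - i y - i l1 + i r - b\<close> and \<open>p = Q / 2 + i y\<close>, the relation
  reduces to \<open>sfac (u + v) * sfac (u - v) = (sfac u)\<^sup>2 - (sfac v)\<^sup>2\<close>, used three times.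
\<close>

lemma F_relation:
  fixes x y r :: complex and \<alpha> :: real
  defines "c0 \<equiv> exp (\<i> * pi * b * (Q / 2 + \<i> * x + \<i> * l1))"
  defines "d1 \<equiv> sfac (Q / 2 + \<i> * \<alpha> - \<i> * (x + y) + \<i> * r - b)"
  assumes nz: "sfac (\<i> * \<alpha> - \<i> * y - \<i> * l1 + \<i> * r - b) \<noteq> 0"
  shows "sfac (Q / 2 + \<i> * \<alpha> + \<i> * (x + y)) * sfac (Q / 2 + \<i> * \<alpha> - \<i> * (x + y) - b)
      - sfac (Q / 2 + \<i> * (l2 + y)) * sfac (Q / 2 - \<i> * y + \<i> * l2 - b) * c0 * d1 / sfac (\<i> * \<alpha> - \<i> * y - \<i> * l1 + \<i> * r - b)
      - sfac (Q / 2 + \<i> * (l1 + x)) * exp (2 * pi * b * y) * exp (pi * b * (r + \<alpha> - l1 - y)) * d1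
    = sfac (\<i> * r) * sfac (2 * \<i> * \<alpha> + \<i> * r)
      - c0 * d1 * sfac (Q / 2 + \<i> * \<alpha> - \<i> * l1 - \<i> * l2 + \<i> * r - b) * sfac (Q / 2 + \<i> * \<alpha> - \<i> * l1 + \<i> * l2 + \<i> * r - b)
        / sfac (\<i> * \<alpha> - \<i> * y - \<i> * l1 + \<i> * r - b)"
proof -
  define w where "w = \<i> * \<alpha> - \<i> * y - \<i> * l1 + \<i> * r - b"
  define p where "p = Q / 2 + \<i> * y"
  define m where "m = \<i> * complex_of_real l2"
  define q where "q = Q / 2 + \<i> * (x + y)"
  have QQ: "complex_of_real Q = b + complex_of_real (1 / b)" by (simp only: Qb_def of_real_add)
  have half: "complex_of_real (Q / 2) = complex_of_real Q / 2" by simp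
  have a1: "Q / 2 + \<i> * (l2 + y) = p + m" by (simp add: p_def m_def algebra_simps)
  have "Q / 2 - \<i> * y + \<i> * l2 - b = complex_of_real (1 / b) - (p - m)"
    unfolding p_def m_def half QQ by (simp add: field_simps)
  then have a2: "sfac (Q / 2 - \<i> * y + \<i> * l2 - b) = sfac (p - m)" by (simp only: sfac_reflect)
  have a3: "Q / 2 + \<i> * \<alpha> - \<i> * l1 - \<i> * l2 + \<i> * r - b = (w + p) - m"
    "Q / 2 + \<i> * \<alpha> - \<i> * l1 + \<i> * l2 + \<i> * r - b = (w + p) + m"
    by (simp_all add: w_def p_def m_def algebra_simps)
  have "w + p + p = (\<i> * \<alpha> + \<i> * y - \<i> * l1 + \<i> * r) + complex_of_real (1 / b)"
    unfolding w_def p_def half QQ by (simp add: field_simps)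
  then have a4: "sfac (w + p + p) = - sfac (\<i> * \<alpha> + \<i> * y - \<i> * l1 + \<i> * r)" by (simp only: sfac_add_period)
  have "sfac (p + m) * sfac (p - m) - sfac (w + p - m) * sfac (w + p + m) = (sfac p)\<^sup>2 - (sfac (w + p))\<^sup>2"
    using sfac_prod[of p m] sfac_prod[of "w + p" m] by (simp add: mult.commute)
  also have "\<dots> = - (sfac (w + p + p) * sfac (w + p - p))"
    unfolding sfac_prod by simp
  also have "\<dots> = sfac (\<i> * \<alpha> + \<i> * y - \<i> * l1 + \<i> * r) * sfac w"
    unfolding a4 add_diff_cancel_right' by simp
  finally have A: "sfac (p + m) * sfac (p - m) - sfac (w + p - m) * sfac (w + p + m)
      = sfac (\<i> * \<alpha> + \<i> * y - \<i> * l1 + \<i> * r) * sfac w" .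
  have B: "sfac (Q / 2 + \<i> * (l1 + x)) * exp (2 * pi * b * y) * exp (pi * b * (r + \<alpha> - l1 - y))
      + c0 * sfac (\<i> * \<alpha> + \<i> * y - \<i> * l1 + \<i> * r) = sfac (q + (\<i> * \<alpha> + \<i> * r))"
  proof -
    define u where "u = q + (\<i> * \<alpha> + \<i> * r)"
    define v where "v = \<i> * l1 - \<i> * \<alpha> - \<i> * y - \<i> * r"
    have 1: "Q / 2 + \<i> * (l1 + x) = u + v" by (simp add: u_def v_def q_def algebra_simps)
    have 2: "exp (2 * pi * b * y) * exp (pi * b * (r + \<alpha> - l1 - y)) = exp (\<i> * (pi * b * v))"
      unfolding exp_add[symmetric] by (rule arg_cong[of _ _ exp]) (simp add: v_def algebra_simps)
    have 3: "c0 = exp (\<i> * (pi * b * (u + v)))"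
      unfolding c0_def 1[symmetric] by (rule arg_cong[of _ _ exp]) (simp add: algebra_simps)
    have 4: "\<i> * \<alpha> + \<i> * y - \<i> * l1 + \<i> * r = - v" by (simp add: v_def)
    show ?thesis
      using sfac_sum_exp(2)[of u v] unfolding 1 3[symmetric] 4 2[symmetric] by (simp add: u_def mult.assoc)
  qed
  have "Q / 2 + \<i> * \<alpha> - \<i> * (x + y) + \<i> * r - b = complex_of_real (1 / b) - (q - (\<i> * \<alpha> + \<i> * r))"
    unfolding q_def half QQ by (simp add: field_simps)
  then have d1: "d1 = sfac (q - (\<i> * \<alpha> + \<i> * r))" unfolding d1_def by (simp only: sfac_reflect)
  have "Q / 2 + \<i> * \<alpha> - \<i> * (x + y) - b = complex_of_real (1 / b) - (q - \<i> * \<alpha>)"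
    unfolding q_def half QQ by (simp add: field_simps)
  then have e1: "sfac (Q / 2 + \<i> * \<alpha> - \<i> * (x + y) - b) = sfac (q - \<i> * \<alpha>)" by (simp only: sfac_reflect)
  have e2: "Q / 2 + \<i> * \<alpha> + \<i> * (x + y) = q + \<i> * \<alpha>" by (simp add: q_def algebra_simps)
  have e3: "sfac (\<i> * r) * sfac (2 * \<i> * \<alpha> + \<i> * r) = (sfac (\<i> * \<alpha> + \<i> * r))\<^sup>2 - (sfac (\<i> * \<alpha>))\<^sup>2"
    using sfac_prod[of "\<i> * \<alpha> + \<i> * r" "\<i> * \<alpha>"] by (simp add: algebra_simps)
  have C: "sfac (q + \<i> * \<alpha>) * sfac (q - \<i> * \<alpha>) - sfac (q + (\<i> * \<alpha> + \<i> * r)) * d1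
      = sfac (\<i> * r) * sfac (2 * \<i> * \<alpha> + \<i> * r)"
    unfolding e3 d1 sfac_prod by simp
  have w0: "sfac w \<noteq> 0" using nz by (simp add: w_def)
  define sp where "sp = sfac (\<i> * \<alpha> + \<i> * y - \<i> * l1 + \<i> * r)"
  define B1 where "B1 = sfac (Q / 2 + \<i> * (l1 + x)) * exp (2 * pi * b * y) * exp (pi * b * (r + \<alpha> - l1 - y))"
  have B': "B1 + c0 * sp = sfac (q + (\<i> * \<alpha> + \<i> * r))" using B by (simp only: B1_def sp_def)
  have A': "sfac (p + m) * sfac (p - m) = sfac (w + p - m) * sfac (w + p + m) + sp * sfac w"
    using A by (simp add: sp_def algebra_simps)
  \<comment> \<open>The relation \<open>A'\<close> splits off a term free of the denominator
    \<open>sfac w\<close>; it cancels against the term that \<open>B'\<close> contributes.\<close>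
  have "sfac (p + m) * sfac (p - m) * c0 * d1 / sfac w
      = c0 * d1 * sfac (w + p - m) * sfac (w + p + m) / sfac w + sp * c0 * d1"
    unfolding A' using w0 by (simp add: field_simps)
  moreover have "B1 * d1 = sfac (q + (\<i> * \<alpha> + \<i> * r)) * d1 - sp * c0 * d1"
    unfolding B'[symmetric] by (simp add: algebra_simps)
  ultimately show ?thesis
    unfolding a1 a2 a3 e1 e2 w_def[symmetric] B1_def[symmetric] C[symmetric] by simp
qed

text \<open>Reduces each shifted kernel to separate polynomial identities between the arguments of
  its factors.\<close>

lemma ker_eqI:
  fixes x y r :: complex and \<alpha> s :: real
  assumes "e = pi * (Q / 2 + \<i> * x + \<i> * l1) * (r + \<alpha> - l1 - y)"
    and "a1 = \<i> * \<alpha> - \<i> * y - \<i> * l1 + \<i> * r - s" "a2 = \<i> * r" "a3 = 2 * \<i> * \<alpha> + \<i> * r"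
    and "d1 = Q / 2 + \<i> * \<alpha> - \<i> * (x + y) + \<i> * r - s"
    and "d2 = Q / 2 + \<i> * \<alpha> - \<i> * l1 - \<i> * l2 + \<i> * r - s"
    and "d3 = Q / 2 + \<i> * \<alpha> - \<i> * l1 + \<i> * l2 + \<i> * r - s"
  shows "ker s x y \<alpha> r = exp e * S0 a1 * S0 a2 * S0 a3 / (S0 d1 * S0 d2 * S0 d3)"
  unfolding ker_def assms ..

section \<open>Shifts of the kernel at real points\<close>

context
  fixes x y r :: complex and \<alpha> k :: real
  assumes real: "Im x = 0" "Im y = 0" and r: "Im r = - k"
begin

definition "N0 = exp (pi * (Q / 2 + \<i> * x + \<i> * l1) * (r + \<alpha> - l1 - y))"
definition "w1 = \<i> * \<alpha> - \<i> * y - \<i> * l1 + \<i> * r"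
definition "v1 = Q / 2 + \<i> * \<alpha> - \<i> * (x + y) + \<i> * r"
definition "v2 = Q / 2 + \<i> * \<alpha> - \<i> * l1 - \<i> * l2 + \<i> * r"
definition "v3 = Q / 2 + \<i> * \<alpha> - \<i> * l1 + \<i> * l2 + \<i> * r"
definition "t1 = Q / 2 + \<i> * \<alpha> - \<i> * (x + y)"
definition "t2 = Q / 2 - \<i> * y + \<i> * l2"
text \<open>The factor by which \<open>N0\<close> is multiplied under
  \<open>y \<mapsto> y - i b\<close>, and divided under \<open>r \<mapsto> r - i b\<close>.\<close>

definition "c0 = exp (\<i> * pi * b * (Q / 2 + \<i> * x + \<i> * l1))"

lemmas args = N0_def w1_def v1_def v2_def v3_def t1_def t2_def

lemma Re_args: "Re w1 = k" "Re (\<i> * r) = k" "Re (2 * \<i> * \<alpha> + \<i> * r) = k" "Re v1 = Q / 2 + k" "Re v2 = Q / 2 + k" "Re v3 = Q / 2 + k"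
  "Re t1 = Q / 2" "Re t2 = Q / 2"
  using real r by (simp_all add: args)

lemma ker_0: "ker 0 x y \<alpha> r = N0 * S0 w1 * S0 (\<i> * r) * S0 (2 * \<i> * \<alpha> + \<i> * r) / (S0 v1 * S0 v2 * S0 v3)"
  unfolding N0_def by (rule ker_eqI) (simp_all add: args)

lemma pre_shift_E:
  "pre (x + \<i> * b) y \<alpha> = sfac t1 * pre x y \<alpha>"
  "pre x (y + \<i> * b) \<alpha> = sfac t1 / sfac t2 * pre x y \<alpha>"
proof -
  have h: "0 < Q / 2" "Q / 2 < 1 / b" using Q_pos b_less_inverse by (auto simp: Qb_def)
  have s: "S0 (t1 + b) = sfac t1 * S0 t1" "S0 (t2 + b) = sfac t2 * S0 t2"
    by (rule S0_add_b; use Re_args h in simp)+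
  have 1: "Q / 2 + \<i> * \<alpha> - \<i> * (x + \<i> * b + y) = t1 + b" "Q / 2 + \<i> * \<alpha> - \<i> * (x + (y + \<i> * b)) = t1 + b"
    "Q / 2 - \<i> * (y + \<i> * b) + \<i> * l2 = t2 + b"
    by (simp_all add: t1_def t2_def algebra_simps)
  show "pre (x + \<i> * b) y \<alpha> = sfac t1 * pre x y \<alpha>"
    "pre x (y + \<i> * b) \<alpha> = sfac t1 / sfac t2 * pre x y \<alpha>"
    unfolding pre_def 1 s t1_def[symmetric] t2_def[symmetric] by (simp_all add: mult.assoc)
qed

lemma ker_shift_E:
  assumes k: "0 < k" "k < Q / 2 - b"
  shows "ker 0 (x + \<i> * b) y \<alpha> r = exp (- (pi * b * (r + \<alpha> - l1 - y))) / sfac v1 * ker 0 x y \<alpha> r"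
    and "ker 0 x (y + \<i> * b) \<alpha> r = exp (- (\<i> * pi * b * (Q / 2 + \<i> * x + \<i> * l1))) * sfac w1 / sfac v1 * ker 0 x y \<alpha> r"
proof -
  have h: "0 < k" "k < 1 / b" "0 < Q / 2 + k" "Q / 2 + k < 1 / b"
    using k Q_pos b_pos b_less_half_Q unfolding inverse_b_eq by linarith+
  have s: "S0 (v1 + b) = sfac v1 * S0 v1" "S0 (w1 + b) = sfac w1 * S0 w1"
    by (rule S0_add_b; use Re_args h in simp)+
  have "ker 0 (x + \<i> * b) y \<alpha> r = exp (pi * (Q / 2 + \<i> * x + \<i> * l1) * (r + \<alpha> - l1 - y) + - (pi * b * (r + \<alpha> - l1 - y))) * S0 w1 * S0 (\<i> * r) * S0 (2 * \<i> * \<alpha> + \<i> * r) / (S0 (v1 + b) * S0 v2 * S0 v3)"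
    by (rule ker_eqI) (simp_all add: args algebra_simps add_divide_distrib diff_divide_distrib)
  then show "ker 0 (x + \<i> * b) y \<alpha> r = exp (- (pi * b * (r + \<alpha> - l1 - y))) / sfac v1 * ker 0 x y \<alpha> r"
    unfolding ker_0 exp_add N0_def[symmetric] s by (simp add: mult_ac)
  have "ker 0 x (y + \<i> * b) \<alpha> r = exp (pi * (Q / 2 + \<i> * x + \<i> * l1) * (r + \<alpha> - l1 - y) + - (\<i> * pi * b * (Q / 2 + \<i> * x + \<i> * l1))) * S0 (w1 + b) * S0 (\<i> * r) * S0 (2 * \<i> * \<alpha> + \<i> * r) / (S0 (v1 + b) * S0 v2 * S0 v3)"
    by (rule ker_eqI) (simp_all add: args algebra_simps add_divide_distrib diff_divide_distrib)
  then show "ker 0 x (y + \<i> * b) \<alpha> r = exp (- (\<i> * pi * b * (Q / 2 + \<i> * x + \<i> * l1))) * sfac w1 / sfac v1 * ker 0 x y \<alpha> r"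
    unfolding ker_0 exp_add N0_def[symmetric] s by (simp add: mult_ac)
qed

text \<open>After division by \<open>pre * ker\<close> and multiplication by
  \<open>sfac v1 / sfac t1\<close> this is \<open>E_relation\<close>. The coefficient of
  \<open>E\<close> in the second tensor factor, \<open>sfac t2\<close>, cancels the denominator
  created by the shift of \<open>y\<close> in \<open>pre\<close>.\<close>

lemma kernel_relation_E:
  assumes k: "0 < k" "k < Q / 2 - b"
  shows "pre x y \<alpha> * ker 0 x y \<alpha> r * sfac (Q / 2 + \<i> * (\<alpha> - (x + y)))
    = sfac (Q / 2 + \<i> * (l1 - x)) * (pre (x + \<i> * b) y \<alpha> * ker 0 (x + \<i> * b) y \<alpha> r)
      + exp (- 2 * pi * b * x) * sfac (Q / 2 + \<i> * (l2 - y)) * (pre x (y + \<i> * b) \<alpha> * ker 0 x (y + \<i> * b) \<alpha> r)"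
proof -
  have h: "0 < Q / 2 + k" "Q / 2 + k < 1 / b" "0 < Q / 2" "Q / 2 < 1 / b"
    using k Q_pos b_pos b_less_half_Q unfolding inverse_b_eq by linarith+
  have nz: "sfac v1 \<noteq> 0" "sfac t2 \<noteq> 0" by (rule sfac_nonzero; use Re_args h in simp)+
  have e: "Q / 2 + \<i> * (\<alpha> - (x + y)) = t1" "Q / 2 + \<i> * (l2 - y) = t2"
    by (simp_all add: t1_def t2_def algebra_simps)
  have rel: "sfac v1 = sfac (Q / 2 + \<i> * (l1 - x)) * exp (- (pi * b * (r + \<alpha> - l1 - y)))
      + exp (- 2 * pi * b * x) * exp (- (\<i> * pi * b * (Q / 2 + \<i> * x + \<i> * l1))) * sfac w1"
    unfolding v1_def w1_def by (rule E_relation[symmetric])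
  have *: "P * A * K = s1 * ((A * P) * (E1 / D * K)) + E0 * B * ((A / B * P) * (E2 * a / D * K))"
    if "D \<noteq> 0" "B \<noteq> 0" "D = s1 * E1 + E0 * E2 * a" for P K A s1 E1 D E0 B E2 a :: complex
  proof -
    have "s1 * ((A * P) * (E1 / D * K)) + E0 * B * ((A / B * P) * (E2 * a / D * K)) = (A * P * K) * (s1 * E1 + E0 * E2 * a) / D"
      using that(1,2) by (simp add: field_simps)
    then show ?thesis unfolding that(3)[symmetric] using that(1) by simp
  qed
  show ?thesis
    unfolding e pre_shift_E ker_shift_E[OF k] mult.assoc[of "pre x y \<alpha>" "ker 0 x y \<alpha> r"] mult.commute[of "ker 0 x y \<alpha> r" "sfac t1"]
    unfolding mult.assoc[of "pre x y \<alpha>" "sfac t1", symmetric]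
    by (rule *[OF nz rel])
qed

lemma pre_shift_F:
  "pre (x - \<i> * b) y \<alpha> = pre x y \<alpha> / sfac (t1 - b)"
  "pre x (y - \<i> * b) \<alpha> = sfac (t2 - b) / sfac (t1 - b) * pre x y \<alpha>"
proof -
  have h: "0 < Q / 2 - b" "Q / 2 - b < 1 / b" "b < Q / 2" "Q / 2 < Q"
    using b_less_half_Q b_pos Q_pos b_less_inverse by (auto simp: Qb_def)
  have s: "S0 t1 = sfac (t1 - b) * S0 (t1 - b)" "S0 t2 = sfac (t2 - b) * S0 (t2 - b)"
    by (rule S0_sub_b; use Re_args h in simp)+
  have nz: "sfac (t1 - b) \<noteq> 0" "sfac (t2 - b) \<noteq> 0" by (rule sfac_nonzero; use Re_args h in simp)+
  have 1: "Q / 2 + \<i> * \<alpha> - \<i> * (x - \<i> * b + y) = t1 - b" "Q / 2 + \<i> * \<alpha> - \<i> * (x + (y - \<i> * b)) = t1 - b"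
    "Q / 2 - \<i> * (y - \<i> * b) + \<i> * l2 = t2 - b"
    by (simp_all add: t1_def t2_def algebra_simps)
  have p: "pre x y \<alpha> = sfac (t1 - b) * S0 (t1 - b) / (sfac (t2 - b) * S0 (t2 - b))
     * (S0 (Q / 2 + \<i> * \<alpha> - \<i> * l1 + \<i> * l2) * sfac (2 * \<i> * \<alpha>) / S0 (2 * \<i> * \<alpha> + b))"
    unfolding pre_def t1_def[symmetric] t2_def[symmetric] s(1)[symmetric] s(2)[symmetric] ..
  have t2: "S0 (t2 - b) = S0 t2 / sfac (t2 - b)" using s(2) nz by simp
  show "pre (x - \<i> * b) y \<alpha> = pre x y \<alpha> / sfac (t1 - b)"
    unfolding p using nz unfolding s(2)[symmetric] pre_def 1 t2_def[symmetric] by simp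
  show "pre x (y - \<i> * b) \<alpha> = sfac (t2 - b) / sfac (t1 - b) * pre x y \<alpha>"
    unfolding p unfolding pre_def 1 using nz by simp
qed

text \<open>The bound \<open>b < k\<close> keeps the lowered argument \<open>w1 - b\<close> to the
  right of the imaginary axis. The last two equations express the values at \<open>r\<close> and
  \<open>r - i b\<close> of the function behind the difference through the same \<open>ker 0\<close>
  at \<open>r\<close>.\<close>

lemma ker_shift_F:
  assumes k: "b < k" "k < Q / 2"
  shows "ker 0 (x - \<i> * b) y \<alpha> r = exp (pi * b * (r + \<alpha> - l1 - y)) * sfac (v1 - b) * ker 0 x y \<alpha> r"
    and "ker 0 x (y - \<i> * b) \<alpha> r = c0 * sfac (v1 - b) / sfac (w1 - b) * ker 0 x y \<alpha> r"
    and "ker b x y \<alpha> r = sfac (v1 - b) * sfac (v2 - b) * sfac (v3 - b) / sfac (w1 - b) * ker 0 x y \<alpha> r"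
    and "ker b x y \<alpha> (r - \<i> * b) = sfac (\<i> * r) * sfac (2 * \<i> * \<alpha> + \<i> * r) / c0 * ker 0 x y \<alpha> r"
proof -
  have h: "0 < k" "k < 1 / b" "0 < k - b" "k - b < 1 / b" "b < k" "k < Q" "0 < Q / 2 + k - b" "Q / 2 + k - b < 1 / b"
      "b < Q / 2 + k" "Q / 2 + k < Q"
    using k Q_pos b_pos b_less_half_Q unfolding inverse_b_eq by linarith+
  have s: "S0 v1 = sfac (v1 - b) * S0 (v1 - b)" "S0 v2 = sfac (v2 - b) * S0 (v2 - b)" "S0 v3 = sfac (v3 - b) * S0 (v3 - b)"
      "S0 w1 = sfac (w1 - b) * S0 (w1 - b)"
    by (rule S0_sub_b; use Re_args h in simp)+
  have nz: "sfac (v1 - b) \<noteq> 0" "sfac (v2 - b) \<noteq> 0" "sfac (v3 - b) \<noteq> 0" "sfac (w1 - b) \<noteq> 0"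
    by (rule sfac_nonzero; use Re_args h in simp)+
  have sa: "S0 (\<i> * r + b) = sfac (\<i> * r) * S0 (\<i> * r)"
    "S0 (2 * \<i> * \<alpha> + \<i> * r + b) = sfac (2 * \<i> * \<alpha> + \<i> * r) * S0 (2 * \<i> * \<alpha> + \<i> * r)"
    by (rule S0_add_b; use Re_args h in simp)+
  have c0nz: "c0 \<noteq> 0" by (simp add: c0_def)
  have "ker 0 (x - \<i> * b) y \<alpha> r = exp (pi * (Q / 2 + \<i> * x + \<i> * l1) * (r + \<alpha> - l1 - y) + pi * b * (r + \<alpha> - l1 - y)) * S0 w1 * S0 (\<i> * r) * S0 (2 * \<i> * \<alpha> + \<i> * r) / (S0 (v1 - b) * S0 v2 * S0 v3)"
    by (rule ker_eqI) (simp_all add: args algebra_simps add_divide_distrib diff_divide_distrib)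
  then show "ker 0 (x - \<i> * b) y \<alpha> r = exp (pi * b * (r + \<alpha> - l1 - y)) * sfac (v1 - b) * ker 0 x y \<alpha> r"
    unfolding ker_0 exp_add N0_def[symmetric] s(1) using nz by (simp add: mult_ac)
  have "ker 0 x (y - \<i> * b) \<alpha> r = exp (pi * (Q / 2 + \<i> * x + \<i> * l1) * (r + \<alpha> - l1 - y) + \<i> * pi * b * (Q / 2 + \<i> * x + \<i> * l1)) * S0 (w1 - b) * S0 (\<i> * r) * S0 (2 * \<i> * \<alpha> + \<i> * r) / (S0 (v1 - b) * S0 v2 * S0 v3)"
    by (rule ker_eqI) (simp_all add: args algebra_simps add_divide_distrib diff_divide_distrib)
  then show "ker 0 x (y - \<i> * b) \<alpha> r = c0 * sfac (v1 - b) / sfac (w1 - b) * ker 0 x y \<alpha> r"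
    unfolding ker_0 exp_add N0_def[symmetric] c0_def[symmetric] s(1,4) using nz by (simp add: mult_ac)
  have "ker b x y \<alpha> r = exp (pi * (Q / 2 + \<i> * x + \<i> * l1) * (r + \<alpha> - l1 - y)) * S0 (w1 - b) * S0 (\<i> * r) * S0 (2 * \<i> * \<alpha> + \<i> * r) / (S0 (v1 - b) * S0 (v2 - b) * S0 (v3 - b))"
    by (rule ker_eqI) (simp_all add: args algebra_simps add_divide_distrib diff_divide_distrib)
  then show "ker b x y \<alpha> r = sfac (v1 - b) * sfac (v2 - b) * sfac (v3 - b) / sfac (w1 - b) * ker 0 x y \<alpha> r"
    unfolding ker_0 N0_def[symmetric] s using nz by (simp add: mult_ac)
  have "ker b x y \<alpha> (r - \<i> * b) = exp (pi * (Q / 2 + \<i> * x + \<i> * l1) * (r + \<alpha> - l1 - y) - \<i> * pi * b * (Q / 2 + \<i> * x + \<i> * l1)) * S0 w1 * S0 (\<i> * r + b) * S0 (2 * \<i> * \<alpha> + \<i> * r + b) / (S0 v1 * S0 v2 * S0 v3)"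
    by (rule ker_eqI) (simp_all add: args algebra_simps add_divide_distrib diff_divide_distrib)
  then show "ker b x y \<alpha> (r - \<i> * b) = sfac (\<i> * r) * sfac (2 * \<i> * \<alpha> + \<i> * r) / c0 * ker 0 x y \<alpha> r"
    unfolding ker_0 exp_diff N0_def[symmetric] c0_def[symmetric] sa using nz c0nz by (simp add: mult_ac)
qed

text \<open>\<open>F_relation\<close> multiplied by \<open>pre * ker / sfac (t1 - b)\<close>. The
  coefficient in front of the difference on the right is free of \<open>r\<close>, so it can be
  taken out of the integral over the line.\<close>

lemma kernel_relation_F:
  assumes k: "b < k" "k < Q / 2"
  shows "pre x y \<alpha> * ker 0 x y \<alpha> r * sfac (Q / 2 + \<i> * (\<alpha> + (x + y)))
    - sfac (Q / 2 + \<i> * (l2 + y)) * (pre x (y - \<i> * b) \<alpha> * ker 0 x (y - \<i> * b) \<alpha> r)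
    - sfac (Q / 2 + \<i> * (l1 + x)) * exp (2 * pi * b * y) * (pre (x - \<i> * b) y \<alpha> * ker 0 (x - \<i> * b) y \<alpha> r)
    = c0 * pre x y \<alpha> / sfac (t1 - b) * (ker b x y \<alpha> (r - \<i> * b) - ker b x y \<alpha> r)"
proof -
  have h: "0 < k - b" "k - b < 1 / b" "0 < Q / 2 - b" "Q / 2 - b < 1 / b"
    using k Q_pos b_pos b_less_half_Q unfolding inverse_b_eq by linarith+
  have nz: "sfac (w1 - b) \<noteq> 0" "sfac (t1 - b) \<noteq> 0" by (rule sfac_nonzero; use Re_args h in simp)+
  have c0nz: "c0 \<noteq> 0" by (simp add: c0_def)
  have e: "Q / 2 + \<i> * (\<alpha> + (x + y)) = Q / 2 + \<i> * \<alpha> + \<i> * (x + y)" by (simp add: algebra_simps)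
  have rel: "sfac (Q / 2 + \<i> * \<alpha> + \<i> * (x + y)) * sfac (t1 - b)
      - sfac (Q / 2 + \<i> * (l2 + y)) * sfac (t2 - b) * c0 * sfac (v1 - b) / sfac (w1 - b)
      - sfac (Q / 2 + \<i> * (l1 + x)) * exp (2 * pi * b * y) * exp (pi * b * (r + \<alpha> - l1 - y)) * sfac (v1 - b)
    = sfac (\<i> * r) * sfac (2 * \<i> * \<alpha> + \<i> * r)
      - c0 * sfac (v1 - b) * sfac (v2 - b) * sfac (v3 - b) / sfac (w1 - b)"
    using F_relation[of \<alpha> y r x] nz(1) unfolding args c0_def by simp
  have *: "P * K * q - u2 * ((B / A * P) * (c * v / w * K)) - u1 * e * ((P / A) * (E * v * K)) = c * P / A * (ra / c * K - v * v2 * v3 / w * K)"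
    if "A \<noteq> 0" "c \<noteq> 0" "w \<noteq> 0" "q * A - u2 * B * c * v / w - u1 * e * E * v = ra - c * v * v2 * v3 / w"
    for P K q u2 B A c v w u1 e E ra v2 v3 :: complex
  proof -
    have "P * K * q - u2 * ((B / A * P) * (c * v / w * K)) - u1 * e * ((P / A) * (E * v * K))
        = P * K / A * (q * A - u2 * B * c * v / w - u1 * e * E * v)"
      using that(1,3) by (simp add: field_simps)
    also have "\<dots> = c * P / A * (ra / c * K - v * v2 * v3 / w * K)"
      unfolding that(4) using that(1-3) by (simp add: field_simps)
    finally show ?thesis .
  qed
  show ?thesis
    unfolding e pre_shift_F ker_shift_F[OF k] by (rule *[OF nz(2) c0nz nz(1) rel])
qed

end

end

context cg_kernel_setup
begin


section \<open>Test functions and intertwining relations\<close>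

lemma decaying_mult:
  assumes g: "decaying g" and m: "continuous_on UNIV (\<lambda>p. m (fst p) (snd p))" "\<And>\<alpha>. m \<alpha> holomorphic_on UNIV"
    and growth: "\<And>R. \<exists>C N. \<forall>\<alpha>\<ge>0. \<forall>z. norm z \<le> R \<longrightarrow> norm (m \<alpha> z) \<le> C * exp (N * \<alpha>)"
  shows "decaying (\<lambda>\<alpha> z. m \<alpha> z * g \<alpha> z)"
  unfolding decaying_def
proof (intro conjI allI)
  show "continuous_on UNIV (\<lambda>p. m (fst p) (snd p) * g (fst p) (snd p))"
    using g m(1) by (auto simp: decaying_def intro!: continuous_intros)
  show "(\<lambda>z. m \<alpha> z * g \<alpha> z) holomorphic_on UNIV" for \<alpha>
    using g m(2) by (auto simp: decaying_def intro!: holomorphic_intros)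
  fix M R :: real
  obtain C N where C: "\<And>\<alpha> z. 0 \<le> \<alpha> \<Longrightarrow> norm z \<le> R \<Longrightarrow> norm (m \<alpha> z) \<le> C * exp (N * \<alpha>)"
    using growth[of R] by blast
  have "\<exists>C'. \<forall>\<alpha>\<ge>0. \<forall>z. norm z \<le> R \<longrightarrow> norm (g \<alpha> z) \<le> C' * exp (- (M + N) * \<alpha>)"
    using g unfolding decaying_def by blast
  then obtain C' where C': "\<And>\<alpha> z. 0 \<le> \<alpha> \<Longrightarrow> norm z \<le> R \<Longrightarrow> norm (g \<alpha> z) \<le> C' * exp (- (M + N) * \<alpha>)"
    by blast
  show "\<exists>C. \<forall>\<alpha>\<ge>0. \<forall>z. norm z \<le> R \<longrightarrow> norm (m \<alpha> z * g \<alpha> z) \<le> C * exp (- M * \<alpha>)"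
  proof (intro exI[of _ "C * C'"] allI impI)
    fix \<alpha> :: real and z :: complex assume a: "0 \<le> \<alpha>" "norm z \<le> R"
    have "norm (m \<alpha> z * g \<alpha> z) \<le> (C * exp (N * \<alpha>)) * (C' * exp (- (M + N) * \<alpha>))"
      unfolding norm_mult
      by (rule mult_mono[OF C[OF a] C'[OF a]]) (use order.trans[OF norm_ge_zero C[OF a]] in auto)
    also have "\<dots> = C * C' * (exp (N * \<alpha>) * exp (- (M + N) * \<alpha>))" by simp
    also have "exp (N * \<alpha>) * exp (- (M + N) * \<alpha>) = exp (- M * \<alpha>)"
      unfolding exp_add[symmetric] by (simp add: algebra_simps)
    finally show "norm (m \<alpha> z * g \<alpha> z) \<le> C * C' * exp (- M * \<alpha>)" .
  qed
qed

lemma decaying_shift: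
  assumes g: "decaying g"
  shows "decaying (\<lambda>\<alpha> z. g \<alpha> (z + w))"
  unfolding decaying_def
proof (intro conjI allI)
  have "continuous_on UNIV (\<lambda>p::real \<times> complex. g (fst (fst p, snd p + w)) (snd (fst p, snd p + w)))"
    using g unfolding decaying_def
    by (intro continuous_on_compose2[of UNIV "\<lambda>p. g (fst p) (snd p)" UNIV "\<lambda>p. (fst p, snd p + w)"])
       (auto intro!: continuous_intros)
  then show "continuous_on UNIV (\<lambda>p. g (fst p) (snd p + w))" by simp
  show "(\<lambda>z. g \<alpha> (z + w)) holomorphic_on UNIV" for \<alpha>
  proof -
    have "(\<lambda>z::complex. z + w) holomorphic_on UNIV" by (intro holomorphic_intros)
    moreover have "g \<alpha> holomorphic_on UNIV" using g by (simp add: decaying_def)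
    ultimately show ?thesis
      using holomorphic_on_compose_gen[of "\<lambda>z::complex. z + w" UNIV "g \<alpha>" UNIV] by (simp add: o_def)
  qed
  fix M R :: real
  have "\<exists>C. \<forall>\<alpha>\<ge>0. \<forall>z. norm z \<le> R + norm w \<longrightarrow> norm (g \<alpha> z) \<le> C * exp (- M * \<alpha>)"
    using g unfolding decaying_def by blast
  then obtain C where C: "\<And>\<alpha> z. 0 \<le> \<alpha> \<Longrightarrow> norm z \<le> R + norm w \<Longrightarrow> norm (g \<alpha> z) \<le> C * exp (- M * \<alpha>)"
    by blast
  show "\<exists>C. \<forall>\<alpha>\<ge>0. \<forall>z. norm z \<le> R \<longrightarrow> norm (g \<alpha> (z + w)) \<le> C * exp (- M * \<alpha>)"
  proof (intro exI[of _ C] allI impI C)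
    fix z :: complex assume "norm z \<le> R"
    then show "norm (z + w) \<le> R + norm w" using norm_triangle_ineq[of z w] by linarith
  qed
qed

lemma decaying_sum:
  assumes "\<And>j. j < n \<Longrightarrow> decaying (G j)"
  shows "decaying (\<lambda>\<alpha> z. \<Sum>j<(n::nat). G j \<alpha> z)"
  unfolding decaying_def
proof (intro conjI allI)
  show "continuous_on UNIV (\<lambda>p. \<Sum>j<n. G j (fst p) (snd p))"
    using assms by (intro continuous_on_sum) (auto simp: decaying_def)
  show "(\<lambda>z. \<Sum>j<n. G j \<alpha> z) holomorphic_on UNIV" for \<alpha>
    using assms by (intro holomorphic_on_sum) (auto simp: decaying_def)
  fix M R :: real
  have "\<forall>j\<in>{..<n}. \<exists>C. \<forall>\<alpha>\<ge>0. \<forall>z. norm z \<le> R \<longrightarrow> norm (G j \<alpha> z) \<le> C * exp (- M * \<alpha>)"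
    using assms unfolding decaying_def by blast
  then obtain C where C: "\<And>j \<alpha> z. j < n \<Longrightarrow> 0 \<le> \<alpha> \<Longrightarrow> norm z \<le> R \<Longrightarrow> norm (G j \<alpha> z) \<le> C j * exp (- M * \<alpha>)"
    by (subst (asm) bchoice_iff) auto
  show "\<exists>C. \<forall>\<alpha>\<ge>0. \<forall>z. norm z \<le> R \<longrightarrow> norm (\<Sum>j<n. G j \<alpha> z) \<le> C * exp (- M * \<alpha>)"
  proof (intro exI[of _ "\<Sum>j<n. C j"] allI impI)
    fix \<alpha> :: real and z :: complex assume "0 \<le> \<alpha>" "norm z \<le> R"
    then have "norm (\<Sum>j<n. G j \<alpha> z) \<le> (\<Sum>j<n. C j * exp (- M * \<alpha>))"
      by (intro order.trans[OF norm_sum] sum_mono C) auto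
    then show "norm (\<Sum>j<n. G j \<alpha> z) \<le> (\<Sum>j<n. C j) * exp (- M * \<alpha>)" by (simp add: sum_distrib_right)
  qed
qed

lemma norm_poly_le_exp:
  fixes P :: "complex poly"
  obtains C N where "0 \<le> C" "\<And>t::real. 0 \<le> t \<Longrightarrow> norm (poly P (of_real t)) \<le> C * exp (N * t)"
proof -
  have "\<exists>C N. 0 \<le> C \<and> (\<forall>t::real. 0 \<le> t \<longrightarrow> norm (poly P (of_real t)) \<le> C * exp (real N * t))"
  proof (induction P)
    case 0
    show ?case by (intro exI[of _ 0]) simp
  next
    case (pCons a P)
    then obtain C N where C: "0 \<le> C" "\<And>t::real. 0 \<le> t \<Longrightarrow> norm (poly P (of_real t)) \<le> C * exp (real N * t)"
      by blast
    show ?case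
    proof (intro exI[of _ "norm a + C"] exI[of _ "Suc N"] conjI allI impI)
      fix t :: real assume t: "0 \<le> t"
      have te: "t \<le> exp t" using exp_ge_add_one_self[of t] by linarith
      have "norm (poly (pCons a P) (of_real t)) \<le> norm a + t * norm (poly P (of_real t))"
        using norm_triangle_ineq[of a "of_real t * poly P (of_real t)"] t by (simp add: norm_mult)
      also have "\<dots> \<le> norm a * exp (real (Suc N) * t) + exp t * (C * exp (real N * t))"
        using t te C by (intro add_mono mult_mono) (auto simp: mult_le_cancel_left1)
      also have "exp t * (C * exp (real N * t)) = C * exp (real (Suc N) * t)"
      proof -
        have "exp t * exp (real N * t) = exp (real (Suc N) * t)"
          unfolding exp_add[symmetric] by (simp add: algebra_simps)
        then show ?thesis by (simp only: mult.left_commute)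
      qed
      finally show "norm (poly (pCons a P) (of_real t)) \<le> (norm a + C) * exp (real (Suc N) * t)"
        by (simp add: distrib_right)
    qed (use C in auto)
  qed
  then show ?thesis using that by blast
qed

lemma gauss_poly_holomorphic: "h \<in> gauss_poly \<Longrightarrow> h holomorphic_on UNIV"
  unfolding gauss_poly_def by (auto intro!: holomorphic_intros)

lemma gauss_poly_decay:
  assumes "h \<in> gauss_poly"
  obtains C where "0 \<le> C" "\<And>t::real. 0 \<le> t \<Longrightarrow> norm (h (of_real t)) \<le> C * exp (- M * t)"
proof -
  obtain r s P where r: "0 < r" and h: "h = (\<lambda>w::complex. exp (- of_real r * w^2 + s * w) * poly P w)"
    using assms unfolding gauss_poly_def by blast
  obtain C N where C: "0 \<le> C" "\<And>t::real. 0 \<le> t \<Longrightarrow> norm (poly P (of_real t)) \<le> C * exp (N * t)"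
    using norm_poly_le_exp[of P] by blast
  \<comment> \<open>All linear exponents, including the requested rate \<open>M\<close>, are
    collected in \<open>K\<close>; the maximum of \<open>- r * t^2 + K * t\<close> is
    \<open>K^2 / (4 * r)\<close>.\<close>
  define K where "K = Re s + N + M"
  show ?thesis
  proof (rule that[of "C * exp (K\<^sup>2 / (4 * r))"])
    fix t :: real assume t: "0 \<le> t"
    have "norm (h (of_real t)) \<le> exp (- r * t\<^sup>2 + Re s * t) * (C * exp (N * t))"
      unfolding h norm_mult using C(2)[OF t]
      by (intro mult_mono) (auto simp: norm_exp_eq_Re power2_eq_square)
    also have "\<dots> = C * exp (- r * t\<^sup>2 + K * t + - M * t)"
      unfolding K_def by (simp add: exp_add[symmetric] algebra_simps)
    also have "\<dots> \<le> C * exp (K\<^sup>2 / (4 * r) + - M * t)"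
    proof -
      have "0 \<le> (2 * r * t - K)\<^sup>2" by simp
      then have "- r * t\<^sup>2 + K * t \<le> K\<^sup>2 / (4 * r)"
        using r by (simp add: field_simps power2_eq_square)
      then show ?thesis using C(1) by (intro mult_left_mono) auto
    qed
    finally show "norm (h (of_real t)) \<le> C * exp (K\<^sup>2 / (4 * r)) * exp (- M * t)"
      by (simp only: exp_add mult.assoc)
  qed (use C in auto)
qed

lemma decaying_gauss_poly_product:
  assumes h: "h1 \<in> gauss_poly" "h2 \<in> gauss_poly"
  shows "decaying (\<lambda>\<alpha> z. a * h1 (of_real \<alpha>) * h2 z)"
  unfolding decaying_def
proof (intro conjI allI)
  have c1: "continuous_on UNIV h1" and c2: "continuous_on UNIV h2"
    using h by (auto intro: holomorphic_on_imp_continuous_on gauss_poly_holomorphic)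
  show "continuous_on UNIV (\<lambda>p. a * h1 (of_real (fst p)) * h2 (snd p))"
    by (intro continuous_intros continuous_on_compose2[OF c1] continuous_on_compose2[OF c2]) auto
  show "(\<lambda>z. a * h1 (of_real \<alpha>) * h2 z) holomorphic_on UNIV" for \<alpha>
    using gauss_poly_holomorphic[OF h(2)] by (intro holomorphic_intros)
  fix M R :: real
  obtain C where C: "0 \<le> C" "\<And>t::real. 0 \<le> t \<Longrightarrow> norm (h1 (of_real t)) \<le> C * exp (- M * t)"
    using gauss_poly_decay[OF h(1)] by blast
  have "bounded (h2 ` cball 0 R)"
    by (intro compact_imp_bounded compact_continuous_image continuous_on_subset[OF c2]) auto
  then obtain B where B: "\<And>z. norm z \<le> R \<Longrightarrow> norm (h2 z) \<le> B"
    unfolding bounded_iff by (metis imageI mem_cball_0)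
  show "\<exists>C. \<forall>\<alpha>\<ge>0. \<forall>z. norm z \<le> R \<longrightarrow> norm (a * h1 (of_real \<alpha>) * h2 z) \<le> C * exp (- M * \<alpha>)"
  proof (intro exI[of _ "norm a * C * B"] allI impI)
    fix \<alpha> :: real and z :: complex assume x: "0 \<le> \<alpha>" "norm z \<le> R"
    have "norm (a * h1 (of_real \<alpha>) * h2 z) \<le> norm a * (C * exp (- M * \<alpha>)) * B"
      unfolding norm_mult using C x B by (intro mult_mono C(2) B) auto
    then show "norm (a * h1 (of_real \<alpha>) * h2 z) \<le> norm a * C * B * exp (- M * \<alpha>)" by (simp add: mult_ac)
  qed
qed

lemma test_function_decaying:
  assumes "test_function f"
  obtains g where "decaying g" "\<And>\<alpha> z. f \<alpha> z = g \<alpha> (of_real z)"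
proof -
  obtain n a g1 g2 where g: "\<forall>j<n. g1 j \<in> gauss_poly \<and> g2 j \<in> gauss_poly"
    and f: "f = (\<lambda>\<alpha> z. \<Sum>j<(n::nat). a j * g1 j (of_real \<alpha>) * g2 j (of_real z))"
    using assms unfolding test_function_def by blast
  have "decaying (\<lambda>\<alpha> z. \<Sum>j<n. a j * g1 j (of_real \<alpha>) * g2 j z)"
    using g by (intro decaying_sum decaying_gauss_poly_product) auto
  then show ?thesis using that f by blast
qed

end

section \<open>Uniqueness of the continuation that defines the shift operators\<close>

lemma convex_shift_strip: "convex (shift_strip a)"
proof -
  have "shift_strip a = Im -` closed_segment 0 a" by (auto simp: shift_strip_def)
  moreover have "linear Im" by (rule bounded_linear.linear[OF bounded_linear_Im])
  ultimately show ?thesis by (simp add: convex_linear_vimage)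
qed

text \<open>The identity theorem, with the real line as the set with a limit point. The
  neighbourhoods on which the two continuations are holomorphic may meet in a disconnected set, so
  the component that contains the strip is used.\<close>

lemma continues_unique:
  assumes "continues a f \<phi>" "continues a f \<psi>" "z \<in> shift_strip a"
  shows "\<phi> z = \<psi> z"
proof -
  obtain U where U: "open U" "shift_strip a \<subseteq> U" "\<phi> holomorphic_on U"
    using assms(1) unfolding continues_def analytic_on_holomorphic by blast
  obtain V where V: "open V" "shift_strip a \<subseteq> V" "\<psi> holomorphic_on V"
    using assms(2) unfolding continues_def analytic_on_holomorphic by blast
  have 0: "0 \<in> shift_strip a" by (simp add: shift_strip_def)
  define W where "W = connected_component_set (U \<inter> V) 0"
  have W: "open W" "connected W" "W \<subseteq> U \<inter> V"
    using U V connected_component_subset[of "U \<inter> V" 0]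
    by (simp_all add: W_def open_connected_component open_Int)
  have sW: "shift_strip a \<subseteq> W"
    unfolding W_def using U V 0 by (intro connected_component_maximal convex_connected convex_shift_strip) auto
  have "(\<lambda>z. \<phi> z - \<psi> z) z = 0"
  proof (rule analytic_continuation[of "\<lambda>z. \<phi> z - \<psi> z" W "range complex_of_real" 0])
    show "(\<lambda>z. \<phi> z - \<psi> z) holomorphic_on W"
      using U V W by (intro holomorphic_intros) (auto intro: holomorphic_on_subset)
    show "range complex_of_real \<subseteq> W"
      using sW by (auto simp: shift_strip_def)
    show "(0::complex) islimpt range of_real"
      unfolding islimpt_approachable
    proof (intro allI impI)
      fix e :: real assume "0 < e"
      then show "\<exists>x'\<in>range complex_of_real. x' \<noteq> 0 \<and> dist x' 0 < e"
        by (intro bexI[OF _ rangeI[of complex_of_real "e / 2"]]) auto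
    qed
    show "0 \<in> W" "z \<in> W" using 0 sW assms(3) by auto
    show "\<phi> z - \<psi> z = 0" if "z \<in> range of_real" for z
      using assms(1,2) that by (auto simp: continues_def)
  qed (use W in auto)
  then show ?thesis by simp
qed

lemma shift_eq:
  assumes "continues a f \<phi>"
  shows "shift a f x = \<phi> (Complex x a)"
proof -
  have "\<exists>\<phi>. continues a f \<phi>" using assms by blast
  then have "continues a f (SOME \<phi>. continues a f \<phi>)" by (rule someI_ex)
  then show ?thesis
    unfolding shift_def by (rule continues_unique[OF _ assms]) (simp add: shift_strip_def)
qed

lemma shiftable_I: "continues a f \<phi> \<Longrightarrow> shiftable a f"
  by (auto simp: shiftable_def)

context cg_kernel_setup
begin

lemma norm_sfac_le: "norm (sfac w) \<le> 2 * exp (pi * b * norm w)"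
proof -
  have "norm (sfac w) = norm (exp (pi * \<i> * b * w) - exp (- (pi * \<i> * b * w)))"
    unfolding sfac_eq norm_mult by simp
  also have "\<dots> \<le> norm (exp (pi * \<i> * b * w)) + norm (exp (- (pi * \<i> * b * w)))"
    by (rule norm_triangle_ineq4)
  also have "\<dots> \<le> exp (norm (pi * \<i> * b * w)) + exp (norm (- (pi * \<i> * b * w)))"
    by (intro add_mono norm_exp)
  also have "\<dots> = 2 * exp (pi * b * norm w)" using b_pos by (simp add: norm_mult)
  finally show ?thesis .
qed

text \<open>The shape of both actions: \<open>t = - 1\<close> and \<open>w = i b\<close> give
  \<open>E\<close>, while \<open>t = 1\<close> and \<open>w = - i b\<close> give
  \<open>F\<close>.\<close>

lemma decaying_sfac:
  assumes g: "decaying g" and t: "norm t = 1"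
  shows "decaying (\<lambda>\<alpha> z. c * sfac (Q / 2 + \<i> * (of_real \<alpha> + t * z)) * g \<alpha> (z + w))"
proof (rule decaying_mult[OF decaying_shift[OF g]])
  show "continuous_on UNIV (\<lambda>p. c * sfac (Q / 2 + \<i> * (of_real (fst p) + t * snd p)))"
    unfolding sfac_def by (intro continuous_intros)
  show "(\<lambda>z. c * sfac (Q / 2 + \<i> * (of_real \<alpha> + t * z))) holomorphic_on UNIV" for \<alpha>
    unfolding sfac_def by (intro holomorphic_intros)
  fix R :: real
  show "\<exists>C N. \<forall>\<alpha>\<ge>0. \<forall>z. norm z \<le> R \<longrightarrow> norm (c * sfac (Q / 2 + \<i> * (of_real \<alpha> + t * z))) \<le> C * exp (N * \<alpha>)"
  proof (rule exI[of _ "norm c * (2 * exp (pi * b * (Q / 2 + R)))"], rule exI[of _ "pi * b"], intro allI impI)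
    fix \<alpha> :: real and z :: complex assume a: "0 \<le> \<alpha>" "norm z \<le> R"
    have "norm (Q / 2 + \<i> * (of_real \<alpha> + t * z)) \<le> norm (complex_of_real (Q / 2)) + norm (\<i> * (of_real \<alpha> + t * z))"
      by (rule norm_triangle_ineq)
    also have "\<dots> \<le> Q / 2 + (\<alpha> + R)"
    proof -
      have "norm (complex_of_real \<alpha> + t * z) \<le> norm (complex_of_real \<alpha>) + norm (t * z)" by (rule norm_triangle_ineq)
      also have "\<dots> \<le> \<alpha> + R" using a t by (simp add: norm_mult)
      finally show ?thesis using Q_pos by (simp add: norm_mult del: of_real_divide)
    qed
    finally have n: "norm (Q / 2 + \<i> * (of_real \<alpha> + t * z)) \<le> Q / 2 + R + \<alpha>" by simp
    have "norm (sfac (Q / 2 + \<i> * (of_real \<alpha> + t * z))) \<le> 2 * exp (pi * b * norm (Q / 2 + \<i> * (of_real \<alpha> + t * z)))"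
      by (rule norm_sfac_le)
    also have "\<dots> \<le> 2 * exp (pi * b * (Q / 2 + R + \<alpha>))"
      using n b_pos by (intro mult_left_mono iffD2[OF exp_le_cancel_iff]) auto
    also have "\<dots> = 2 * exp (pi * b * (Q / 2 + R)) * exp (pi * b * \<alpha>)"
      by (simp only: distrib_left exp_add mult.assoc)
    finally have "norm c * norm (sfac (Q / 2 + \<i> * (of_real \<alpha> + t * z))) \<le> norm c * (2 * exp (pi * b * (Q / 2 + R)) * exp (pi * b * \<alpha>))"
      by (rule mult_left_mono) simp
    then show "norm (c * sfac (Q / 2 + \<i> * (of_real \<alpha> + t * z))) \<le> norm c * (2 * exp (pi * b * (Q / 2 + R))) * exp (pi * b * \<alpha>)"
      by (simp only: norm_mult mult.assoc)
  qed
qed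

lemma decaying_exp:
  assumes g: "decaying g"
  shows "decaying (\<lambda>\<alpha> z. exp (of_real c * z) * g \<alpha> z)"
proof (rule decaying_mult[OF g])
  show "continuous_on UNIV (\<lambda>p::real \<times> complex. exp (of_real c * snd p))" by (intro continuous_intros)
  show "(\<lambda>z::complex. exp (of_real c * z)) holomorphic_on UNIV" by (intro holomorphic_intros)
  fix R :: real
  show "\<exists>C N. \<forall>\<alpha>\<ge>0. \<forall>z. norm z \<le> R \<longrightarrow> norm (exp (of_real c * z) :: complex) \<le> C * exp (N * \<alpha>)"
  proof (rule exI[of _ "exp (\<bar>c\<bar> * R)"], rule exI[of _ 0], intro allI impI)
    fix \<alpha> :: real and z :: complex assume "norm z \<le> R"
    then have "norm (of_real c * z) \<le> \<bar>c\<bar> * R" by (simp add: norm_mult mult_left_mono)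
    then show "norm (exp (of_real c * z)) \<le> exp (\<bar>c\<bar> * R) * exp (0 * \<alpha>)"
      using norm_exp[of "of_real c * z"] by (auto intro: order.trans)
  qed
qed

text \<open>
  On the lines \<open>Re (i r) = 4 gap\<close> for \<open>E\<close> and \<open>Re (i r) = b + 4 gap\<close> for \<open>F\<close>, shifting \<open>x\<close>
  or \<open>y\<close> by \<open>i b\<close> respectively \<open>- i b\<close> keeps all arguments of \<open>S0\<close> inside the strip
  \<open>0 < Re < Q\<close>, with \<open>gap\<close> to spare.
\<close>

definition "gap = (Q / 2 - b) / 8"
text \<open>Differentiation under the integral starts from conditions with margin
  \<open>2 * margin\<close>, which fits into \<open>gap\<close>; the estimate of \<open>pre\<close>
  asks in addition for a margin of at most \<open>b\<close>.\<close>

definition "margin = min gap b / 2"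

lemma gap_margin: "0 < gap" "0 < margin" "2 * margin \<le> gap" "margin \<le> b" "Q / 2 = b + 8 * gap" "Q = 2 * b + 16 * gap"
proof -
  show "0 < gap" using b_less_half_Q by (simp add: gap_def)
  then show "0 < margin" using b_pos by (simp add: margin_def)
  show "2 * margin \<le> gap" "margin \<le> b" using b_pos by (auto simp: margin_def min_def)
  show "Q / 2 = b + 8 * gap" "Q = 2 * b + 16 * gap" by (simp_all add: gap_def field_simps)
qed

lemma ok_E:
  assumes "- gap < Im x" "Im x < b + gap" "- gap < Im y" "Im y < b + gap" "- gap < Im x + Im y" "Im x + Im y < b + gap"
  shows "ker_ok (2 * margin) 0 (4 * gap) x y" "pre_ok (2 * margin) x y"
  unfolding ker_ok_def pre_ok_def using assms gap_margin b_pos by (intro conjI; linarith)+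

lemma ok_F:
  assumes "- b - gap < Im x" "Im x < gap" "- b - gap < Im y" "Im y < gap" "- b - gap < Im x + Im y" "Im x + Im y < gap"
  shows "ker_ok (2 * margin) 0 (b + 4 * gap) x y" "pre_ok (2 * margin) x y"
  unfolding ker_ok_def pre_ok_def using assms gap_margin b_pos by (intro conjI; linarith)+

section \<open>Analyticity of the transform in \<open>x\<close> and \<open>y\<close>, and its
  integrated relations\<close>

lemma integrable_integrand:
  assumes "decaying g" "ker_ok (2 * margin) 0 k x y" "pre_ok (2 * margin) x y"
  shows "integrable lborel (integrand k g x y)"
  using integrand_integrable[OF gap_margin(2,4) _ _ assms(1)] ok_perturb[OF gap_margin(2), of x x y y] assms gap_margin(2) by simp

text \<open>The open strip between \<open>lo\<close> and \<open>hi\<close> is taken slightly wider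
  than the closed strip of a shift, so that analyticity includes the boundary lines.\<close>

lemma Phi_analytic:
  assumes g: "decaying g"
    and ff: "f holomorphic_on UNIV" "f' holomorphic_on UNIV"
    and near: "\<And>z w. norm (f z - f w) + norm (f' z - f' w) \<le> norm (z - w)"
    and ok: "\<And>z. lo < Im z \<Longrightarrow> Im z < hi \<Longrightarrow> ker_ok (2 * margin) 0 k (f z) (f' z) \<and> pre_ok (2 * margin) (f z) (f' z)"
    and S: "\<And>z. z \<in> S \<Longrightarrow> lo < Im z \<and> Im z < hi"
  shows "(\<lambda>z. Phi k g (f z) (f' z)) analytic_on S"
proof -
  have "(\<lambda>z. Phi k g (f z) (f' z)) holomorphic_on {z. lo < Im z \<and> Im z < hi}"
    unfolding holomorphic_on_def
  proof
    fix z assume "z \<in> {z. lo < Im z \<and> Im z < hi}"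
    then have "(\<lambda>z. Phi k g (f z) (f' z)) field_differentiable at z"
      using ok[of z] near by (intro Phi_differentiable[OF gap_margin(2,4) g ff]) (auto intro: order.trans[OF near])
    then show "(\<lambda>z. Phi k g (f z) (f' z)) field_differentiable at z within {z. lo < Im z \<and> Im z < hi}"
      by (rule field_differentiable_at_within)
  qed
  then show ?thesis
    unfolding analytic_on_holomorphic using open_Im_strip S by blast
qed

lemma shift_strip_iff: "z \<in> shift_strip a \<longleftrightarrow> min 0 a \<le> Im z \<and> Im z \<le> max 0 a"
  by (auto simp: shift_strip_def closed_segment_eq_real_ivl)

lemma Phi_continues:
  fixes x y :: real
  assumes g: "decaying g"
  shows "continues b (\<lambda>x. Phi (4 * gap) g x y) (\<lambda>z. Phi (4 * gap) g z y)"
    and "continues b (\<lambda>y. Phi (4 * gap) g x y) (\<lambda>z. Phi (4 * gap) g x z)"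
    and "continues (- b) (\<lambda>x. Phi (b + 4 * gap) g x y) (\<lambda>z. Phi (b + 4 * gap) g z y)"
    and "continues (- b) (\<lambda>y. Phi (b + 4 * gap) g x y) (\<lambda>z. Phi (b + 4 * gap) g x z)"
proof -
  have E1: "(\<lambda>z. Phi (4 * gap) g z y) analytic_on shift_strip b"
    by (rule Phi_analytic[OF g, where lo="- gap" and hi="b + gap"])
       (use gap_margin b_pos in \<open>auto intro!: holomorphic_intros ok_E simp: shift_strip_iff\<close>)
  have E2: "(\<lambda>z. Phi (4 * gap) g x z) analytic_on shift_strip b"
    by (rule Phi_analytic[OF g, where lo="- gap" and hi="b + gap"])
       (use gap_margin b_pos in \<open>auto intro!: holomorphic_intros ok_E simp: shift_strip_iff\<close>)
  have F1: "(\<lambda>z. Phi (b + 4 * gap) g z y) analytic_on shift_strip (- b)"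
    by (rule Phi_analytic[OF g, where lo="- b - gap" and hi="gap"])
       (use gap_margin b_pos in \<open>auto intro!: holomorphic_intros ok_F simp: shift_strip_iff\<close>)
  have F2: "(\<lambda>z. Phi (b + 4 * gap) g x z) analytic_on shift_strip (- b)"
    by (rule Phi_analytic[OF g, where lo="- b - gap" and hi="gap"])
       (use gap_margin b_pos in \<open>auto intro!: holomorphic_intros ok_F simp: shift_strip_iff\<close>)
  show "continues b (\<lambda>x. Phi (4 * gap) g x y) (\<lambda>z. Phi (4 * gap) g z y)"
    "continues b (\<lambda>y. Phi (4 * gap) g x y) (\<lambda>z. Phi (4 * gap) g x z)"
    "continues (- b) (\<lambda>x. Phi (b + 4 * gap) g x y) (\<lambda>z. Phi (b + 4 * gap) g z y)"
    "continues (- b) (\<lambda>y. Phi (b + 4 * gap) g x y) (\<lambda>z. Phi (b + 4 * gap) g x z)"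
    using E1 E2 F1 F2 by (simp_all add: continues_def)
qed

lemma Phi_relation_E:
  fixes x y :: real
  assumes g: "decaying g"
  shows "Phi (4 * gap) (\<lambda>\<alpha> z. c * sfac (Q / 2 + \<i> * (of_real \<alpha> + (- 1) * z)) * g \<alpha> (z + \<i> * b)) x y
    = c * sfac (Q / 2 + \<i> * (l1 - x)) * Phi (4 * gap) g (x + \<i> * b) y
      + exp (- 2 * pi * b * x) * (c * sfac (Q / 2 + \<i> * (l2 - y)) * Phi (4 * gap) g x (y + \<i> * b))"
proof -
  let ?k = "4 * gap"
  have k: "0 < ?k" "?k < Q / 2 - b" using gap_margin by linarith+
  have i1: "integrable lborel (integrand ?k g (x + \<i> * b) y)"
    by (rule integrable_integrand[OF g ok_E]) (use gap_margin b_pos in auto)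
  have i2: "integrable lborel (integrand ?k g x (y + \<i> * b))"
    by (rule integrable_integrand[OF g ok_E]) (use gap_margin b_pos in auto)
  have eq: "integrand ?k (\<lambda>\<alpha> z. c * sfac (Q / 2 + \<i> * (of_real \<alpha> + (- 1) * z)) * g \<alpha> (z + \<i> * b)) x y p
    = c * sfac (Q / 2 + \<i> * (l1 - x)) * integrand ?k g (x + \<i> * b) y p
      + exp (- 2 * pi * b * x) * (c * sfac (Q / 2 + \<i> * (l2 - y)) * integrand ?k g x (y + \<i> * b) p)" for p
  proof -
    obtain \<alpha> u where p: "p = (\<alpha>, u)" by force
    have rel: "pre x y \<alpha> * ker 0 x y \<alpha> (Complex u (- ?k)) * sfac (Q / 2 + \<i> * (\<alpha> - (complex_of_real x + y)))
    = sfac (Q / 2 + \<i> * (l1 - complex_of_real x)) * (pre (x + \<i> * b) y \<alpha> * ker 0 (x + \<i> * b) y \<alpha> (Complex u (- ?k)))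
      + exp (- 2 * pi * b * complex_of_real x) * sfac (Q / 2 + \<i> * (l2 - complex_of_real y)) * (pre x (y + \<i> * b) \<alpha> * ker 0 x (y + \<i> * b) \<alpha> (Complex u (- ?k)))"
      by (rule kernel_relation_E[where k="?k"]) (use k in auto)
    have e: "x + \<i> * b + y = x + y + \<i> * b" "x + (y + \<i> * b) = x + y + \<i> * b" by (simp_all add: algebra_simps)
    have ds: "A * (c * S * G) = c * s1 * (P1 * G) + E0 * (c * s2 * (P2 * G))"
      if "A * S = s1 * P1 + E0 * s2 * P2" for A S G s1 P1 E0 s2 P2 :: complex
    proof -
      have "A * (c * S * G) = c * G * (A * S)" by (simp add: mult_ac)
      then show ?thesis unfolding that by (simp add: algebra_simps)
    qed
    show ?thesis
    proof (cases "0 \<le> \<alpha>")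
      case True
      then show ?thesis
        using ds[OF rel, of "g \<alpha> (x + y + \<i> * b)"]
        by (simp add: integrand_def p e exp_of_real[symmetric])
    qed (simp add: integrand_def p)
  qed
  show ?thesis
    unfolding Phi_def eq using i1 i2 by simp
qed

text \<open>The difference \<open>D\<close> of the two sides is integrated over \<open>u\<close>
  first. For fixed \<open>\<alpha>\<close> it is a constant times the difference of
  \<open>ker b\<close> on the lines \<open>- k - b\<close> and \<open>- k\<close>, whose integrals
  agree by Cauchy's theorem.\<close>

lemma Phi_relation_F:
  fixes x y :: real
  assumes g: "decaying g"
  shows "Phi (b + 4 * gap) (\<lambda>\<alpha> z. c * sfac (Q / 2 + \<i> * (of_real \<alpha> + 1 * z)) * g \<alpha> (z + - (\<i> * b))) x y
    = c * sfac (Q / 2 + \<i> * (l2 + y)) * Phi (b + 4 * gap) g x (y - \<i> * b)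
      + c * sfac (Q / 2 + \<i> * (l1 + x)) * (exp (2 * pi * b * y) * Phi (b + 4 * gap) g (x - \<i> * b) y)"
proof -
  let ?k = "b + 4 * gap"
  let ?g = "\<lambda>\<alpha> z. c * sfac (Q / 2 + \<i> * (of_real \<alpha> + 1 * z)) * g \<alpha> (z + - (\<i> * b))"
  define A where "A = c * sfac (Q / 2 + \<i> * (l2 + y))"
  define B where "B = c * sfac (Q / 2 + \<i> * (l1 + x)) * exp (2 * pi * b * y)"
  have k: "b < ?k" "?k < Q / 2" using gap_margin by linarith+
  have i0: "integrable lborel (integrand ?k ?g x y)"
    by (rule integrable_integrand[OF decaying_sfac[OF g] ok_F]) (use gap_margin b_pos in auto)
  have i1: "integrable lborel (integrand ?k g (x - \<i> * b) y)"
    by (rule integrable_integrand[OF g ok_F]) (use gap_margin b_pos in auto)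
  have i2: "integrable lborel (integrand ?k g x (y - \<i> * b))"
    by (rule integrable_integrand[OF g ok_F]) (use gap_margin b_pos in auto)
  define D where "D p = integrand ?k ?g x y p - A * integrand ?k g x (y - \<i> * b) p - B * integrand ?k g (x - \<i> * b) y p" for p
  have iD: "integrable (lborel \<Otimes>\<^sub>M lborel) D"
    unfolding D_def lborel_prod using i0 i1 i2 by simp
  have "(LINT u|lborel. D (\<alpha>, u)) = 0" for \<alpha>
  proof (cases "0 \<le> \<alpha>")
    case True
    define K where "K = c0 (complex_of_real x) * pre x y \<alpha> / sfac (t1 (complex_of_real x) (complex_of_real y) \<alpha> - b) * (c * g \<alpha> (x + y - \<i> * b))"
    have D: "D (\<alpha>, u) = K * (ker b x y \<alpha> (Complex u (- ?k - b)) - ker b x y \<alpha> (Complex u (- ?k)))" for u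
    proof -
      have rel: "pre x y \<alpha> * ker 0 x y \<alpha> (Complex u (- ?k)) * sfac (Q / 2 + \<i> * (\<alpha> + (complex_of_real x + y)))
    - sfac (Q / 2 + \<i> * (l2 + complex_of_real y)) * (pre x (y - \<i> * b) \<alpha> * ker 0 x (y - \<i> * b) \<alpha> (Complex u (- ?k)))
    - sfac (Q / 2 + \<i> * (l1 + complex_of_real x)) * exp (2 * pi * b * complex_of_real y) * (pre (x - \<i> * b) y \<alpha> * ker 0 (x - \<i> * b) y \<alpha> (Complex u (- ?k)))
    = c0 (complex_of_real x) * pre x y \<alpha> / sfac (t1 (complex_of_real x) (complex_of_real y) \<alpha> - b) * (ker b x y \<alpha> (Complex u (- ?k) - \<i> * b) - ker b x y \<alpha> (Complex u (- ?k)))"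
        by (rule kernel_relation_F[where k="?k"]) (use k in auto)
      have e: "x - \<i> * b + y = x + y - \<i> * b" "x + (y - \<i> * b) = x + y - \<i> * b" by (simp_all add: algebra_simps)
      have e': "Complex u (- ?k) - \<i> * b = Complex u (- ?k - b)" by (simp add: complex_eq_iff)
      have ds: "P * (c * S * G) - (c * s2) * (P2 * G) - (c * s1 * E0) * (P1 * G) = T * (c * G) * V"
        if "P * S - s2 * P2 - s1 * E0 * P1 = T * V" for P S G s1 P1 E0 s2 P2 T V :: complex
      proof -
        have "P * (c * S * G) - (c * s2) * (P2 * G) - (c * s1 * E0) * (P1 * G) = c * G * (P * S - s2 * P2 - s1 * E0 * P1)"
          by (simp add: algebra_simps)
        then show ?thesis unfolding that by (simp add: mult_ac)
      qed
      show ?thesis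
        using ds[OF rel, of "g \<alpha> (x + y - \<i> * b)"] True
        unfolding e' by (simp add: D_def integrand_def e A_def B_def K_def exp_of_real[symmetric])
    qed
    \<comment> \<open>Since \<open>s = b\<close> is subtracted in four arguments, the numerator
      stays above \<open>0\<close> on the upper line and the denominators stay below
      \<open>Q\<close> on the lower one.\<close>
    have "ker_ok margin b (- Im r) x y" if "- ?k - b - margin \<le> Im r" "Im r \<le> - ?k + margin" for r
      unfolding ker_ok_def Im_complex_of_real using that gap_margin b_pos by (intro conjI; linarith)
    note sh = ker_line_shift[OF _ True gap_margin(2) _ this]
    have eQ: "margin \<le> Q / 2" using gap_margin b_pos by linarith
    have kb: "- ?k - b \<le> - ?k" using b_pos by simp
    have li: "integrable lborel (\<lambda>u. ker b x y \<alpha> (Complex u (- ?k - b)))" "integrable lborel (\<lambda>u. ker b x y \<alpha> (Complex u (- ?k)))"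
      using sh(2,3)[OF kb eQ] by (simp_all add: line_integrable_def)
    have "(LINT u|lborel. D (\<alpha>, u)) = K * (line_integral (- ?k - b) (ker b x y \<alpha>) - line_integral (- ?k) (ker b x y \<alpha>))"
      unfolding D line_integral_def using li by simp
    then show ?thesis using sh(1)[OF kb eQ] by simp
  qed (simp add: D_def integrand_def)
  then have "integral\<^sup>L (lborel \<Otimes>\<^sub>M lborel) D = 0"
    using lborel_pair.integral_fst'[OF iD] by simp
  then have "Phi ?k ?g x y - A * Phi ?k g x (y - \<i> * b) - B * Phi ?k g (x - \<i> * b) y = 0"
    unfolding D_def lborel_prod Phi_def using i0 i1 i2 by simp
  then show ?thesis by (simp add: A_def B_def mult.assoc algebra_simps)
qed

section \<open>The positive representations written with sines\<close>

definition "qc = \<i> / (qpar b - inverse (qpar b))"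

text \<open>As \<open>pi * b^2\<close> lies in \<open>(0, pi)\<close>, the principal logarithm of
  \<open>q\<close> is \<open>pi * i * b^2\<close>. Multiplying it by the representation's argument
  yields \<open>pi * i * b * (Q / 2 + i * w)\<close>.\<close>

lemma qnum_eq_sfac: "qnum (qpar b) (Q / (2 * b) + \<i> / b * w) = qc * sfac (Q / 2 + \<i> * w)"
proof -
  have "0 < pi * b^2" "pi * b^2 < pi"
    using b_pos b_less power_strict_mono[of b 1 2] by auto
  then have "Ln (qpar b) = pi * \<i> * (complex_of_real b)^2"
    unfolding qpar_def using pi_gt_zero by (intro Ln_exp; simp add: power2_eq_square flip: of_real_mult; linarith)
  then have pw: "qpar b powr z = exp (z * (pi * \<i> * (complex_of_real b)^2))" for z
    by (simp add: powr_def qpar_def)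
  have e: "(Q / (2 * b) + \<i> / b * w) * (pi * \<i> * (complex_of_real b)^2) = pi * \<i> * b * (Q / 2 + \<i> * w)"
    using b_pos by (simp add: power2_eq_square field_simps)
  have "qpar b powr (Q / (2 * b) + \<i> / b * w) - qpar b powr (- (Q / (2 * b) + \<i> / b * w))
      = exp (pi * \<i> * b * (Q / 2 + \<i> * w)) - exp (- (pi * \<i> * b * (Q / 2 + \<i> * w)))"
    unfolding pw mult_minus_left e ..
  also have "\<dots> = \<i> * sfac (Q / 2 + \<i> * w)" unfolding sfac_eq by simp
  finally show ?thesis by (simp add: qnum_def qc_def)
qed

lemma act_E:
  fixes z :: real
  assumes "continues b f \<phi>"
  shows "act b l E f z = qc * sfac (Q / 2 + \<i> * (of_real l - of_real z)) * \<phi> (z + \<i> * b)"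
  using qnum_eq_sfac[of "complex_of_real (l - z)"] shift_eq[OF assms, of z]
  by (simp add: Complex_eq)

lemma act_F:
  fixes z :: real
  assumes "continues (- b) f \<phi>"
  shows "act b l F f z = qc * sfac (Q / 2 + \<i> * (of_real l + of_real z)) * \<phi> (z - \<i> * b)"
  using qnum_eq_sfac[of "complex_of_real (l + z)"] shift_eq[OF assms, of z]
  by (simp add: Complex_eq)

lemma decaying_continues:
  assumes "decaying g" "\<And>\<alpha> z. f \<alpha> z = g \<alpha> (of_real z)"
  shows "continues a (f \<alpha>) (g \<alpha>)"
  using assms unfolding continues_def decaying_def
  by (auto simp: analytic_on_open intro: analytic_on_subset[of _ UNIV])

text \<open>Both transforms are evaluated at the same height \<open>- 4 * gap\<close>, although
  \<open>h\<close> is arbitrary: \<open>act b \<alpha> E (f \<alpha>)\<close> again comes from a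
  decaying function.\<close>

lemma intertwines_E:
  assumes sep: "\<And>x y \<alpha>. 0 \<le> \<alpha> \<Longrightarrow> separates b l1 l2 y \<alpha> (x + y) (h x y \<alpha>)"
    and g: "decaying g" and f: "\<And>\<alpha> z. f \<alpha> z = g \<alpha> (of_real z)"
  shows "transform_converges b l1 l2 h (\<lambda>\<alpha>. act b \<alpha> E (f \<alpha>))"
    and "in_coproduct_domain b l2 E (transform b l1 l2 h f)"
    and "transform b l1 l2 h (\<lambda>\<alpha>. act b \<alpha> E (f \<alpha>)) = coproduct_act b l1 l2 E (transform b l1 l2 h f)"
proof -
  let ?k = "4 * gap"
  have k: "0 < ?k" "?k < Q / 2" using gap_margin b_pos by linarith+
  let ?g = "\<lambda>\<alpha> z. qc * sfac (Q / 2 + \<i> * (of_real \<alpha> + (- 1) * z)) * g \<alpha> (z + \<i> * b)"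
  have g': "decaying ?g" by (rule decaying_sfac[OF g]) simp
  have f': "act b \<alpha> E (f \<alpha>) z = ?g \<alpha> (of_real z)" for \<alpha> z
    using act_E[OF decaying_continues[OF g f]] by simp
  have tf: "transform b l1 l2 h f = (\<lambda>x y. Phi ?k g x y)"
    using transform_eq_Phi(2)[OF sep g f k] by blast
  have tf': "transform b l1 l2 h (\<lambda>\<alpha>. act b \<alpha> E (f \<alpha>)) = (\<lambda>x y. Phi ?k ?g x y)"
    using transform_eq_Phi(2)[OF sep g' f' k] by blast
  show "transform_converges b l1 l2 h (\<lambda>\<alpha>. act b \<alpha> E (f \<alpha>))"
    by (rule transform_eq_Phi(1)[OF sep g' f' k])
  show "in_coproduct_domain b l2 E (transform b l1 l2 h f)"
    unfolding tf in_coproduct_domain_def in_tensor_domain_def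
    by (simp add: shiftable_I[OF Phi_continues(1)[OF g]] shiftable_I[OF Phi_continues(2)[OF g]])
  show "transform b l1 l2 h (\<lambda>\<alpha>. act b \<alpha> E (f \<alpha>)) = coproduct_act b l1 l2 E (transform b l1 l2 h f)"
  proof (intro ext)
    fix x y :: real
    have "coproduct_act b l1 l2 E (\<lambda>x y. Phi ?k g x y) x y
        = act b l1 E (\<lambda>x. Phi ?k g x y) x + exp (- 2 * pi * b * x) * act b l2 E (\<lambda>y. Phi ?k g x y) y"
      by (simp add: coproduct_act_def tensor_act_def)
    also have "\<dots> = qc * sfac (Q / 2 + \<i> * (l1 - x)) * Phi ?k g (x + \<i> * b) y
      + exp (- 2 * pi * b * x) * (qc * sfac (Q / 2 + \<i> * (l2 - y)) * Phi ?k g x (y + \<i> * b))"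
      unfolding act_E[OF Phi_continues(1)[OF g]] act_E[OF Phi_continues(2)[OF g]] by simp
    finally show "transform b l1 l2 h (\<lambda>\<alpha>. act b \<alpha> E (f \<alpha>)) x y = coproduct_act b l1 l2 E (transform b l1 l2 h f) x y"
      unfolding tf tf' Phi_relation_E[OF g] by simp
  qed
qed

lemma intertwines_F:
  assumes sep: "\<And>x y \<alpha>. 0 \<le> \<alpha> \<Longrightarrow> separates b l1 l2 y \<alpha> (x + y) (h x y \<alpha>)"
    and g: "decaying g" and f: "\<And>\<alpha> z. f \<alpha> z = g \<alpha> (of_real z)"
  shows "transform_converges b l1 l2 h (\<lambda>\<alpha>. act b \<alpha> F (f \<alpha>))"
    and "in_coproduct_domain b l2 F (transform b l1 l2 h f)"
    and "transform b l1 l2 h (\<lambda>\<alpha>. act b \<alpha> F (f \<alpha>)) = coproduct_act b l1 l2 F (transform b l1 l2 h f)"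
proof -
  let ?k = "b + 4 * gap"
  have k: "0 < ?k" "?k < Q / 2" using gap_margin b_pos by linarith+
  let ?g = "\<lambda>\<alpha> z. qc * sfac (Q / 2 + \<i> * (of_real \<alpha> + 1 * z)) * g \<alpha> (z + - (\<i> * b))"
  have g': "decaying ?g" by (rule decaying_sfac[OF g]) simp
  have f': "act b \<alpha> F (f \<alpha>) z = ?g \<alpha> (of_real z)" for \<alpha> z
    using act_F[OF decaying_continues[OF g f]] by simp
  have tf: "transform b l1 l2 h f = (\<lambda>x y. Phi ?k g x y)"
    using transform_eq_Phi(2)[OF sep g f k] by blast
  have tf': "transform b l1 l2 h (\<lambda>\<alpha>. act b \<alpha> F (f \<alpha>)) = (\<lambda>x y. Phi ?k ?g x y)"
    using transform_eq_Phi(2)[OF sep g' f' k] by blast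
  \<comment> \<open>The summand \<open>F \<otimes> Kinv\<close> applies \<open>Kinv\<close> in
    \<open>y\<close> first; for fixed \<open>y\<close> its factor is a constant and passes through
    the continuation in \<open>x\<close>.\<close>
  have cm: "continues (- b) (\<lambda>x. of_real (exp (2 * pi * b * y)) * Phi ?k g x y)
      (\<lambda>z. of_real (exp (2 * pi * b * y)) * Phi ?k g z y)" for y :: real
    using Phi_continues(3)[OF g, of y] by (auto simp: continues_def intro!: analytic_intros)
  show "transform_converges b l1 l2 h (\<lambda>\<alpha>. act b \<alpha> F (f \<alpha>))"
    by (rule transform_eq_Phi(1)[OF sep g' f' k])
  show "in_coproduct_domain b l2 F (transform b l1 l2 h f)"
    unfolding tf in_coproduct_domain_def in_tensor_domain_def
    by (simp add: shiftable_I[OF Phi_continues(4)[OF g]] shiftable_I[OF cm, simplified])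
  show "transform b l1 l2 h (\<lambda>\<alpha>. act b \<alpha> F (f \<alpha>)) = coproduct_act b l1 l2 F (transform b l1 l2 h f)"
  proof (intro ext)
    fix x y :: real
    have "coproduct_act b l1 l2 F (\<lambda>x y. Phi ?k g x y) x y
        = act b l2 F (\<lambda>y. Phi ?k g x y) y + act b l1 F (\<lambda>x. of_real (exp (2 * pi * b * y)) * Phi ?k g x y) x"
      by (simp add: coproduct_act_def tensor_act_def)
    also have "\<dots> = qc * sfac (Q / 2 + \<i> * (l2 + y)) * Phi ?k g x (y - \<i> * b)
      + qc * sfac (Q / 2 + \<i> * (l1 + x)) * (exp (2 * pi * b * y) * Phi ?k g (x - \<i> * b) y)"
      unfolding act_F[OF Phi_continues(4)[OF g]] act_F[OF cm] by simp
    finally show "transform b l1 l2 h (\<lambda>\<alpha>. act b \<alpha> F (f \<alpha>)) x y = coproduct_act b l1 l2 F (transform b l1 l2 h f) x y"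
      unfolding tf tf' Phi_relation_F[OF g] by simp
  qed
qed

lemma intertwines_K:
  assumes sep: "\<And>x y \<alpha>. 0 \<le> \<alpha> \<Longrightarrow> separates b l1 l2 y \<alpha> (x + y) (h x y \<alpha>)"
    and g: "decaying g" and f: "\<And>\<alpha> z. f \<alpha> z = g \<alpha> (of_real z)"
  shows "transform_converges b l1 l2 h (\<lambda>\<alpha>. act b \<alpha> K (f \<alpha>))"
    and "in_coproduct_domain b l2 K (transform b l1 l2 h f)"
    and "transform b l1 l2 h (\<lambda>\<alpha>. act b \<alpha> K (f \<alpha>)) = coproduct_act b l1 l2 K (transform b l1 l2 h f)"
proof -
  let ?k = "4 * gap"
  have k: "0 < ?k" "?k < Q / 2" using gap_margin b_pos by linarith+
  let ?g = "\<lambda>\<alpha> z. exp (of_real (- 2 * pi * b) * z) * g \<alpha> z"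
  have g': "decaying ?g" by (rule decaying_exp[OF g])
  have f': "act b \<alpha> K (f \<alpha>) z = ?g \<alpha> (of_real z)" for \<alpha> z
    by (simp add: f exp_of_real[symmetric])
  have tf: "transform b l1 l2 h f = (\<lambda>x y. Phi ?k g x y)"
    using transform_eq_Phi(2)[OF sep g f k] by blast
  have tf': "transform b l1 l2 h (\<lambda>\<alpha>. act b \<alpha> K (f \<alpha>)) = (\<lambda>x y. Phi ?k ?g x y)"
    using transform_eq_Phi(2)[OF sep g' f' k] by blast
  show "transform_converges b l1 l2 h (\<lambda>\<alpha>. act b \<alpha> K (f \<alpha>))"
    by (rule transform_eq_Phi(1)[OF sep g' f' k])
  show "in_coproduct_domain b l2 K (transform b l1 l2 h f)"
    unfolding in_coproduct_domain_def in_tensor_domain_def by simp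
  show "transform b l1 l2 h (\<lambda>\<alpha>. act b \<alpha> K (f \<alpha>)) = coproduct_act b l1 l2 K (transform b l1 l2 h f)"
  proof (intro ext)
    fix x y :: real
    define c :: complex where "c = exp (of_real (- 2 * pi * b) * (of_real x + of_real y))"
    have "integrand ?k ?g x y = (\<lambda>p. c * integrand ?k g x y p)"
      by (rule ext) (simp add: integrand_def c_def case_prod_beta)
    then have "Phi ?k ?g x y = c * Phi ?k g x y"
      unfolding Phi_def by (simp only: integral_mult_right_zero)
    moreover have "c = of_real (exp (- 2 * pi * b * x)) * of_real (exp (- 2 * pi * b * y))"
      by (simp add: c_def exp_of_real[symmetric] exp_add[symmetric] algebra_simps)
    ultimately show "transform b l1 l2 h (\<lambda>\<alpha>. act b \<alpha> K (f \<alpha>)) x y = coproduct_act b l1 l2 K (transform b l1 l2 h f) x y"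
      unfolding tf tf' by (simp add: coproduct_act_def tensor_act_def)
  qed
qed

end

theorem theorem4p8:
  fixes b l\<^sub>1 l\<^sub>2 :: real
    and h :: "real \<Rightarrow> real \<Rightarrow> real \<Rightarrow> real"
    and f :: "real \<Rightarrow> real \<Rightarrow> complex"
    and X :: gen
  assumes "0 < b" and "b < 1" and "b^2 \<notin> \<rat>"
    and "0 \<le> l\<^sub>1" and "0 \<le> l\<^sub>2"
    and "\<And>x y \<alpha>. 0 \<le> \<alpha> \<Longrightarrow> separates b l\<^sub>1 l\<^sub>2 y \<alpha> (x + y) (h x y \<alpha>)"
    and "test_function f"
    and "X \<in> {E, F, K}"
  shows "transform_converges b l\<^sub>1 l\<^sub>2 h f
       \<and> (\<forall>\<alpha>\<ge>0. in_domain b X (f \<alpha>))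
       \<and> transform_converges b l\<^sub>1 l\<^sub>2 h (\<lambda>\<alpha>. act b \<alpha> X (f \<alpha>))
       \<and> in_coproduct_domain b l\<^sub>2 X (transform b l\<^sub>1 l\<^sub>2 h f)
       \<and> transform b l\<^sub>1 l\<^sub>2 h (\<lambda>\<alpha>. act b \<alpha> X (f \<alpha>))
         = coproduct_act b l\<^sub>1 l\<^sub>2 X (transform b l\<^sub>1 l\<^sub>2 h f)"
proof -
  interpret cg_kernel_setup b l\<^sub>1 l\<^sub>2
    using assms by unfold_locales auto
  note sep = assms(6)
  obtain g where g: "decaying g" and f: "\<And>\<alpha> z. f \<alpha> z = g \<alpha> (of_real z)"
    using test_function_decaying[OF assms(7)] by blast
  \<comment> \<open>Any height strictly between \<open>0\<close> and \<open>Q / 2\<close> would do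
    to establish convergence.\<close>
  have "0 < Q / 4" "Q / 4 < Q / 2" using Q_pos by auto
  then have conv: "transform_converges b l\<^sub>1 l\<^sub>2 h f"
    using transform_eq_Phi(1)[OF sep g f] by blast
  have dom: "in_domain b X (f \<alpha>)" for \<alpha>
    using assms(8) shiftable_I[OF decaying_continues[OF g f]] by auto
  from assms(8) consider "X = E" | "X = F" | "X = K" by auto
  then show ?thesis
  proof cases
    case 1
    then show ?thesis using conv dom intertwines_E[OF sep g f] by simp
  next
    case 2
    then show ?thesis using conv dom intertwines_F[OF sep g f] by simp
  next
    case 3
    then show ?thesis using conv dom intertwines_K[OF sep g f] by simp
  qed
qed

end
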